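(* For every diagonal $\lambda_+/\lambda_-$ of $R$ and every $w\in S_n$, the filling $T_w$ of $R$ defined below is a standard Young tableau of shape $R$ (its entries are $1,2,\dots,mn$, each once, strictly increasing along rows and down columns). Moreover, $T_w$ does not depend on the choice of the diagonal $\lambda_+/\lambda_-$.
   Context: Fix integers $m\ge n\ge 1$. Young diagrams are drawn in English convention (row $1$ on top); "above" means in a row of smaller index, "to the right" means in a column of larger index. Let $R$ be a rectangular Young diagram with either $n$ rows and $m$ columns, or $m$ rows and $n$ columns. A diagonal of $R$ is a skew shape $\lambda_+/\lambda_-$ ($\lambda_-\subseteq\lambda_+\subseteq R$ Young diagrams) consisting of exactly $n$ boxes $b_1,\dots,b_n$ with $b_{i+1}$ strictly above and strictly to the right of $b_i$ ($1\le i\le n-1$). $T[x]$ is the entry of a filling $T$ in box $x$. Jeu de taquin: for a filling $T$ with entries strictly increasing along rows and columns and an empty box $x$, sliding $x$ through $T$ means: while the empty box has a filled neighbour immediately to its right or immediately below, move the smaller of these entries into the empty box. Reverse-sliding $x$ through $T$ means: while the empty box has a filled neighbour immediately to its left or immediately above, move the larger of these entries into the empty box. The box where the empty box ends is the final position of the sliding path. Construction of $T^{\lambda_+}_w$ ($w\in S_n$): start with $T[b_i]=w(i)$, boxes of $\lambda_-$ unfilled. While the filled boxes are not all of $\lambda_+$: let $\mu\subseteq\lambda_+$ be the Young diagram of unfilled boxes; choose a corner box $x$ of $\mu$ (removing it leaves a Young diagram); slide $x$ through $T$ to get $T'$; if the final position of the path is $b_i$, set $T'[b_i]:=T[b_i]+n$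 ($T[b_i]$ the entry before the slide); replace $T$ by $T'$. Output $T^{\lambda_+}_w$. Construction of $T^{R/\lambda_-}_w$: start with $T[b_i]=w(i)+(m-1)n$, boxes of $R/\lambda_+$ unfilled. While the filled boxes are not all of $R/\lambda_-$: the unfilled boxes of $R/\lambda_-$ form a set $R/\nu$ with $\nu$ a Young diagram; choose a box $x\in R/\nu$ such that $\nu\cup\{x\}$ is a Young diagram; reverse-slide $x$ through $T$ to get $T'$; if the final position of the path is $b_i$, set $T'[b_i]:=T[b_i]-n$; replace $T$ by $T'$. Output $T^{R/\lambda_-}_w$. Both outputs are independent of the choices made. Define $T_w$ on $R$ by $T_w[x]=T^{\lambda_+}_w[x]$ if $x\in\lambda_+$ and $T_w[x]=T^{R/\lambda_-}_w[x]$ otherwise. *)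

theory Defs
  imports "HOL-Combinatorics.Permutations"
begin

text \<open>A box is a pair (row, column), both counted from 1; row 1 is the top row and column 1 the
  leftmost column. The pairs with a coordinate 0, which occur below as the box above row 1
  or left of column 1, belong to no Young diagram and hence are never filled.\<close>

type_synonym box = "nat \<times> nat"

definition young_diagram :: "box set \<Rightarrow> bool" where
  "young_diagram L \<longleftrightarrow> finite L \<and> L \<subseteq> {1..} \<times> {1..} \<and>
     (\<forall>r c r' c'. (r, c) \<in> L \<and> 1 \<le> r' \<and> r' \<le> r \<and> 1 \<le> c' \<and> c' \<le> c \<longrightarrow> (r', c') \<in> L)"

definition rect :: "nat \<Rightarrow> nat \<Rightarrow> box set" where
  "rect p q = {1..p} \<times> {1..q}"

text \<open>The enumeration \<open>b 1, \<dots>, b n\<close> of the boxes from bottom left to top right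
  is determined by the two Young diagrams; the values of \<open>b\<close> outside \<open>{1..n}\<close> are
  irrelevant.\<close>

definition diagonal :: "nat \<Rightarrow> box set \<Rightarrow> box set \<Rightarrow> box set \<Rightarrow> (nat \<Rightarrow> box) \<Rightarrow> bool" where
  "diagonal n R Lm Lp b \<longleftrightarrow>
     young_diagram Lm \<and> young_diagram Lp \<and> Lm \<subseteq> Lp \<and> Lp \<subseteq> R \<and>
     Lp - Lm = b ` {1..n} \<and> card (Lp - Lm) = n \<and>
     (\<forall>i. 1 \<le> i \<and> i \<le> n - 1 \<longrightarrow>
        fst (b (i + 1)) < fst (b i) \<and> snd (b i) < snd (b (i + 1)))"

text \<open>The domain of a filling is its set of filled boxes. Entries are integers, so that
  subtracting \<open>n\<close> does not truncate.\<close>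

type_synonym filling = "box \<Rightarrow> int option"

definition standard_young_tableau :: "box set \<Rightarrow> filling \<Rightarrow> bool" where
  "standard_young_tableau L T \<longleftrightarrow> dom T = L \<and>
     bij_betw (\<lambda>x. the (T x)) L {1..int (card L)} \<and>
     (\<forall>r c c'. (r, c) \<in> L \<and> (r, c') \<in> L \<and> c < c' \<longrightarrow> the (T (r, c)) < the (T (r, c'))) \<and>
     (\<forall>r r' c. (r, c) \<in> L \<and> (r', c) \<in> L \<and> r < r' \<longrightarrow> the (T (r, c)) < the (T (r', c)))"

fun right_of below left_of above :: "box \<Rightarrow> box" where
  "right_of (r, c) = (r, c + 1)"
| "below (r, c) = (r + 1, c)"
| "left_of (r, c) = (r, c - 1)"
| "above (r, c) = (r - 1, c)"

text \<open>The box whose entry is moved into the empty box \<open>x\<close>, if any. In the constructions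
  below the two candidate entries are always distinct, so the treatment of ties is immaterial.\<close>

definition slide_source :: "filling \<Rightarrow> box \<Rightarrow> box option" where
  "slide_source T x =
     (case (T (right_of x), T (below x)) of
        (None, None) \<Rightarrow> None
      | (Some a, None) \<Rightarrow> Some (right_of x)
      | (None, Some d) \<Rightarrow> Some (below x)
      | (Some a, Some d) \<Rightarrow> Some (if a < d then right_of x else below x))"

definition rev_slide_source :: "filling \<Rightarrow> box \<Rightarrow> box option" where
  "rev_slide_source T x =
     (case (T (left_of x), T (above x)) of
        (None, None) \<Rightarrow> None
      | (Some a, None) \<Rightarrow> Some (left_of x)
      | (None, Some d) \<Rightarrow> Some (above x)
      | (Some a, Some d) \<Rightarrow> Some (if a > d then left_of x else above x))"

text \<open>\<open>slides src T x T' z\<close>: moving the empty box \<open>x\<close> through \<open>T\<close> according to \<open>src\<close>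
  until it stops yields \<open>T'\<close>, with final position \<open>z\<close> (which is empty in \<open>T'\<close>).\<close>

inductive slides :: "(filling \<Rightarrow> box \<Rightarrow> box option) \<Rightarrow> filling \<Rightarrow> box \<Rightarrow> filling \<Rightarrow> box \<Rightarrow> bool"
  for src where
  stop: "src T x = None \<Longrightarrow> slides src T x T x"
| move: "src T x = Some y \<Longrightarrow> slides src (T(x := T y, y := None)) y T' z \<Longrightarrow> slides src T x T' z"

text \<open>\<open>T\<close> is the filling before the slide, \<open>T'\<close> the one after it and \<open>z\<close> the final position.\<close>

definition refill :: "nat \<Rightarrow> (nat \<Rightarrow> box) \<Rightarrow> int \<Rightarrow> filling \<Rightarrow> filling \<Rightarrow> box \<Rightarrow> filling" where
  "refill n b k T T' z = (if z \<in> b ` {1..n} then T'(z := Some (the (T z) + k)) else T')"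

definition diagonal_filling :: "nat \<Rightarrow> (nat \<Rightarrow> box) \<Rightarrow> (nat \<Rightarrow> int) \<Rightarrow> filling" where
  "diagonal_filling n b e = map_of (map (\<lambda>i. (b i, e i)) [1..<n + 1])"

definition lower_step :: "nat \<Rightarrow> box set \<Rightarrow> (nat \<Rightarrow> box) \<Rightarrow> filling \<Rightarrow> filling \<Rightarrow> bool" where
  "lower_step n Lp b T T'' \<longleftrightarrow> dom T \<noteq> Lp \<and>
     (\<exists>\<mu> x T' z. \<mu> = Lp - dom T \<and> x \<in> \<mu> \<and> young_diagram (\<mu> - {x}) \<and>
        slides slide_source T x T' z \<and> T'' = refill n b (int n) T T' z)"

definition lower_output ::
  "nat \<Rightarrow> box set \<Rightarrow> (nat \<Rightarrow> box) \<Rightarrow> (nat \<Rightarrow> nat) \<Rightarrow> filling \<Rightarrow> bool" where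
  "lower_output n Lp b w T \<longleftrightarrow>
     (lower_step n Lp b)\<^sup>*\<^sup>* (diagonal_filling n b (\<lambda>i. int (w i))) T \<and> dom T = Lp"

definition upper_step ::
  "nat \<Rightarrow> box set \<Rightarrow> box set \<Rightarrow> (nat \<Rightarrow> box) \<Rightarrow> filling \<Rightarrow> filling \<Rightarrow> bool" where
  "upper_step n R Lm b T T'' \<longleftrightarrow> dom T \<noteq> R - Lm \<and>
     (\<exists>\<nu> x T' z. \<nu> = R - ((R - Lm) - dom T) \<and> x \<in> R - \<nu> \<and> young_diagram (\<nu> \<union> {x}) \<and>
        slides rev_slide_source T x T' z \<and> T'' = refill n b (- int n) T T' z)"

definition upper_output ::
  "nat \<Rightarrow> nat \<Rightarrow> box set \<Rightarrow> box set \<Rightarrow> (nat \<Rightarrow> box) \<Rightarrow> (nat \<Rightarrow> nat) \<Rightarrow> filling \<Rightarrow> bool" where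
  "upper_output m n R Lm b w T \<longleftrightarrow>
     (upper_step n R Lm b)\<^sup>*\<^sup>*
       (diagonal_filling n b (\<lambda>i. int (w i) + (int m - 1) * int n)) T \<and> dom T = R - Lm"

text \<open>The steps involve a choice of \<open>x\<close>; the definite descriptions below rely on the outputs
  existing and being independent of these choices.\<close>

definition T_lower :: "nat \<Rightarrow> box set \<Rightarrow> (nat \<Rightarrow> box) \<Rightarrow> (nat \<Rightarrow> nat) \<Rightarrow> filling" where
  "T_lower n Lp b w = (THE T. lower_output n Lp b w T)"

definition T_upper ::
  "nat \<Rightarrow> nat \<Rightarrow> box set \<Rightarrow> box set \<Rightarrow> (nat \<Rightarrow> box) \<Rightarrow> (nat \<Rightarrow> nat) \<Rightarrow> filling" where
  "T_upper m n R Lm b w = (THE T. upper_output m n R Lm b w T)"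

definition T_glued ::
  "nat \<Rightarrow> nat \<Rightarrow> box set \<Rightarrow> box set \<Rightarrow> box set \<Rightarrow> (nat \<Rightarrow> box) \<Rightarrow> (nat \<Rightarrow> nat) \<Rightarrow> filling" where
  "T_glued m n R Lm Lp b w =
     (\<lambda>x. if x \<in> Lp then T_lower n Lp b w x
          else if x \<in> R then T_upper m n R Lm b w x
          else None)"

end

theory Submission
  imports Defs
begin

text \<open>Every residue class modulo \<open>n\<close> belongs to one box \<open>b i\<close>; call \<open>i\<close> the index of its letters. Let a
  letter that does not occur in a filling wait in the box of its index. Refilling a box then moves no letter, and
  a slide moves letters one step up or to the left. Reading the rows (columns) of all letters
  in a window as a word, one step of a slide never increases the maximal size of a union of \<open>a\<close> weakly
  decreasing subsequences, so these Greene invariants stay below those of the periodic word of the indices.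

  On the staircase, where \<open>b i\<close> is the \<open>i\<close>-th antidiagonal box, an upper bound for the invariants of a periodic
  word and a count of boxes leave no freedom: the final entries of the corners are determined, and neighbouring
  ones differ by less than \<open>n\<close>. For such corner entries the steps of a slide also do not decrease the
  invariants. Promoting a staircase tableau from far in the past, when all positive letters were still
  waiting, produces a tableau \<open>D\<close> whose invariants equal those of the periodic word. Any output on a shape
  with one corner in each row has smaller invariants, and comparing it with \<open>D\<close> letter by letter shows
  that it has the same rows. Hence its entries can be read off from \<open>D\<close>: the construction does not depend on
  the choices nor on the diagonal. Shapes with one corner in each column follow by transposition.

  Rotating the rectangle and replacing \<open>x\<close> by \<open>mn + 1 - x\<close> turns the upper construction into a lower one. The
  formula for the corner entries shows that the two halves agree where they overlap and have no common
  letter elsewhere.\<close>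

section \<open>Unions of chains in words\<close>

text \<open>A letter moved up by a slide changes the word of rows in one place, from
  \<open>r + 1\<close> to \<open>r\<close>. This is a crystal operator, and it keeps all Greene
  invariants if ballot conditions hold on both sides of the moved letter. For the smaller letters
  the condition is automatic, whence an inequality on every shape. For the larger ones it involves
  the letters waiting in two neighbouring corners, and these can be matched only if the corner
  entries differ by less than \<open>n\<close>. Promotion avoids the obstacle: it leads from one
  full staircase to the next. As each promotion discards the smallest letter, it has to start far
  below \<open>0\<close>, and all comparisons must allow windows that begin late. In the comparison
  with \<open>D\<close> the row words keep a letter from lying too high; the column words are needed
  to keep it from lying too low. Hence every estimate has a transposed version.\<close>

definition chain_cover :: "nat \<Rightarrow> (int \<Rightarrow> int) \<Rightarrow> int set \<Rightarrow> bool" where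
  "chain_cover a \<rho> S \<longleftrightarrow> (\<exists>f :: int \<Rightarrow> nat. (\<forall>x\<in>S. f x < a) \<and>
     (\<forall>x\<in>S. \<forall>y\<in>S. x < y \<longrightarrow> f x = f y \<longrightarrow> \<rho> y \<le> \<rho> x))"

text \<open>Domination of all Greene invariants at once. Only sizes are compared, so a union of
  chains may be traded for a different set of letters.\<close>

definition covers_below :: "(int \<Rightarrow> int) \<Rightarrow> (int \<Rightarrow> int) \<Rightarrow> int set \<Rightarrow> bool" where
  "covers_below \<rho> \<sigma> X \<longleftrightarrow> (\<forall>a S. S \<subseteq> X \<longrightarrow> chain_cover a \<rho> S \<longrightarrow>
     (\<exists>S'. S' \<subseteq> X \<and> card S' = card S \<and> chain_cover a \<sigma> S'))"

lemma covers_belowD: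
  assumes "covers_below \<rho> \<sigma> X" "S \<subseteq> X" "chain_cover a \<rho> S"
  obtains S' where "S' \<subseteq> X" "card S' = card S" "chain_cover a \<sigma> S'"
proof -
  have "\<exists>S'. S' \<subseteq> X \<and> card S' = card S \<and> chain_cover a \<sigma> S'"
    using assms(1)[unfolded covers_below_def, rule_format, OF assms(2,3)] .
  then show ?thesis using that by auto
qed

lemma covers_below_trans:
  assumes 1: "covers_below \<rho> \<sigma> X" and 2: "covers_below \<sigma> \<tau> X"
  shows "covers_below \<rho> \<tau> X"
  unfolding covers_below_def
proof (intro allI impI)
  fix a S assume "S \<subseteq> X" "chain_cover a \<rho> S"
  then obtain S' where S': "S' \<subseteq> X" "card S' = card S" "chain_cover a \<sigma> S'"
    using covers_belowD[OF 1] by metis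
  then obtain S'' where "S'' \<subseteq> X" "card S'' = card S'" "chain_cover a \<tau> S''"
    using covers_belowD[OF 2] by metis
  then show "\<exists>S'. S' \<subseteq> X \<and> card S' = card S \<and> chain_cover a \<tau> S'"
    using S' by metis
qed

lemma chain_cover_cong:
  assumes "\<And>x y. x \<in> S \<Longrightarrow> y \<in> S \<Longrightarrow> x < y \<Longrightarrow> \<rho> y \<le> \<rho> x \<Longrightarrow> \<sigma> y \<le> \<sigma> x"
    and "chain_cover a \<rho> S"
  shows "chain_cover a \<sigma> S"
proof -
  obtain f :: "int \<Rightarrow> nat" where f: "\<forall>x\<in>S. f x < a"
    "\<forall>x\<in>S. \<forall>y\<in>S. x < y \<longrightarrow> f x = f y \<longrightarrow> \<rho> y \<le> \<rho> x"
    using assms(2) unfolding chain_cover_def by blast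
  show ?thesis unfolding chain_cover_def by (rule exI[of _ f]) (use f assms(1) in auto)
qed

text \<open>Only the relative order of the values matters. This later identifies the word of corner
  rows with the word of \<open>- idx\<close>.\<close>

lemma covers_below_order:
  assumes "\<And>x y. x \<in> X \<Longrightarrow> y \<in> X \<Longrightarrow> x < y \<Longrightarrow> \<rho> y \<le> \<rho> x \<Longrightarrow> \<sigma> y \<le> \<sigma> x"
  shows "covers_below \<rho> \<sigma> X"
  unfolding covers_below_def
proof (intro allI impI)
  fix a S assume S: "S \<subseteq> X" "chain_cover a \<rho> S"
  have "chain_cover a \<sigma> S"
    by (rule chain_cover_cong[OF _ S(2)]) (use S(1) assms in auto)
  then show "\<exists>S'. S' \<subseteq> X \<and> card S' = card S \<and> chain_cover a \<sigma> S'" using S(1) by blast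
qed

lemma covers_below_refl: "(\<And>x. x \<in> X \<Longrightarrow> \<rho> x = \<sigma> x) \<Longrightarrow> covers_below \<rho> \<sigma> X"
  by (rule covers_below_order) auto

text \<open>Read leftwards from \<open>\<tau>\<close>, the letters \<open>r + 1\<close> never fall
  behind the letters \<open>r\<close>. So every \<open>r\<close> before \<open>\<tau>\<close> has a
  partner \<open>r + 1\<close> between itself and \<open>\<tau>\<close>, and the letters
  \<open>r\<close> that a chain can no longer keep in front of \<open>\<tau>\<close> are replaced by
  such partners.\<close>

lemma covers_below_raise:
  fixes \<rho> :: "int \<Rightarrow> int"
  assumes fin: "finite X" and tau: "\<tau> \<in> X" and rho: "\<rho> \<tau> = r + 1"
    and ballot: "\<And>v. v < \<tau> \<Longrightarrow>
      card {x \<in> X. v \<le> x \<and> x < \<tau> \<and> \<rho> x = r} \<le> card {x \<in> X. v \<le> x \<and> x < \<tau> \<and> \<rho> x = r + 1}"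
  shows "covers_below (\<rho>(\<tau> := r)) \<rho> X"
  unfolding covers_below_def
proof (intro allI impI)
  fix a S
  assume SX: "S \<subseteq> X" and "chain_cover a (\<rho>(\<tau> := r)) S"
  then obtain f :: "int \<Rightarrow> nat" where fa: "\<And>x. x \<in> S \<Longrightarrow> f x < a"
    and f: "\<And>x y. x \<in> S \<Longrightarrow> y \<in> S \<Longrightarrow> x < y \<Longrightarrow> f x = f y \<Longrightarrow> (\<rho>(\<tau> := r)) y \<le> (\<rho>(\<tau> := r)) x"
    unfolding chain_cover_def by blast
  have finS: "finite S" using SX fin finite_subset by blast
  define k0 where "k0 = f \<tau>"
  \<comment> \<open>Exactly these elements break the chain of \<open>\<tau>\<close> when its value
    returns from \<open>r\<close> to \<open>r + 1\<close>.\<close>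
  define Bd where "Bd = {x \<in> S. f x = k0 \<and> x < \<tau> \<and> \<rho> x = r}"
  have finBd: "finite Bd" unfolding Bd_def using finS by auto
  show "\<exists>S'. S' \<subseteq> X \<and> card S' = card S \<and> chain_cover a \<rho> S'"
  proof (cases "\<tau> \<in> S \<and> Bd \<noteq> {}")
    case False
    have "chain_cover a \<rho> S"
      unfolding chain_cover_def
    proof (intro exI[of _ f] conjI ballI impI)
      fix x y assume xy: "x \<in> S" "y \<in> S" "x < y" "f x = f y"
      have le: "(\<rho>(\<tau> := r)) y \<le> (\<rho>(\<tau> := r)) x" using f xy by auto
      show "\<rho> y \<le> \<rho> x"
      proof (cases "y = \<tau>")
        case True
        then have "x \<notin> Bd" using False xy by auto
        then have "\<rho> x \<noteq> r" using xy True by (auto simp: Bd_def k0_def)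
        then show ?thesis using le True xy rho by auto
      next
        case False
        then show ?thesis using le rho by (cases "x = \<tau>") auto
      qed
    qed (use fa in auto)
    then show ?thesis using SX by blast
  next
    case True
    then have tS: "\<tau> \<in> S" and Bne: "Bd \<noteq> {}" by auto
    have k0rows: "\<rho> x \<ge> r" if "x \<in> S" "f x = k0" "x < \<tau>" for x
      using f[of x \<tau>] that tS by (auto simp: k0_def)
    have k0late: "\<rho> y \<le> r" if "y \<in> S" "f y = k0" "\<tau> < y" for y
      using f[of \<tau> y] that tS by (auto simp: k0_def)
    have k0mono: "\<rho> y \<le> \<rho> x" if "x \<in> S" "y \<in> S" "f x = f y" "x < y" "x \<noteq> \<tau>" "y \<noteq> \<tau>" for x y
      using f[of x y] that by auto
    show ?thesis
    proof (cases "\<exists>x\<in>S. \<exists>y\<in>S. f x \<noteq> k0 \<and> f x = f y \<and> x < \<tau> \<and> \<tau> < y \<and> \<rho> x = r + 1 \<and> \<rho> y = r + 1")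
      case True
      \<comment> \<open>A different chain that stands at height \<open>r + 1\<close> both before and
        after \<open>\<tau>\<close> can absorb \<open>\<tau>\<close>.\<close>
      then obtain x y where xy: "x \<in> S" "y \<in> S" "f x \<noteq> k0" "f x = f y" "x < \<tau>" "\<tau> < y"
        "\<rho> x = r + 1" "\<rho> y = r + 1" by auto
      have "chain_cover a \<rho> S"
        unfolding chain_cover_def
      proof (intro exI[of _ "f(\<tau> := f x)"] conjI ballI impI)
        fix u v assume uv: "u \<in> S" "v \<in> S" "u < v" "(f(\<tau> := f x)) u = (f(\<tau> := f x)) v"
        show "\<rho> v \<le> \<rho> u"
        proof (cases "u = \<tau>")
          case True
          then have "f v = f x" "v \<noteq> \<tau>" "x < v" using uv xy by auto
          then show ?thesis using k0mono[of x v] xy uv True rho by auto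
        next
          case False
          note ut = this
          show ?thesis
          proof (cases "v = \<tau>")
            case True
            then have "f u = f y" "u < y" using uv xy ut by auto
            then show ?thesis using k0mono[of u y] xy uv True ut rho by auto
          next
            case False
            then show ?thesis using k0mono uv ut by auto
          qed
        qed
      qed (use fa xy in auto)
      then show ?thesis using SX by blast
    next
      case noover: False
      define W where "W = {x \<in> S. f x \<noteq> k0 \<and> x < \<tau> \<and> \<rho> x = r + 1}"
      have finW: "finite W" unfolding W_def using finS by auto
      define m where "m = Min Bd"
      have m: "m \<in> Bd" "\<And>x. x \<in> Bd \<Longrightarrow> m \<le> x"
        unfolding m_def using finBd Bne by auto
      have mS: "m \<in> S" "f m = k0" "m < \<tau>" "\<rho> m = r" using m by (auto simp: Bd_def)
      have k0high: "x < m" if "x \<in> S" "f x = k0" "x < \<tau>" "\<rho> x = r + 1" for x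
      proof (rule ccontr)
        assume "\<not> x < m"
        then have "m < x" using that mS by (cases "x = m") auto
        then show False using k0mono[of m x] mS that by auto
      qed
      show ?thesis
      proof (cases "\<exists>u\<in>W. m < u")
        case False
        \<comment> \<open>no other chain interferes: trade the offending elements for elements of row \<open>r + 1\<close>\<close>
        define C where "C = {x \<in> X. m \<le> x \<and> x < \<tau> \<and> \<rho> x = r + 1}"
        have "card Bd \<le> card {x \<in> X. m \<le> x \<and> x < \<tau> \<and> \<rho> x = r}"
          by (rule card_mono) (use fin SX m in \<open>auto simp: Bd_def\<close>)
        also have "\<dots> \<le> card C" unfolding C_def using ballot mS by auto
        finally obtain M where M: "M \<subseteq> C" "card M = card Bd" "finite M"
          using obtain_subset_with_card_n by blast
        have Mdisj: "x \<notin> S" if "x \<in> M" for x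
        proof
          assume "x \<in> S"
          have x: "m \<le> x" "x < \<tau>" "\<rho> x = r + 1" using that M by (auto simp: C_def)
          have "m < x" using x mS by (cases "x = m") auto
          then show False using False k0high[of x] \<open>x \<in> S\<close> x by (cases "f x = k0") (auto simp: W_def)
        qed
        define S' where "S' = (S - Bd) \<union> M"
        have "card S' = card S"
        proof -
          have "card S' = card (S - Bd) + card M"
            unfolding S'_def by (rule card_Un_disjoint) (use finS M Mdisj in auto)
          also have "card (S - Bd) = card S - card Bd"
            by (rule card_Diff_subset) (use finBd in \<open>auto simp: Bd_def\<close>)
          moreover have "card Bd \<le> card S" by (rule card_mono) (auto simp: finS Bd_def)
          ultimately show ?thesis using M by auto
        qed
        moreover have "S' \<subseteq> X" using SX M by (auto simp: S'_def C_def)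
        moreover have "chain_cover a \<rho> S'"
          unfolding chain_cover_def
        proof (intro exI[of _ "\<lambda>x. if x \<in> M then k0 else f x"] conjI ballI impI)
          fix x assume "x \<in> S'"
          then show "(if x \<in> M then k0 else f x) < a" using fa tS by (auto simp: S'_def k0_def)
        next
          fix x y assume xy: "x \<in> S'" "y \<in> S'" "x < y"
            "(if x \<in> M then k0 else f x) = (if y \<in> M then k0 else f y)"
          have MM: "m \<le> z \<and> z < \<tau> \<and> \<rho> z = r + 1" if "z \<in> M" for z using that M by (auto simp: C_def)
          have lo: "\<rho> z \<ge> r + 1" if "z \<in> S" "z \<notin> Bd" "f z = k0" "z < \<tau>" for z
            using k0rows[of z] that by (auto simp: Bd_def)
          have hi: "\<rho> z \<le> r + 1" if "z \<in> S" "f z = k0" "z \<ge> m" for z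
            using k0late[of z] k0mono[of m z] that rho mS by (cases "z = \<tau>"; cases "z = m") auto
          show "\<rho> y \<le> \<rho> x"
          proof (cases "x \<in> M")
            case True
            then show ?thesis using MM[of x] MM[of y] hi[of y] xy by (cases "y \<in> M") (auto simp: S'_def)
          next
            case xM: False
            then have xS: "x \<in> S" "x \<notin> Bd" using xy by (auto simp: S'_def)
            show ?thesis
            proof (cases "y \<in> M")
              case True
              then show ?thesis using MM[of y] lo[of x] xS xy xM by auto
            next
              case False
              then have yS: "y \<in> S" "y \<notin> Bd" and ff: "f x = f y" using xy xM by (auto simp: S'_def)
              show ?thesis
              proof (cases "y = \<tau>")
                case True
                then show ?thesis using lo[of x] xS ff xy rho by (auto simp: k0_def)
              next
                case False
                then show ?thesis using k0mono[of x y] k0late[of y] xS yS ff xy rho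
                  by (cases "x = \<tau>") (auto simp: k0_def)
              qed
            qed
          qed
        qed
        ultimately show ?thesis by blast
      next
        case True
        \<comment> \<open>exchange the tails of the chain of \<open>\<tau>\<close> and of the chain of the last element
          \<open>u\<close> of row \<open>r + 1\<close> before \<open>\<tau>\<close>\<close>
        define u where "u = Max W"
        have Wne: "W \<noteq> {}" using True by auto
        have uW: "u \<in> W" "\<And>x. x \<in> W \<Longrightarrow> x \<le> u" unfolding u_def using finW Wne by auto
        have mu: "m < u" using True uW by fastforce
        have uS: "u \<in> S" "f u \<noteq> k0" "u < \<tau>" "\<rho> u = r + 1" using uW by (auto simp: W_def)
        define k1 where "k1 = f u"
        have k1high: "\<rho> y \<le> r" if "y \<in> S" "f y = k1" "u < y" for y
        proof -
          have "y \<noteq> \<tau>" using that uS by (auto simp: k1_def k0_def)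
          then have "\<rho> y \<le> r + 1" using k0mono[of u y] that uS by (auto simp: k1_def)
          moreover have "\<rho> y \<noteq> r + 1"
          proof
            assume e: "\<rho> y = r + 1"
            show False
            proof (cases "y < \<tau>")
              case True
              then have "y \<in> W" using that e uS by (auto simp: W_def k1_def)
              then show False using uW that by fastforce
            next
              case False
              then show False using noover uS that e \<open>y \<noteq> \<tau>\<close> by (auto simp: k1_def)
            qed
          qed
          ultimately show ?thesis by auto
        qed
        have k1low: "\<rho> y \<ge> r + 1" if "y \<in> S" "f y = k1" "y \<le> u" for y
          using k0mono[of y u] that uS by (cases "y = u") (auto simp: k1_def)
        \<comment> \<open>The exchange removes everything before \<open>u\<close> from the chain of
          \<open>\<tau>\<close>, so only the offenders beyond \<open>u\<close> still need
          replacements.\<close>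
        define B2 where "B2 = {x \<in> Bd. u < x}"
        have finB2: "finite B2" using finBd by (auto simp: B2_def)
        define C where "C = {x \<in> X. u + 1 \<le> x \<and> x < \<tau> \<and> \<rho> x = r + 1}"
        have "card B2 \<le> card {x \<in> X. u + 1 \<le> x \<and> x < \<tau> \<and> \<rho> x = r}"
          by (rule card_mono) (use fin SX in \<open>auto simp: Bd_def B2_def\<close>)
        also have "\<dots> \<le> card C"
        proof (cases "u + 1 < \<tau>")
          case True then show ?thesis unfolding C_def using ballot by auto
        next
          case False
          then have "{x \<in> X. u + 1 \<le> x \<and> x < \<tau> \<and> \<rho> x = r} = {}" by auto
          then show ?thesis by (metis card.empty zero_le)
        qed
        finally obtain M where M: "M \<subseteq> C" "card M = card B2" "finite M"
          using obtain_subset_with_card_n by blast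
        have Mdisj: "x \<notin> S" if "x \<in> M" for x
        proof
          assume "x \<in> S"
          have x: "u < x" "x < \<tau>" "\<rho> x = r + 1" using that M by (auto simp: C_def)
          show False
          proof (cases "f x = k0")
            case True then show False using k0high[of x] x \<open>x \<in> S\<close> mu by auto
          next
            case False then have "x \<in> W" using x \<open>x \<in> S\<close> by (auto simp: W_def)
            then show False using uW x by fastforce
          qed
        qed
        define S' where "S' = (S - B2) \<union> M"
        define g where "g = (\<lambda>x. if x \<in> M then k0 else if f x = k0 \<and> x < u then k1
          else if f x = k1 \<and> x \<le> u then k0 else f x)"
        have "card S' = card S"
        proof -
          have "card S' = card (S - B2) + card M"
            unfolding S'_def by (rule card_Un_disjoint) (use finS M Mdisj in auto)
          also have "card (S - B2) = card S - card B2"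
            by (rule card_Diff_subset) (use finB2 in \<open>auto simp: B2_def Bd_def\<close>)
          moreover have "card B2 \<le> card S" by (rule card_mono) (auto simp: finS Bd_def B2_def)
          ultimately show ?thesis using M by auto
        qed
        moreover have "S' \<subseteq> X" using SX M by (auto simp: S'_def C_def)
        moreover have "chain_cover a \<rho> S'"
          unfolding chain_cover_def
        proof (intro exI[of _ g] conjI ballI impI)
          fix x assume "x \<in> S'"
          then show "g x < a" using fa tS uS by (auto simp: S'_def k0_def k1_def g_def)
        next
          fix x y assume xy: "x \<in> S'" "y \<in> S'" "x < y" "g x = g y"
          have k01: "k0 \<noteq> k1" using uS by (auto simp: k1_def)
          have MM: "u < z \<and> z < \<tau> \<and> \<rho> z = r + 1" if "z \<in> M" for z using that M by (auto simp: C_def)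
          have SM: "z \<in> S" "z \<notin> B2" if "z \<in> S'" "z \<notin> M" for z using that by (auto simp: S'_def)
          have k0mid: "z < u \<or> \<tau> \<le> z" if "z \<in> S" "z \<notin> B2" "f z = k0" for z
          proof (rule ccontr)
            assume "\<not> ?thesis"
            then have z: "u \<le> z" "z < \<tau>" by auto
            have "z \<noteq> u" using that uS by auto
            then have "u < z" using z by auto
            have "z \<notin> Bd" using that \<open>u < z\<close> by (auto simp: B2_def)
            then have "\<rho> z > r" using k0rows[of z] that z by (auto simp: Bd_def)
            moreover have "\<rho> z \<le> r" using k0mono[of m z] mS mu \<open>u < z\<close> that z by auto
            ultimately show False by auto
          qed
          show "\<rho> y \<le> \<rho> x"
          proof (cases "g x = k0 \<or> g x = k1")
            case False
            then have "x \<notin> M" "y \<notin> M" "f x = f y" "f x \<noteq> k0"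
              using xy by (auto simp: g_def split: if_splits)
            moreover from this have "x \<noteq> \<tau>" "y \<noteq> \<tau>" unfolding k0_def by metis+
            ultimately show ?thesis using k0mono[of x y] SM(1)[of x] SM(1)[of y] xy by blast
          next
            case True
            then show ?thesis
            proof
              assume gx: "g x = k0"
              have g0: "z \<in> M \<or> (z \<in> S \<and> f z = k1 \<and> z \<le> u) \<or> (z \<in> S \<and> f z = k0 \<and> \<tau> \<le> z)"
                if "z \<in> S'" "g z = k0" for z
                using that SM[of z] k0mid[of z] k01 by (auto simp: g_def split: if_splits)
              have lo: "\<rho> z \<ge> r + 1" if "z \<in> S'" "g z = k0" "z < \<tau>" for z
                using g0[OF that(1,2)] MM[of z] k1low[of z] that by auto
              have hi: "\<rho> z \<le> r + 1" if "z \<in> S'" "g z = k0" "u < z" for z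
                using g0[OF that(1,2)] MM[of z] k0late[of z] that rho by (cases "z = \<tau>") auto
              show ?thesis
              proof (cases "x < \<tau> \<and> u < y")
                case True then show ?thesis using lo[of x] hi[of y] gx xy by auto
              next
                case False
                then consider "y \<le> u" | "\<tau> \<le> x" using uS xy by linarith
                then show ?thesis
                proof cases
                  case 1
                  then have "x \<in> S" "y \<in> S" "f x = k1" "f y = k1"
                    using g0[of x] g0[of y] MM[of x] MM[of y] uS xy gx by auto
                  then show ?thesis using k0mono[of x y] xy 1 uS by auto
                next
                  case 2
                  then have "x \<in> S" "y \<in> S" "f x = k0" "f y = k0"
                    using g0[of x] g0[of y] MM[of x] MM[of y] uS xy gx by auto
                  then show ?thesis using k0mono[of x y] k0late[of y] xy 2 rho by (cases "x = \<tau>") auto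
                qed
              qed
            next
              assume gx: "g x = k1"
              have g1: "z \<in> S \<and> ((f z = k0 \<and> z < u) \<or> (f z = k1 \<and> u < z))"
                if "z \<in> S'" "g z = k1" for z
                using that SM[of z] k01 by (auto simp: g_def split: if_splits)
              have lo: "\<rho> z \<ge> r" if "z \<in> S'" "g z = k1" "z < u" for z
                using g1[OF that(1,2)] k0rows[of z] that uS by auto
              have hi: "\<rho> z \<le> r" if "z \<in> S'" "g z = k1" "u < z" for z
                using g1[OF that(1,2)] k1high[of z] that by auto
              show ?thesis
              proof (cases "x < u \<and> u < y")
                case True then show ?thesis using lo[of x] hi[of y] gx xy by auto
              next
                case False
                have "z \<noteq> \<tau>" if "z \<in> S'" "g z = k1" for z
                  using g1[OF that] k01 uS unfolding k0_def by auto
                then have "x \<noteq> \<tau>" "y \<noteq> \<tau>" using xy gx by auto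
                moreover have "f x = f y" "x \<in> S" "y \<in> S"
                  using False g1[of x] g1[of y] xy gx by auto
                ultimately show ?thesis using k0mono[of x y] xy by blast
              qed
            qed
          qed
        qed
        ultimately show ?thesis by blast
      qed
    qed
  qed
qed

lemma chain_cover_reflect:
  "chain_cover a \<rho> S \<Longrightarrow> chain_cover a (\<lambda>x. - \<rho> (- x)) (uminus ` S)"
proof -
  assume "chain_cover a \<rho> S"
  then obtain f :: "int \<Rightarrow> nat" where f: "\<forall>x\<in>S. f x < a"
    "\<forall>x\<in>S. \<forall>y\<in>S. x < y \<longrightarrow> f x = f y \<longrightarrow> \<rho> y \<le> \<rho> x" unfolding chain_cover_def by blast
  show ?thesis unfolding chain_cover_def
    by (rule exI[of _ "\<lambda>x. f (- x)"]) (use f in auto)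
qed

lemma covers_below_reflect:
  assumes "covers_below (\<lambda>x. - \<rho> (- x)) (\<lambda>x. - \<sigma> (- x)) (uminus ` X)"
  shows "covers_below \<rho> \<sigma> X"
  unfolding covers_below_def
proof (intro allI impI)
  fix a S assume S: "S \<subseteq> X" "chain_cover a \<rho> S"
  have "uminus ` S \<subseteq> uminus ` X" using S by auto
  then obtain S' where S': "S' \<subseteq> uminus ` X" "card S' = card (uminus ` S)"
    "chain_cover a (\<lambda>x. - \<sigma> (- x)) S'"
    using covers_belowD[OF assms _ chain_cover_reflect[OF S(2)]] by metis
  have "chain_cover a \<sigma> (uminus ` S')" using chain_cover_reflect[OF S'(3)] by simp
  moreover have "uminus ` S' \<subseteq> X" using S'(1) by auto
  moreover have "card (uminus ` S') = card S" using S'(2) by (simp add: card_image)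
  ultimately show "\<exists>S'. S' \<subseteq> X \<and> card S' = card S \<and> chain_cover a \<sigma> S'" by blast
qed

text \<open>Reversing time and negating the values keeps weakly decreasing subsequences and turns a
  ballot condition before \<open>\<tau>\<close> into one after it. The value \<open>r + 1\<close>
  becomes the smaller one of the two.\<close>

lemma covers_below_lower:
  fixes \<rho> :: "int \<Rightarrow> int"
  assumes fin: "finite X" and tau: "\<tau> \<in> X" and rho: "\<rho> \<tau> = r + 1"
    and ballot: "\<And>v. \<tau> < v \<Longrightarrow>
      card {x \<in> X. \<tau> < x \<and> x \<le> v \<and> \<rho> x = r + 1} \<le> card {x \<in> X. \<tau> < x \<and> x \<le> v \<and> \<rho> x = r}"
  shows "covers_below \<rho> (\<rho>(\<tau> := r)) X"
proof (rule covers_below_reflect)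
  define \<rho>' where "\<rho>' = (\<lambda>x. - (\<rho>(\<tau> := r)) (- x))"
  have "covers_below (\<rho>'(- \<tau> := - (r + 1))) \<rho>' (uminus ` X)"
  proof (rule covers_below_raise)
    fix v assume v: "v < - \<tau>"
    have "{x \<in> uminus ` X. v \<le> x \<and> x < - \<tau> \<and> \<rho>' x = - (r + 1)}
      = uminus ` {x \<in> X. \<tau> < x \<and> x \<le> - v \<and> \<rho> x = r + 1}"
      by (auto simp: \<rho>'_def image_iff intro: bexI[of _ "- _"])
    moreover have "{x \<in> uminus ` X. v \<le> x \<and> x < - \<tau> \<and> \<rho>' x = - (r + 1) + 1}
      = uminus ` {x \<in> X. \<tau> < x \<and> x \<le> - v \<and> \<rho> x = r}"
      by (auto simp: \<rho>'_def image_iff intro: bexI[of _ "- _"])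
    ultimately show "card {x \<in> uminus ` X. v \<le> x \<and> x < - \<tau> \<and> \<rho>' x = - (r + 1)}
      \<le> card {x \<in> uminus ` X. v \<le> x \<and> x < - \<tau> \<and> \<rho>' x = - (r + 1) + 1}"
      using ballot[of "- v"] v by (simp add: card_image)
  qed (use fin tau in \<open>auto simp: \<rho>'_def\<close>)
  moreover have "\<rho>'(- \<tau> := - (r + 1)) = (\<lambda>x. - \<rho> (- x))"
    using rho by (auto simp: \<rho>'_def)
  ultimately show "covers_below (\<lambda>x. - \<rho> (- x)) (\<lambda>x. - (\<rho>(\<tau> := r)) (- x)) (uminus ` X)"
    by (simp add: \<rho>'_def)
qed

section \<open>Slides and waiting letters\<close>

declare split_paired_All [simp del] split_paired_Ex [simp del]

section \<open>The northwest order on boxes\<close>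

definition nw :: "box \<Rightarrow> box \<Rightarrow> bool" where
  "nw y z \<longleftrightarrow> fst y \<le> fst z \<and> snd y \<le> snd z"

lemma nw_refl [simp]: "nw y y" by (simp add: nw_def)
lemma nw_trans: "nw x y \<Longrightarrow> nw y z \<Longrightarrow> nw x z" by (auto simp: nw_def)
lemma nw_antisym: "nw x y \<Longrightarrow> nw y x \<Longrightarrow> x = y" by (auto simp: nw_def prod_eq_iff)
lemma nw_swap [simp]: "nw (prod.swap x) (prod.swap y) = nw x y" by (auto simp: nw_def)
lemma right_of_conv: "right_of y = (fst y, snd y + 1)" by (cases y) auto
lemma below_conv: "below y = (fst y + 1, snd y)" by (cases y) auto
lemma nw_right_of [simp]: "nw y (right_of y)" by (simp add: nw_def right_of_conv)
lemma nw_below [simp]: "nw y (below y)" by (simp add: nw_def below_conv)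

lemma right_of_neq [simp]: "right_of y \<noteq> y" "y \<noteq> right_of y" by (auto simp: right_of_conv prod_eq_iff)
lemma below_neq [simp]: "below y \<noteq> y" "y \<noteq> below y" by (auto simp: below_conv prod_eq_iff)

lemma nw_strict: "nw h y \<Longrightarrow> y \<noteq> h \<Longrightarrow> nw (right_of h) y \<or> nw (below h) y"
  by (cases h; cases y) (auto simp: nw_def right_of_conv below_conv)

lemma young_downD: "young_diagram L \<Longrightarrow> y \<in> L \<Longrightarrow> nw z y \<Longrightarrow> 1 \<le> fst z \<Longrightarrow> 1 \<le> snd z \<Longrightarrow> z \<in> L"
  unfolding young_diagram_def nw_def by (cases y; cases z) auto

lemma young_pos: "young_diagram L \<Longrightarrow> y \<in> L \<Longrightarrow> 1 \<le> fst y \<and> 1 \<le> snd y"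
  unfolding young_diagram_def by (cases y) auto

lemma young_diagramI:
  assumes "finite L" "\<And>y. y \<in> L \<Longrightarrow> 1 \<le> fst y \<and> 1 \<le> snd y"
    "\<And>y z. y \<in> L \<Longrightarrow> nw z y \<Longrightarrow> 1 \<le> fst z \<Longrightarrow> 1 \<le> snd z \<Longrightarrow> z \<in> L"
  shows "young_diagram L"
  unfolding young_diagram_def
proof (intro conjI allI impI)
  show "L \<subseteq> {1..} \<times> {1..}" using assms(2) by fastforce
  fix r c r' c'
  assume "(r, c) \<in> L \<and> 1 \<le> r' \<and> r' \<le> r \<and> 1 \<le> c' \<and> c' \<le> c"
  then show "(r', c') \<in> L" using assms(3)[of "(r, c)" "(r', c')"] by (auto simp: nw_def)
qed (rule assms(1))

lemma young_swap: "young_diagram L \<Longrightarrow> young_diagram (prod.swap ` L)"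
proof (rule young_diagramI)
  assume y: "young_diagram L"
  then show "finite (prod.swap ` L)" by (simp add: young_diagram_def)
  show "1 \<le> fst z \<and> 1 \<le> snd z" if "z \<in> prod.swap ` L" for z
    using that young_pos[OF y] by auto
  show "z' \<in> prod.swap ` L" if "z \<in> prod.swap ` L" "nw z' z" "1 \<le> fst z'" "1 \<le> snd z'" for z z'
  proof -
    have "prod.swap z' \<in> L"
      by (rule young_downD[OF y, of "prod.swap z"]) (use that in \<open>auto simp: nw_def\<close>)
    then show ?thesis by (metis image_eqI swap_swap)
  qed
qed

text \<open>A relational form of \<open>slide_source\<close>. It would admit both neighbours in case
  of a tie and is therefore symmetric under transposition.\<close>

definition slide_move :: "filling \<Rightarrow> box \<Rightarrow> box \<Rightarrow> bool" where
  "slide_move T h z \<longleftrightarrow> (z = right_of h \<or> z = below h) \<and> z \<in> dom T \<and>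
     (\<forall>z'. z' = right_of h \<or> z' = below h \<longrightarrow> z' \<in> dom T \<longrightarrow> the (T z) \<le> the (T z'))"

text \<open>The shape enters only through its maximal boxes \<open>b i\<close>, one for each residue
  class. Keeping \<open>idx\<close> abstract makes the locale closed under transposition and
  rotation, which both reverse the order of the corners.\<close>

locale corners =
  fixes n :: nat and idx :: "int \<Rightarrow> nat" and L :: "box set" and b :: "nat \<Rightarrow> box"
  assumes n1: "1 \<le> n"
    and idx_range: "idx x \<in> {1..n}"
    and idx_eq: "idx x = idx x' \<longleftrightarrow> int n dvd x - x'"
    and young: "young_diagram L"
    and b_in: "i \<in> {1..n} \<Longrightarrow> b i \<in> L"
    and b_max: "i \<in> {1..n} \<Longrightarrow> y \<in> L \<Longrightarrow> nw (b i) y \<Longrightarrow> y = b i"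
    and max_b: "y \<in> L \<Longrightarrow> right_of y \<notin> L \<Longrightarrow> below y \<notin> L \<Longrightarrow> \<exists>i\<in>{1..n}. y = b i"
    and b_mono: "1 \<le> i \<Longrightarrow> i < j \<Longrightarrow> j \<le> n \<Longrightarrow> fst (b j) < fst (b i) \<and> snd (b i) < snd (b j)"
begin

lemma b_inj: "i \<in> {1..n} \<Longrightarrow> j \<in> {1..n} \<Longrightarrow> b i = b j \<Longrightarrow> i = j"
  using b_mono[of i j] b_mono[of j i] by (metis atLeastAtMost_iff less_irrefl linorder_neqE_nat)

lemma idx_add [simp]: "idx (x + int n) = idx x" by (simp add: idx_eq)

text \<open>Letters that a filling does not contain are regarded as waiting in their corner: refilling
  a corner then does not change the position of any letter.\<close>

definition pos :: "filling \<Rightarrow> int \<Rightarrow> box" where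
  "pos T x = (if \<exists>y. T y = Some x then THE y. T y = Some x else b (idx x))"

definition row :: "filling \<Rightarrow> int \<Rightarrow> int" where "row T x = int (fst (pos T x))"
definition col :: "filling \<Rightarrow> int \<Rightarrow> int" where "col T x = int (snd (pos T x))"

definition down_closed :: "box set \<Rightarrow> bool" where
  "down_closed \<mu> \<longleftrightarrow> \<mu> \<subseteq> L \<and> (\<forall>y\<in>\<mu>. \<forall>z\<in>L. nw z y \<longrightarrow> z \<in> \<mu>)"

text \<open>\<open>cv i\<close> is the entry of the corner \<open>b i\<close> before the slide that is being carried out.\<close>

definition holed :: "int \<Rightarrow> (nat \<Rightarrow> int) \<Rightarrow> box set \<Rightarrow> filling \<Rightarrow> box \<Rightarrow> bool" where
  "holed s cv \<mu> T h \<longleftrightarrow> down_closed \<mu> \<and> h \<in> L - \<mu> \<and> dom T = L - \<mu> - {h} \<and>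
     (\<forall>y z u v. T y = Some u \<longrightarrow> T z = Some v \<longrightarrow> nw y z \<longrightarrow> y \<noteq> z \<longrightarrow> u < v) \<and>
     (\<forall>y z u. T y = Some u \<longrightarrow> T z = Some u \<longrightarrow> y = z) \<and>
     (\<forall>x. (\<exists>y. T y = Some x) \<longleftrightarrow> s < x \<and> x \<le> cv (idx x)) \<and>
     (\<forall>y x. T y = Some x \<longrightarrow> nw y (b (idx x))) \<and>
     (\<forall>i\<in>{1..n}. b i \<noteq> h \<longrightarrow> T (b i) = Some (cv i)) \<and>
     (\<forall>i\<in>{1..n}. idx (cv i) = i \<and> s < cv i + int n) \<and>
     (\<forall>y u. T y = Some u \<longrightarrow> (\<forall>i\<in>{1..n}. nw y (b i) \<longrightarrow> u \<le> cv i))"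

text \<open>The entries of each index are precisely its letters above \<open>s\<close> up to the
  corner entry, so that placed and waiting letters together form a word on all letters greater than
  \<open>s\<close>. The additional clauses of \<open>holed\<close> recall what a corner contained
  while it may be empty; here they follow from the others.\<close>

definition state :: "int \<Rightarrow> (nat \<Rightarrow> int) \<Rightarrow> box set \<Rightarrow> filling \<Rightarrow> bool" where
  "state s cv \<mu> T \<longleftrightarrow> down_closed \<mu> \<and> dom T = L - \<mu> \<and>
     (\<forall>y z u v. T y = Some u \<longrightarrow> T z = Some v \<longrightarrow> nw y z \<longrightarrow> y \<noteq> z \<longrightarrow> u < v) \<and>
     (\<forall>y z u. T y = Some u \<longrightarrow> T z = Some u \<longrightarrow> y = z) \<and>
     (\<forall>x. (\<exists>y. T y = Some x) \<longleftrightarrow> s < x \<and> x \<le> cv (idx x)) \<and>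
     (\<forall>y x. T y = Some x \<longrightarrow> nw y (b (idx x))) \<and>
     (\<forall>i\<in>{1..n}. T (b i) = Some (cv i) \<and> idx (cv i) = i)"

lemma holedD:
  assumes "holed s cv \<mu> T h"
  shows "down_closed \<mu>" "h \<in> L" "h \<notin> \<mu>" "dom T = L - \<mu> - {h}"
    "\<And>y z u v. T y = Some u \<Longrightarrow> T z = Some v \<Longrightarrow> nw y z \<Longrightarrow> y \<noteq> z \<Longrightarrow> u < v"
    "\<And>y z u. T y = Some u \<Longrightarrow> T z = Some u \<Longrightarrow> y = z"
    "\<And>x. (\<exists>y. T y = Some x) \<longleftrightarrow> s < x \<and> x \<le> cv (idx x)"
    "\<And>y x. T y = Some x \<Longrightarrow> nw y (b (idx x))"
    "\<And>i. i \<in> {1..n} \<Longrightarrow> b i \<noteq> h \<Longrightarrow> T (b i) = Some (cv i)"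
    "\<And>i. i \<in> {1..n} \<Longrightarrow> idx (cv i) = i" "\<And>i. i \<in> {1..n} \<Longrightarrow> s < cv i + int n"
    "\<And>y u i. T y = Some u \<Longrightarrow> i \<in> {1..n} \<Longrightarrow> nw y (b i) \<Longrightarrow> u \<le> cv i"
  using assms unfolding holed_def by blast+

lemma stateD:
  assumes "state s cv \<mu> T"
  shows "down_closed \<mu>" "dom T = L - \<mu>"
    "\<And>y z u v. T y = Some u \<Longrightarrow> T z = Some v \<Longrightarrow> nw y z \<Longrightarrow> y \<noteq> z \<Longrightarrow> u < v"
    "\<And>y z u. T y = Some u \<Longrightarrow> T z = Some u \<Longrightarrow> y = z"
    "\<And>x. (\<exists>y. T y = Some x) \<longleftrightarrow> s < x \<and> x \<le> cv (idx x)"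
    "\<And>y x. T y = Some x \<Longrightarrow> nw y (b (idx x))"
    "\<And>i. i \<in> {1..n} \<Longrightarrow> T (b i) = Some (cv i)"
    "\<And>i. i \<in> {1..n} \<Longrightarrow> idx (cv i) = i"
  using assms unfolding state_def by blast+

lemma pos_eq:
  assumes "\<And>y z u. T y = Some u \<Longrightarrow> T z = Some u \<Longrightarrow> y = z" "T y = Some x"
  shows "pos T x = y"
proof -
  have "(THE y. T y = Some x) = y" by (rule the_equality) (use assms in blast)+
  moreover have "\<exists>y. T y = Some x" using assms(2) by blast
  ultimately show ?thesis unfolding pos_def by simp
qed

lemma holed_pos: "holed s cv \<mu> T h \<Longrightarrow> T y = Some x \<Longrightarrow> pos T x = y"
  by (rule pos_eq) (use holedD(6) in blast)+

lemma state_pos: "state s cv \<mu> T \<Longrightarrow> T y = Some x \<Longrightarrow> pos T x = y"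
  by (rule pos_eq) (use stateD(4) in blast)+

lemma pos_stuck: "(\<And>y. T y \<noteq> Some x) \<Longrightarrow> pos T x = b (idx x)"
  unfolding pos_def by auto

section \<open>Single moves of a slide\<close>

lemma holed_neighbour:
  assumes h: "holed s cv \<mu> T h" and z: "z \<in> L" "nw h z" "z \<noteq> h"
  shows "z \<in> dom T"
proof -
  have "z \<notin> \<mu>" using holedD(1-3)[OF h] z unfolding down_closed_def by blast
  then show ?thesis using holedD(4)[OF h] z by blast
qed

text \<open>The moved entry is the smaller neighbour of the hole and hence smaller than every other
  entry southeast of it, so the order around \<open>h\<close> is restored. The word of positions
  changes in a single letter.\<close>

lemma holed_move:
  assumes h: "holed s cv \<mu> T h" and m: "slide_move T h z"
  defines "T' \<equiv> T(h := T z, z := None)"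
  shows "holed s cv \<mu> T' z" "pos T' = (pos T)(the (T z) := h)" "pos T (the (T z)) = z"
    "s < the (T z)"
proof -
  note H = holedD[OF h]
  from m have zd: "z \<in> dom T" and zh: "z = right_of h \<or> z = below h"
    and zmin: "\<And>z'. z' = right_of h \<or> z' = below h \<Longrightarrow> z' \<in> dom T \<Longrightarrow> the (T z) \<le> the (T z')"
    unfolding slide_move_def by auto
  obtain v where v: "T z = Some v" using zd by auto
  have hz: "nw h z" "z \<noteq> h" using zh by auto
  have zL: "z \<in> L" "z \<notin> \<mu>" using zd H(4) by auto
  have Th: "T h = None" using H(4) by blast
  have bh: "b i \<noteq> h" if "i \<in> {1..n}" for i
    using b_max[OF that zL(1)] hz by auto
  have T'v: "T' y = Some u \<longleftrightarrow> (y = h \<and> u = v) \<or> (y \<noteq> h \<and> y \<noteq> z \<and> T y = Some u)" for y u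
    using hz v by (auto simp: T'_def)
  have big: "v < u" if "T y = Some u" "nw h y" "y \<noteq> z" for y u
  proof -
    have yh: "y \<noteq> h" using that Th by auto
    show ?thesis
    proof (cases "nw z y")
      case True then show ?thesis using H(5)[OF v that(1)] that by auto
    next
      case False
      define z' where "z' = (if z = right_of h then below h else right_of h)"
      have z': "z' = right_of h \<or> z' = below h" "nw z' y" "z' \<noteq> z" "z' \<noteq> h" "nw h z'"
        using nw_strict[OF that(2) yh] zh False
        by (auto simp: z'_def right_of_conv below_conv prod_eq_iff nw_def)
      have yL: "y \<in> L" using that H(4) by blast
      have "z' \<in> L" by (rule young_downD[OF young yL])
        (use z' young_pos[OF young H(2)] in \<open>auto simp: right_of_conv below_conv\<close>)
      then have z'd: "z' \<in> dom T" using holed_neighbour[OF h] z' by blast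
      then obtain v' where v': "T z' = Some v'" by auto
      have "v \<le> v'" using zmin[OF z'(1) z'd] v v' by simp
      moreover have "v \<noteq> v'" using H(6)[of z v z'] v v' z' by auto
      moreover have "v' \<le> u" using H(5)[OF v' that(1) z'(2)] v' that by (cases "z' = y") auto
      ultimately show ?thesis by auto
    qed
  qed
  show hT': "holed s cv \<mu> T' z"
    unfolding holed_def
  proof (intro conjI allI impI ballI)
    show "down_closed \<mu>" by (rule H)
    show "z \<in> L - \<mu>" using zL by auto
    have "dom T' = insert h (dom T) - {z}" using hz v by (auto simp: T'_def)
    then show "dom T' = L - \<mu> - {z}" using H(2,3,4) hz by auto
  next
    fix y y' u u' assume a: "T' y = Some u" "T' y' = Some u'" "nw y y'" "y \<noteq> y'"
    then show "u < u'"
    proof (cases "y = h")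
      case True
      then show ?thesis using a big[of y' u'] T'v by auto
    next
      case False
      then have Ty: "T y = Some u" "y \<noteq> z" using a T'v by auto
      show ?thesis
      proof (cases "y' = h")
        case True
        then have "u' = v" using a T'v by auto
        then show ?thesis using H(5)[OF Ty(1) v] nw_trans[of y h z] True a hz Ty by auto
      next
        case False
        then show ?thesis using H(5)[OF Ty(1), of y' u'] a T'v by auto
      qed
    qed
  next
    fix y y' u assume "T' y = Some u" "T' y' = Some u"
    then show "y = y'" using H(6) v T'v by metis
  next
    fix x
    have "(\<exists>y. T' y = Some x) \<longleftrightarrow> (\<exists>y. T y = Some x)"
      using T'v v Th H(6) by (metis option.distinct(1) option.inject)
    then show "(\<exists>y. T' y = Some x) = (s < x \<and> x \<le> cv (idx x))" using H(7) by simp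
  next
    fix y x assume "T' y = Some x"
    then consider "y = h" "x = v" | "T y = Some x" using T'v by blast
    then show "nw y (b (idx x))"
      by cases (use nw_trans[OF hz(1) H(8)[OF v]] H(8) in auto)
  next
    fix i assume "i \<in> {1..n}" "b i \<noteq> z"
    then show "T' (b i) = Some (cv i)" using H(9) bh T'v by auto
  next
    fix i assume "i \<in> {1..n}"
    then show "idx (cv i) = i" "s < cv i + int n" using H(10,11) by auto
  next
    fix y u i assume a: "T' y = Some u" "i \<in> {1..n}" "nw y (b i)"
    show "u \<le> cv i"
    proof (cases "y = h")
      case False then show ?thesis using a(2,3) H(12)[of y u] T'v[of y u] a(1) by blast
    next
      case True
      then have u: "u = v" using a T'v by auto
      show ?thesis
      proof (cases "b i = z")
        case True then show ?thesis using H(12)[OF v a(2)] u by auto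
      next
        case False
        have "T (b i) = Some (cv i)" using H(9) bh a by auto
        then show ?thesis using big[of "b i"] False a u True by force
      qed
    qed
  qed
  show pz: "pos T (the (T z)) = z" using holed_pos[OF h v] v by simp
  show "s < the (T z)" using H(7)[of v] v by (metis option.sel)
  show "pos T' = (pos T)(the (T z) := h)"
  proof
    fix x
    show "pos T' x = ((pos T)(the (T z) := h)) x"
    proof (cases "x = v")
      case True
      then show ?thesis using holed_pos[OF hT', of h v] T'v[of h v] v by simp
    next
      case xv: False
      show ?thesis
      proof (cases "\<exists>y. T y = Some x")
        case True
        then obtain y where y: "T y = Some x" by auto
        then have "T' y = Some x" using xv v Th T'v[of y x] by auto
        then show ?thesis using holed_pos[OF hT', of y x] holed_pos[OF h y] xv v by simp
      next
        case False
        then have "T' y \<noteq> Some x" "T y \<noteq> Some x" for y using T'v[of y x] xv by blast+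
        then show ?thesis using pos_stuck[of T x] pos_stuck[of T' x] xv v by simp
      qed
    qed
  qed
qed

text \<open>A horizontal move keeps all rows. For a vertical one, a smaller letter of row
  \<open>r\<close> must lie to the left of the hole, and the box below it holds a letter of row
  \<open>r + 1\<close> that is still smaller than the moved one. This matching gives the ballot
  condition.\<close>

lemma holed_move_rows:
  assumes h: "holed s cv \<mu> T h" and m: "slide_move T h z" and s: "s \<le> s'"
  shows "covers_below (row (T(h := T z, z := None))) (row T) {s'<..t}"
proof -
  note H = holedD[OF h] and M = holed_move[OF h m]
  define T' where "T' = T(h := T z, z := None)"
  obtain v where v: "T z = Some v" using m unfolding slide_move_def by auto
  have row': "row T' = (row T)(v := int (fst h))"
    using M(2) v unfolding T'_def row_def by auto
  have rowv: "row T v = int (fst z)" using M(3) v by (simp add: row_def)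
  show ?thesis
  proof (cases "z = right_of h \<or> v \<notin> {s'<..t}")
    case True
    then have "row T' x = row T x" if "x \<in> {s'<..t}" for x
      using that row' rowv by (auto simp: right_of_conv)
    then show ?thesis unfolding T'_def[symmetric] by (intro covers_below_refl) auto
  next
    case False
    then have z: "z = below h" and vX: "v \<in> {s'<..t}" using m unfolding slide_move_def by auto
    obtain r c where hrc: "h = (r, c)" by (cases h)
    have zrc: "z = (r + 1, c)" using z hrc by simp
    have zL: "z \<in> L" using v H(4) by blast
    have rb: "v < u" if "T y = Some u" "fst y = r" "c < snd y" for y u
    proof -
      have "nw (right_of h) y" using that hrc by (auto simp: nw_def)
      have "y \<in> L" using that H(4) by blast
      then have "right_of h \<in> L" by (rule young_downD[OF young])
        (use \<open>nw (right_of h) y\<close> young_pos[OF young H(2)] in \<open>auto simp: right_of_conv\<close>)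
      then have d: "right_of h \<in> dom T"
        using holed_neighbour[OF h] by simp
      then obtain u' where u': "T (right_of h) = Some u'" by auto
      have "the (T z) \<le> the (T (right_of h))" using m d unfolding slide_move_def by blast
      then have "v \<le> u'" using u' v by simp
      moreover have "v \<noteq> u'" using H(6)[of z v "right_of h"] v u' z
        by (auto simp: right_of_conv below_conv)
      moreover have "u' \<le> u" using H(5)[OF u' that(1) \<open>nw (right_of h) y\<close>] u' that(1)
        by (cases "right_of h = y") auto
      ultimately show ?thesis by auto
    qed
    have "covers_below ((row T)(v := int r)) (row T) {s'<..t}"
    proof (rule covers_below_raise)
      show "row T v = int r + 1" using rowv zrc by simp
      fix w assume "w < v"
      define f where "f = (\<lambda>x. the (T (below (pos T x))))"
      define A where "A = {x \<in> {s'<..t}. w \<le> x \<and> x < v \<and> row T x = int r}"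
      define B where "B = {x \<in> {s'<..t}. w \<le> x \<and> x < v \<and> row T x = int r + 1}"
      have key: "\<exists>c'. c' < c \<and> T (r, c') = Some x \<and> T (r + 1, c') = Some (f x) \<and> x < f x \<and> f x < v"
        if "x \<in> A" for x
      proof -
        have x: "s < x" "x < v" "fst (pos T x) = r" using that s by (auto simp: A_def row_def)
        \<comment> \<open>A letter waiting in row \<open>r\<close> exceeds the entry of its corner,
          which lies to the right of the hole and hence exceeds \<open>v\<close>.\<close>
        have "\<exists>y. T y = Some x"
        proof (rule ccontr)
          assume no: "\<not> ?thesis"
          then have p: "pos T x = b (idx x)" using pos_stuck by auto
          have i: "idx x \<in> {1..n}" by (rule idx_range)
          have bc: "c < snd (b (idx x))"
          proof (rule ccontr)
            assume "\<not> ?thesis"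
            then have "nw (b (idx x)) z" using p x zrc by (auto simp: nw_def)
            then have "fst z = r" using b_max[OF i zL] p x by simp
            then show False using zrc by simp
          qed
          then have "b (idx x) \<noteq> h" using hrc by auto
          then have tb: "T (b (idx x)) = Some (cv (idx x))" using H(9) i by auto
          have "v < cv (idx x)" using rb[OF tb] bc p x by auto
          moreover have "cv (idx x) < x" using H(7)[of x] no x by auto
          ultimately show False using x by auto
        qed
        then obtain y where y: "T y = Some x" by auto
        have py: "pos T x = y" using holed_pos[OF h y] .
        obtain c' where y': "y = (r, c')" using py x by (cases y) auto
        have "c' \<noteq> c" using y y' hrc H(4) by auto
        moreover have "\<not> c < c'" using rb[OF y] y' x by auto
        ultimately have c': "c' < c" by auto
        have yL: "y \<in> L" "y \<notin> \<mu>" using y H(4) by auto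
        have "below y \<in> L" by (rule young_downD[OF young zL])
          (use y' zrc c' young_pos[OF young yL(1)] in \<open>auto simp: nw_def\<close>)
        moreover have "below y \<notin> \<mu>"
          using yL H(1) nw_below[of y] unfolding down_closed_def by blast
        moreover have "below y \<noteq> h" using y' hrc by auto
        ultimately have "below y \<in> dom T" using H(4) by auto
        then obtain u where u: "T (below y) = Some u" by auto
        have "f x = u" using u py by (simp add: f_def)
        moreover have "x < u" using H(5)[OF y u nw_below] by simp
        moreover have "u < v" using H(5)[OF u v] y' zrc c' by (auto simp: nw_def)
        ultimately show ?thesis using y u y' c' by auto
      qed
      have fB: "f x \<in> B" if xA: "x \<in> A" for x
      proof -
        obtain c' where k: "c' < c" "T (r, c') = Some x" "T (r + 1, c') = Some (f x)" "x < f x" "f x < v"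
          using key[OF xA] by auto
        have "pos T (f x) = (r + 1, c')" using holed_pos[OF h k(3)] .
        then show ?thesis using k that vX by (auto simp: A_def B_def row_def)
      qed
      have "inj_on f A"
      proof (rule inj_onI)
        fix x x' assume a: "x \<in> A" "x' \<in> A" "f x = f x'"
        obtain c1 where 1: "T (r, c1) = Some x" "T (r + 1, c1) = Some (f x)" using key[OF a(1)] by auto
        obtain c2 where 2: "T (r, c2) = Some x'" "T (r + 1, c2) = Some (f x')" using key[OF a(2)] by auto
        have "c1 = c2" using H(6)[OF 1(2)] 2(2) a(3) by auto
        then show "x = x'" using 1 2 by auto
      qed
      moreover have "f ` A \<subseteq> B" using fB by auto
      moreover have "finite B" by (rule finite_subset[of _ "{s'<..t}"]) (auto simp: B_def)
      ultimately have "card A \<le> card B" by (rule card_inj_on_le)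
      then show "card {x \<in> {s'<..t}. w \<le> x \<and> x < v \<and> row T x = int r}
        \<le> card {x \<in> {s'<..t}. w \<le> x \<and> x < v \<and> row T x = int r + 1}"
        by (simp add: A_def B_def)
    qed (use vX in auto)
    then show ?thesis using row' hrc unfolding T'_def[symmetric] by simp
  qed
qed

text \<open>Reflection in the main diagonal reverses the order of the corners, which accounts for
  \<open>n + 1 - idx\<close>. All statements about columns are obtained from those about rows in
  this way.\<close>

lemma transpose: "corners n (\<lambda>x. n + 1 - idx x) (prod.swap ` L) (\<lambda>i. prod.swap (b (n + 1 - i)))"
proof
  show "1 \<le> n" by (rule n1)
  show "n + 1 - idx x \<in> {1..n}" for x using idx_range[of x] by auto
  show "(n + 1 - idx x = n + 1 - idx x') = (int n dvd x - x')" for x x'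
    using idx_range[of x] idx_range[of x'] idx_eq[of x x'] by auto
  show "young_diagram (prod.swap ` L)" by (rule young_swap[OF young])
  show "prod.swap (b (n + 1 - i)) \<in> prod.swap ` L" if "i \<in> {1..n}" for i
    using that by (intro imageI b_in) auto
  show "y = prod.swap (b (n + 1 - i))"
    if a: "i \<in> {1..n}" "y \<in> prod.swap ` L" "nw (prod.swap (b (n + 1 - i))) y" for i y
  proof -
    obtain y' where y': "y = prod.swap y'" "y' \<in> L" using a by blast
    have "n + 1 - i \<in> {1..n}" using a(1) by auto
    then show ?thesis using b_max[of "n + 1 - i" y'] a(3) y' by simp
  qed
  show "\<exists>i\<in>{1..n}. y = prod.swap (b (n + 1 - i))"
    if a: "y \<in> prod.swap ` L" "right_of y \<notin> prod.swap ` L" "below y \<notin> prod.swap ` L" for y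
  proof -
    obtain y' where y': "y = prod.swap y'" "y' \<in> L" using a by blast
    have "right_of y = prod.swap (below y')" "below y = prod.swap (right_of y')"
      using y' by (auto simp: right_of_conv below_conv)
    then have "right_of y' \<notin> L" "below y' \<notin> L" using a by auto
    then obtain i where i: "i \<in> {1..n}" "y' = b i" using max_b y' by blast
    then show ?thesis using y' by (intro bexI[of _ "n + 1 - i"]) auto
  qed
  show "fst (prod.swap (b (n + 1 - j))) < fst (prod.swap (b (n + 1 - i))) \<and>
    snd (prod.swap (b (n + 1 - i))) < snd (prod.swap (b (n + 1 - j)))"
    if "1 \<le> i" "i < j" "j \<le> n" for i j
    using b_mono[of "n + 1 - j" "n + 1 - i"] that by auto
qed

lemma down_closed_swap:
  assumes "down_closed \<mu>"
  shows "corners.down_closed (prod.swap ` L) (prod.swap ` \<mu>)"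
proof -
  interpret tr: corners n "\<lambda>x. n + 1 - idx x" "prod.swap ` L" "\<lambda>i. prod.swap (b (n + 1 - i))"
    by (rule transpose)
  show ?thesis
    unfolding tr.down_closed_def
  proof (intro conjI ballI impI)
    show "prod.swap ` \<mu> \<subseteq> prod.swap ` L" using assms unfolding down_closed_def by blast
    fix y z assume "y \<in> prod.swap ` \<mu>" "z \<in> prod.swap ` L" "nw z y"
    then obtain y' z' where "y = prod.swap y'" "y' \<in> \<mu>" "z = prod.swap z'" "z' \<in> L" by blast
    then show "z \<in> prod.swap ` \<mu>" using assms \<open>nw z y\<close> unfolding down_closed_def by auto
  qed
qed

lemma dom_swap: "dom (T \<circ> prod.swap) = prod.swap ` dom T" for T :: filling
proof
  show "dom (T \<circ> prod.swap) \<subseteq> prod.swap ` dom T"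
  proof
    fix y assume "y \<in> dom (T \<circ> prod.swap)"
    then have "prod.swap y \<in> dom T" by auto
    then show "y \<in> prod.swap ` dom T" by (metis image_eqI swap_swap)
  qed
qed auto

lemma swap_eqs: "((T \<circ> prod.swap) y = Some x) = (T (prod.swap y) = Some x)" for T :: filling
  by simp

lemma holed_swap:
  assumes h: "holed s cv \<mu> T h"
  shows "corners.holed n (\<lambda>x. n + 1 - idx x) (prod.swap ` L) (\<lambda>i. prod.swap (b (n + 1 - i)))
    s (\<lambda>i. cv (n + 1 - i)) (prod.swap ` \<mu>) (T \<circ> prod.swap) (prod.swap h)"
proof -
  interpret tr: corners n "\<lambda>x. n + 1 - idx x" "prod.swap ` L" "\<lambda>i. prod.swap (b (n + 1 - i))"
    by (rule transpose)
  note H = holedD[OF h]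
  have ii: "n + 1 - (n + 1 - idx x) = idx x" for x using idx_range[of x] by auto
  have flip: "n + 1 - i \<in> {1..n}" if "i \<in> {1..n}" for i using that by auto
  show ?thesis
    unfolding tr.holed_def swap_eqs
  proof (intro conjI allI impI ballI)
    show "tr.down_closed (prod.swap ` \<mu>)" by (rule down_closed_swap[OF H(1)])
    show "prod.swap h \<in> prod.swap ` L - prod.swap ` \<mu>" using H(2,3) by (simp add: inj_image_mem_iff)
    show "dom (T \<circ> prod.swap) = prod.swap ` L - prod.swap ` \<mu> - {prod.swap h}"
      unfolding dom_swap H(4) by (simp add: image_set_diff)
  next
    fix y z u v assume a: "T (prod.swap y) = Some u" "T (prod.swap z) = Some v" "nw y z" "y \<noteq> z"
    have "nw (prod.swap y) (prod.swap z)" "prod.swap y \<noteq> prod.swap z"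
      using a(3,4) by (simp, metis swap_swap)
    then show "u < v" using H(5)[OF a(1,2)] by blast
  next
    fix y z u assume "T (prod.swap y) = Some u" "T (prod.swap z) = Some u"
    then show "y = z" using H(6) by (metis swap_swap)
  next
    fix x
    have "(\<exists>y. T (prod.swap y) = Some x) = (\<exists>y. T y = Some x)" by (metis swap_swap)
    then show "(\<exists>y. T (prod.swap y) = Some x) = (s < x \<and> x \<le> cv (n + 1 - (n + 1 - idx x)))"
      unfolding ii H(7)[symmetric] .
  next
    fix y x assume "T (prod.swap y) = Some x"
    then have "nw (prod.swap y) (b (idx x))" by (rule H(8))
    then show "nw y (prod.swap (b (n + 1 - (n + 1 - idx x))))" unfolding ii by (simp add: nw_def)
  next
    fix i assume i: "i \<in> {1..n}" "prod.swap (b (n + 1 - i)) \<noteq> prod.swap h"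
    then have "b (n + 1 - i) \<noteq> h" by auto
    then show "T (prod.swap (prod.swap (b (n + 1 - i)))) = Some (cv (n + 1 - i))"
      using H(9)[OF flip[OF i(1)]] by simp
  next
    fix i assume i: "i \<in> {1..n}"
    then show "n + 1 - idx (cv (n + 1 - i)) = i" "s < cv (n + 1 - i) + int n"
      using H(10,11)[OF flip[OF i]] by auto
  next
    fix y u i assume a: "T (prod.swap y) = Some u" "i \<in> {1..n}" "nw y (prod.swap (b (n + 1 - i)))"
    have "nw (prod.swap y) (b (n + 1 - i))" using a(3) by (simp add: nw_def)
    then show "u \<le> cv (n + 1 - i)" using H(12)[OF a(1) flip[OF a(2)]] by simp
  qed
qed

lemma pos_swap:
  assumes "\<And>y z u. T y = Some u \<Longrightarrow> T z = Some u \<Longrightarrow> y = z"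
  shows "corners.pos (\<lambda>x. n + 1 - idx x) (\<lambda>i. prod.swap (b (n + 1 - i))) (T \<circ> prod.swap) x
    = prod.swap (pos T x)"
proof -
  interpret tr: corners n "\<lambda>x. n + 1 - idx x" "prod.swap ` L" "\<lambda>i. prod.swap (b (n + 1 - i))"
    by (rule transpose)
  have ii: "n + 1 - (n + 1 - idx x) = idx x" using idx_range[of x] by auto
  show ?thesis
  proof (cases "\<exists>y. T y = Some x")
    case True
    then obtain y where y: "T y = Some x" by blast
    have "pos T x = y" by (rule pos_eq) (use assms y in blast)+
    moreover have "tr.pos (T \<circ> prod.swap) x = prod.swap y"
    proof (rule tr.pos_eq)
      fix y' z u assume "(T \<circ> prod.swap) y' = Some u" "(T \<circ> prod.swap) z = Some u"
      then show "y' = z" using assms by (metis comp_apply swap_swap)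
    qed (use y in simp)
    ultimately show ?thesis by simp
  next
    case False
    then have "tr.pos (T \<circ> prod.swap) x = prod.swap (b (n + 1 - (n + 1 - idx x)))"
      by (intro tr.pos_stuck) auto
    then show ?thesis using pos_stuck[of T x] False ii by auto
  qed
qed

lemma slide_move_swap: "slide_move T h z \<Longrightarrow> slide_move (T \<circ> prod.swap) (prod.swap h) (prod.swap z)"
  unfolding slide_move_def domIff
  by (cases h; cases z) (auto simp: right_of_conv below_conv)

lemma holed_move_cols:
  assumes h: "holed s cv \<mu> T h" and m: "slide_move T h z" and s: "s \<le> s'"
  shows "covers_below (col (T(h := T z, z := None))) (col T) {s'<..t}"
proof -
  interpret tr: corners n "\<lambda>x. n + 1 - idx x" "prod.swap ` L" "\<lambda>i. prod.swap (b (n + 1 - i))"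
    by (rule transpose)
  define T' where "T' = T(h := T z, z := None)"
  have eq: "T' \<circ> prod.swap = (T \<circ> prod.swap)(prod.swap h := (T \<circ> prod.swap) (prod.swap z), prod.swap z := None)"
    by (rule ext) (auto simp: T'_def)
  have h': "holed s cv \<mu> T' z" unfolding T'_def by (rule holed_move(1)[OF h m])
  have "tr.row (T' \<circ> prod.swap) = col T'"
    unfolding tr.row_def col_def using pos_swap[of T'] holedD(6)[OF h'] by fastforce
  moreover have "tr.row (T \<circ> prod.swap) = col T"
    unfolding tr.row_def col_def using pos_swap[of T] holedD(6)[OF h] by fastforce
  ultimately show ?thesis
    using tr.holed_move_rows[OF holed_swap[OF h] slide_move_swap[OF m] s, of t] eq
    unfolding T'_def by simp
qed

section \<open>Whole slides and runs of the lower construction\<close>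

lemma slide_source_SomeD: "slide_source T x = Some y \<Longrightarrow> slide_move T x y"
  unfolding slide_source_def slide_move_def by (auto split: option.splits if_splits)

lemma slide_source_NoneD: "slide_source T x = None \<Longrightarrow> T (right_of x) = None \<and> T (below x) = None"
  unfolding slide_source_def by (auto split: option.splits)

text \<open>Serves both directions of comparison: the one valid on every shape and the converse on
  staircases.\<close>

lemma slides_holed_rel:
  assumes "slides slide_source T h T' z" "holed s cv \<mu> T h" "\<And>T. Q T T"
    "\<And>T h z T'. holed s cv \<mu> T h \<Longrightarrow> slide_move T h z \<Longrightarrow> Q (T(h := T z, z := None)) T' \<Longrightarrow> Q T T'"
  shows "Q T T'"
  using assms(1,2)
proof (induction rule: slides.induct)
  case (stop T x) then show ?case using assms(3) by simp
next
  case (move T x y T' z)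
  then show ?case
    using assms(4) slide_source_SomeD[OF move(1)] holed_move(1)[OF move(4) slide_source_SomeD[OF move(1)]]
    by blast
qed

text \<open>The neighbours of the hole inside \<open>L\<close> are always filled, so a slide can
  stop only at a box without neighbours in \<open>L\<close>. Consequently every slide of the
  construction is followed by a refill.\<close>

lemma slides_holed_end:
  assumes "slides slide_source T h T' z" "holed s cv \<mu> T h"
  shows "holed s cv \<mu> T' z \<and> (\<exists>i\<in>{1..n}. z = b i)"
  using assms
proof (induction rule: slides.induct)
  case (stop T x)
  note N = slide_source_NoneD[OF stop(1)] and H = holedD[OF stop(2)]
  have "right_of x \<notin> L" "below x \<notin> L"
    using holed_neighbour[OF stop(2), of "right_of x"] holed_neighbour[OF stop(2), of "below x"] N
    by (auto simp: domIff)
  then show ?case using max_b[OF H(2)] stop(2) by blast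
next
  case (move T x y T' z)
  then show ?case
    using holed_move(1)[OF move(4) slide_source_SomeD[OF move(1)]] by blast
qed

lemma slides_holed_covers:
  assumes sl: "slides slide_source T h T' z" and h: "holed s cv \<mu> T h" and s: "s \<le> s'"
  shows "covers_below (row T') (row T) {s'<..t}" "covers_below (col T') (col T) {s'<..t}"
proof -
  show "covers_below (row T') (row T) {s'<..t}"
    by (rule slides_holed_rel[OF sl h, where Q = "\<lambda>T T'. covers_below (row T') (row T) {s'<..t}"])
      (auto intro: covers_below_refl covers_below_trans holed_move_rows[OF _ _ s])
  show "covers_below (col T') (col T) {s'<..t}"
    by (rule slides_holed_rel[OF sl h, where Q = "\<lambda>T T'. covers_below (col T') (col T) {s'<..t}"])
      (auto intro: covers_below_refl covers_below_trans holed_move_cols[OF _ _ s])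
qed

lemma finite_L: "finite L" using young unfolding young_diagram_def by simp

text \<open>Each move shrinks the set of boxes southeast of the hole.\<close>

lemma slides_exists: "holed s cv \<mu> T h \<Longrightarrow> \<exists>T' z. slides slide_source T h T' z"
proof (induction "card {y \<in> L. nw h y}" arbitrary: T h rule: less_induct)
  case less
  show ?case
  proof (cases "slide_source T h")
    case None then show ?thesis using slides.stop[of slide_source T h] by blast
  next
    case (Some y)
    note m = slide_source_SomeD[OF Some]
    have hy: "nw h y" "y \<noteq> h" using m unfolding slide_move_def by auto
    have "h \<notin> {x \<in> L. nw y x}" "h \<in> {x \<in> L. nw h x}"
      using hy holedD(2)[OF less(2)] nw_antisym[of h y] by auto
    moreover have "{x \<in> L. nw y x} \<subseteq> {x \<in> L. nw h x}" using nw_trans[OF hy(1)] by blast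
    ultimately have "{x \<in> L. nw y x} \<subset> {x \<in> L. nw h x}" by blast
    then have "card {x \<in> L. nw y x} < card {x \<in> L. nw h x}"
      using finite_L by (intro psubset_card_mono) auto
    then show ?thesis using less(1)[OF _ holed_move(1)[OF less(2) m]] slides.move[of slide_source T h y] Some by blast
  qed
qed

lemma refill_corner:
  assumes h: "holed s cv \<mu> T h" and i: "i \<in> {1..n}" "h = b i"
  shows "state s (cv(i := cv i + int n)) \<mu> (T(h := Some (cv i + int n)))"
    "pos (T(h := Some (cv i + int n))) = pos T"
proof -
  note H = holedD[OF h]
  define T' where "T' = T(h := Some (cv i + int n))"
  define c where "c = cv i + int n"
  have n0: "0 < int n" using n1 by simp
  have ic: "idx (cv i) = i" "idx c = i" using H(10)[OF i(1)] by (auto simp: c_def)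
  have Th: "T h = None" using H(4) by blast
  have cn: "T y \<noteq> Some c" for y
  proof -
    have "\<not> c \<le> cv (idx c)" using ic n0 by (simp add: c_def)
    then show ?thesis using H(7)[of c] by blast
  qed
  have T'v: "T' y = Some u \<longleftrightarrow> (y = h \<and> u = c) \<or> (y \<noteq> h \<and> T y = Some u)" for y u
    by (auto simp: T'_def c_def)
  have st: "state s (cv(i := c)) \<mu> T'"
    unfolding state_def
  proof (intro conjI allI impI ballI)
    show "down_closed \<mu>" by (rule H)
    have "dom T' = insert h (dom T)" by (auto simp: T'_def)
    then show "dom T' = L - \<mu>" using H(2,3,4) by auto
  next
    fix y z u v assume a: "T' y = Some u" "T' z = Some v" "nw y z" "y \<noteq> z"
    have "z \<in> L" using a(2) T'v[of z v] H(2,4) by (cases "z = h") auto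
    then have yh: "y \<noteq> h" using b_max[OF i(1)] a(3,4) i(2) by metis
    then have Ty: "T y = Some u" using a(1) T'v by blast
    show "u < v"
    proof (cases "z = h")
      case True
      then have "u \<le> cv i" using H(12)[OF Ty i(1)] a(3) i(2) by blast
      then show ?thesis using a(2) T'v[of z v] True n0 by (auto simp: c_def)
    next
      case False
      then show ?thesis using H(5)[OF Ty _ a(3,4)] a(2) T'v by blast
    qed
  next
    fix y z u assume "T' y = Some u" "T' z = Some u"
    then show "y = z" using T'v[of y u] T'v[of z u] cn[of y] cn[of z] H(6)[of y u z] by blast
  next
    fix x
    have "(\<exists>y. T' y = Some x) \<longleftrightarrow> x = c \<or> (\<exists>y. T y = Some x)" using T'v Th by (metis option.distinct(1))
    also have "\<dots> \<longleftrightarrow> x = c \<or> (s < x \<and> x \<le> cv (idx x))" using H(7) by blast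
    also have "\<dots> \<longleftrightarrow> s < x \<and> x \<le> (cv(i := c)) (idx x)"
    proof (cases "idx x = i")
      case True
      \<comment> \<open>Letters of the same index differ by multiples of \<open>n\<close>, so none
        lies strictly between \<open>cv i\<close> and \<open>cv i + n\<close>.\<close>
      have "x = c \<or> x \<le> cv i" if "x \<le> c"
      proof -
        have "int n dvd x - cv i" using idx_eq[of x "cv i"] True ic by simp
        then obtain k where k: "x - cv i = int n * k" by auto
        then have "k \<le> 1" using that n0 by (auto simp: c_def algebra_simps)
        then have "k = 1 \<or> k \<le> 0" by auto
        then show ?thesis using k n0 mult_nonneg_nonpos[of "int n" k] by (auto simp: c_def)
      qed
      then show ?thesis using True H(11)[OF i(1)] n0 by (auto simp: c_def)
    next
      case False
      then show ?thesis using ic by auto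
    qed
    finally show "(\<exists>y. T' y = Some x) = (s < x \<and> x \<le> (cv(i := c)) (idx x))" .
  next
    fix y x assume "T' y = Some x"
    then consider "y = h" "x = c" | "T y = Some x" using T'v by blast
    then show "nw y (b (idx x))" by cases (use i ic H(8) in auto)
  next
    fix j assume j: "j \<in> {1..n}"
    then show "T' (b j) = Some ((cv(i := c)) j)"
      using H(9)[OF j] b_inj[OF j i(1)] i(2) T'v by (cases "j = i") (auto simp: T'_def c_def)
    show "idx ((cv(i := c)) j) = j" using H(10)[OF j] ic by auto
  qed
  then show "state s (cv(i := cv i + int n)) \<mu> (T(h := Some (cv i + int n)))"
    by (simp add: T'_def c_def)
  show "pos (T(h := Some (cv i + int n))) = pos T"
  proof
    fix x
    have "pos T' x = pos T x"
    proof (cases "x = c")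
      case True
      then show ?thesis using state_pos[OF st, of h c] T'v[of h c] pos_stuck[of T c] cn ic i by simp
    next
      case False
      show ?thesis
      proof (cases "\<exists>y. T y = Some x")
        case True
        then obtain y where y: "T y = Some x" by blast
        then have "T' y = Some x" using T'v[of y x] Th by auto
        then show ?thesis using state_pos[OF st, of y x] holed_pos[OF h y] by simp
      next
        case F: False
        then have "T' y \<noteq> Some x" "T y \<noteq> Some x" for y using T'v[of y x] False by blast+
        then show ?thesis using pos_stuck[of T x] pos_stuck[of T' x] by simp
      qed
    qed
    then show "pos (T(h := Some (cv i + int n))) x = pos T x" by (simp add: T'_def)
  qed
qed

lemma state_holed:
  assumes st: "state s cv \<mu> T" and x: "x \<in> \<mu>" "down_closed (\<mu> - {x})"
  shows "holed s cv (\<mu> - {x}) T x"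
proof -
  note S = stateD[OF st]
  have xL: "x \<in> L" using S(1) x unfolding down_closed_def by blast
  have sc: "s < cv i" if "i \<in> {1..n}" for i using S(5)[of "cv i"] S(7)[OF that] by blast
  show ?thesis
    unfolding holed_def
  proof (intro conjI allI impI ballI)
    show "down_closed (\<mu> - {x})" by (rule x)
    show "x \<in> L - (\<mu> - {x})" using xL by auto
    show "dom T = L - (\<mu> - {x}) - {x}" using S(2) x(1) by auto
    show "(\<exists>y. T y = Some x) = (s < x \<and> x \<le> cv (idx x))" for x by (rule S(5))
  next
    fix i assume i: "i \<in> {1..n}"
    show "T (b i) = Some (cv i)" "idx (cv i) = i" by (rule S(7,8)[OF i])+
    show "s < cv i + int n" using sc[OF i] by simp
  next
    fix y u i assume a: "T y = Some u" "i \<in> {1..n}" "nw y (b i)"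
    show "u \<le> cv i"
    proof (cases "y = b i")
      case True then show ?thesis using S(7)[OF a(2)] a(1) by simp
    next
      case False then show ?thesis using S(3)[OF a(1) S(7)[OF a(2)] a(3)] by simp
    qed
  qed (use S in blast)+
qed

text \<open>Windows may start at every \<open>s' \<ge> s\<close>, so that the property survives
  promotion, which raises \<open>s\<close>. The words \<open>- idx\<close> and \<open>idx\<close>
  are, up to order, the rows and columns of letters that all wait in their corners.\<close>

definition dominated :: "int \<Rightarrow> filling \<Rightarrow> bool" where
  "dominated s T \<longleftrightarrow> (\<forall>s' t. s \<le> s' \<longrightarrow>
     covers_below (row T) (\<lambda>x. - int (idx x)) {s'<..t} \<and> covers_below (col T) (\<lambda>x. int (idx x)) {s'<..t})"

lemma dominated_cong: "pos T' = pos T \<Longrightarrow> dominated s T' = dominated s T"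
  unfolding dominated_def row_def col_def by simp

lemma slide_step:
  assumes h: "holed s cv \<mu> T h" and sl: "slides slide_source T h T' z"
  obtains i where "i \<in> {1..n}" "z = b i"
    "state s (cv(i := cv i + int n)) \<mu> (T'(z := Some (cv i + int n)))"
    "pos (T'(z := Some (cv i + int n))) = pos T'"
proof -
  obtain i where "i \<in> {1..n}" "z = b i" "holed s cv \<mu> T' z" using slides_holed_end[OF sl h] by blast
  then show ?thesis using refill_corner[of s cv \<mu> T' z i] that by blast
qed

lemma slides_dominated:
  assumes h: "holed s cv \<mu> T h" and sl: "slides slide_source T h T' z" and d: "dominated s T"
  shows "dominated s T'"
  unfolding dominated_def
  using d[unfolded dominated_def] slides_holed_covers[OF sl h] covers_below_trans by blast

lemma down_closed_iff: "\<mu> \<subseteq> L \<Longrightarrow> down_closed \<mu> \<longleftrightarrow> young_diagram \<mu>"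
proof
  assume sub: "\<mu> \<subseteq> L" and y: "young_diagram \<mu>"
  show "down_closed \<mu>" unfolding down_closed_def
    using sub young_downD[OF y] young_pos[OF young] by blast
next
  assume sub: "\<mu> \<subseteq> L" and d: "down_closed \<mu>"
  show "young_diagram \<mu>"
  proof (rule young_diagramI)
    show "finite \<mu>" using sub finite_L finite_subset by blast
    show "1 \<le> fst y \<and> 1 \<le> snd y" if "y \<in> \<mu>" for y using that sub young_pos[OF young] by blast
    show "z \<in> \<mu>" if "y \<in> \<mu>" "nw z y" "1 \<le> fst z" "1 \<le> snd z" for y z
      using that sub d young_downD[OF young, of y z] unfolding down_closed_def by blast
  qed
qed

lemma lower_step_state:
  assumes ls: "lower_step n L b T T''" and st: "state s cv \<mu> T" and d: "dominated s T"
  shows "\<exists>cv' \<mu>'. state s cv' \<mu>' T'' \<and> dominated s T''"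
proof -
  note S = stateD[OF st]
  obtain x T' z where x: "x \<in> L - dom T" "young_diagram (L - dom T - {x})"
    and sl: "slides slide_source T x T' z" and T'': "T'' = refill n b (int n) T T' z"
    using ls unfolding lower_step_def by blast
  have mu: "L - dom T = \<mu>" using S(1,2) unfolding down_closed_def by blast
  have h: "holed s cv (\<mu> - {x}) T x"
    using state_holed[OF st] x down_closed_iff[of "\<mu> - {x}"] mu by blast
  obtain i where i: "i \<in> {1..n}" "z = b i"
    "state s (cv(i := cv i + int n)) (\<mu> - {x}) (T'(z := Some (cv i + int n)))"
    "pos (T'(z := Some (cv i + int n))) = pos T'"
    using slide_step[OF h sl] by blast
  have "T'' = T'(z := Some (cv i + int n))"
    using T'' i(1,2) S(7)[OF i(1)] unfolding refill_def by auto
  then show ?thesis using i slides_dominated[OF h sl d] dominated_cong[OF i(4)] by blast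
qed

lemma lower_steps_state:
  assumes "(lower_step n L b)\<^sup>*\<^sup>* T T''" and "state s cv \<mu> T" and "dominated s T"
  shows "\<exists>cv' \<mu>'. state s cv' \<mu>' T'' \<and> dominated s T''"
  using assms(1)
proof (induction rule: rtranclp_induct)
  case base then show ?case using assms(2,3) by blast
next
  case (step T1 T2) then show ?case using lower_step_state by blast
qed

lemma lower_step_exists:
  assumes st: "state s cv \<mu> T" and ne: "\<mu> \<noteq> {}"
  shows "\<exists>x cv' T''. x \<in> \<mu> \<and> lower_step n L b T T'' \<and> state s cv' (\<mu> - {x}) T''"
proof -
  note S = stateD[OF st]
  have muL: "\<mu> \<subseteq> L" using S(1) unfolding down_closed_def by blast
  then have "finite \<mu>" using finite_L finite_subset by blast
  \<comment> \<open>A box with maximal coordinate sum has no other box of \<open>\<mu>\<close>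
    southeast of it, so it can be removed.\<close>
  then obtain x where x: "x \<in> \<mu>" "\<And>y. y \<in> \<mu> \<Longrightarrow> fst y + snd y \<le> fst x + snd x"
  proof -
    have "Max ((\<lambda>y. fst y + snd y) ` \<mu>) \<in> (\<lambda>y. fst y + snd y) ` \<mu>"
      using \<open>finite \<mu>\<close> ne by (intro Max_in) auto
    then obtain x where x: "x \<in> \<mu>" "Max ((\<lambda>y. fst y + snd y) ` \<mu>) = fst x + snd x" by blast
    have "fst y + snd y \<le> fst x + snd x" if "y \<in> \<mu>" for y
      unfolding x(2)[symmetric] using that \<open>finite \<mu>\<close> by (intro Max_ge) auto
    then show ?thesis using that[of x] x(1) by blast
  qed
  have dc: "down_closed (\<mu> - {x})"
    unfolding down_closed_def
  proof (intro conjI ballI impI)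
    fix y z assume a: "y \<in> \<mu> - {x}" "z \<in> L" "nw z y"
    have "z \<noteq> x"
    proof
      assume "z = x"
      then have "fst x \<le> fst y" "snd x \<le> snd y" "fst y + snd y \<le> fst x + snd x"
        using a x(2)[of y] by (auto simp: nw_def)
      then show False using a(1) by (auto simp: prod_eq_iff)
    qed
    then show "z \<in> \<mu> - {x}" using a S(1) unfolding down_closed_def by blast
  qed (use muL in blast)
  have h: "holed s cv (\<mu> - {x}) T x" by (rule state_holed[OF st x(1) dc])
  obtain T' z where sl: "slides slide_source T x T' z" using slides_exists[OF h] by blast
  obtain i where i: "i \<in> {1..n}" "z = b i"
    "state s (cv(i := cv i + int n)) (\<mu> - {x}) (T'(z := Some (cv i + int n)))"
    using slide_step[OF h sl] by blast
  have T'': "refill n b (int n) T T' z = T'(z := Some (cv i + int n))"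
    using i(1,2) S(7)[OF i(1)] unfolding refill_def by auto
  have mu: "L - dom T = \<mu>" using S(2) muL by blast
  have "lower_step n L b T (refill n b (int n) T T' z)"
    unfolding lower_step_def using mu x(1) dc down_closed_iff[of "\<mu> - {x}"] muL sl S(2) by blast
  then show ?thesis using i(3) T'' x(1) by metis
qed

lemma lower_steps_exist:
  assumes "state s cv \<mu> T"
  shows "\<exists>cv' T''. (lower_step n L b)\<^sup>*\<^sup>* T T'' \<and> state s cv' {} T''"
  using assms
proof (induction "card \<mu>" arbitrary: \<mu> cv T rule: less_induct)
  case less
  show ?case
  proof (cases "\<mu> = {}")
    case True then show ?thesis using less(2) by blast
  next
    case False
    obtain x cv1 T1 where x: "x \<in> \<mu>" "lower_step n L b T T1" "state s cv1 (\<mu> - {x}) T1"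
      using lower_step_exists[OF less(2) False] by blast
    have "finite \<mu>" using stateD(1)[OF less(2)] finite_L finite_subset unfolding down_closed_def by blast
    then have "card (\<mu> - {x}) < card \<mu>" using x(1) by (rule card_Diff1_less)
    then show ?thesis using less(1)[OF _ x(3)] converse_rtranclp_into_rtranclp[of "lower_step n L b"] x(2)
      by metis
  qed
qed

text \<open>At the start every letter, placed or waiting, is in the corner of its index. The words
  of rows and columns are then ordered like \<open>- idx\<close> and \<open>idx\<close>, so there is
  nothing to lose in the domination.\<close>

lemma initial_state:
  assumes T: "\<And>y x. T y = Some x \<longleftrightarrow> (\<exists>i\<in>{1..n}. y = b i \<and> x = cv i)"
    and cv: "\<And>i. i \<in> {1..n} \<Longrightarrow> idx (cv i) = i \<and> s < cv i \<and> cv i \<le> s + int n"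
  shows "state s cv (L - b ` {1..n}) T" "dominated s T"
proof -
  have n0: "0 < int n" using n1 by simp
  have cvx: "x = cv (idx x)" if "s < x" "x \<le> cv (idx x)" for x
  proof -
    have i: "idx x \<in> {1..n}" by (rule idx_range)
    have "int n dvd cv (idx x) - x" using idx_eq[of "cv (idx x)" x] cv[OF i] by simp
    moreover have "0 \<le> cv (idx x) - x" "cv (idx x) - x < int n" using that cv[OF i] by auto
    ultimately have "cv (idx x) - x = 0" 
      using zdvd_imp_le[of "int n" "cv (idx x) - x"] by (cases "cv (idx x) - x = 0") auto
    then show ?thesis by simp
  qed
  show st: "state s cv (L - b ` {1..n}) T"
    unfolding state_def
  proof (intro conjI allI impI ballI)
    show "down_closed (L - b ` {1..n})"
      unfolding down_closed_def using b_max by blast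
    show "dom T = L - (L - b ` {1..n})" using T b_in by (auto simp: dom_def)
  next
    fix y z u v assume a: "T y = Some u" "T z = Some v" "nw y z" "y \<noteq> z"
    then obtain i j where "i \<in> {1..n}" "y = b i" "j \<in> {1..n}" "z = b j" using T by blast
    then show "u < v" using b_max[of i z] b_in[of j] a by auto
  next
    fix y z u assume "T y = Some u" "T z = Some u"
    then obtain i j where "i \<in> {1..n}" "y = b i" "u = cv i" "j \<in> {1..n}" "z = b j" "u = cv j"
      using T by blast
    then show "y = z" using cv by metis
  next
    fix x
    show "(\<exists>y. T y = Some x) = (s < x \<and> x \<le> cv (idx x))"
    proof
      assume "\<exists>y. T y = Some x"
      then obtain i where "i \<in> {1..n}" "x = cv i" using T by blast
      then show "s < x \<and> x \<le> cv (idx x)" using cv by auto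
    next
      assume "s < x \<and> x \<le> cv (idx x)"
      then have "x = cv (idx x)" using cvx by blast
      then show "\<exists>y. T y = Some x" using T idx_range[of x] by blast
    qed
  next
    fix y x assume "T y = Some x"
    then obtain i where "i \<in> {1..n}" "y = b i" "x = cv i" using T by blast
    then show "nw y (b (idx x))" using cv by auto
  next
    fix i assume "i \<in> {1..n}"
    then show "T (b i) = Some (cv i)" "idx (cv i) = i" using T cv by blast+
  qed
  have posT: "pos T x = b (idx x)" for x
  proof (cases "\<exists>y. T y = Some x")
    case True
    then obtain y where y: "T y = Some x" by blast
    then obtain i where "i \<in> {1..n}" "y = b i" "x = cv i" using T by blast
    then show ?thesis using state_pos[OF st y] cv by auto
  qed (use pos_stuck in blast)
  have mono: "fst (b j) \<le> fst (b i) \<longleftrightarrow> i \<le> j" "snd (b j) \<le> snd (b i) \<longleftrightarrow> j \<le> i"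
    if "i \<in> {1..n}" "j \<in> {1..n}" for i j
    using b_mono[of i j] b_mono[of j i] that by (cases i j rule: linorder_cases; auto)+
  show "dominated s T"
    unfolding dominated_def row_def col_def posT
    using mono[OF idx_range idx_range] by (intro allI impI conjI covers_below_order) auto
qed

end

section \<open>Chains in periodic words\<close>

text \<open>Applied to \<open>e i\<close>, the first letter of index \<open>i\<close> after
  \<open>s\<close>; these ascents determine how the ends of a window cut the periodic word.\<close>

definition asc_set :: "nat \<Rightarrow> (nat \<Rightarrow> int) \<Rightarrow> nat set" where
  "asc_set n e = {l \<in> {1..<n}. e l < e (l + 1)}"

text \<open>At an ascent \<open>l\<close> one full class, of which \<open>a\<close> letters count,
  is replaced by two truncated classes with \<open>l\<close> and \<open>n - l\<close>
  letters.\<close>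

definition gain :: "nat \<Rightarrow> nat \<Rightarrow> nat \<Rightarrow> int" where
  "gain n a l = int (min a l) + int (min a (n - l)) - int a"

text \<open>The letters are partitioned into classes on which the index decreases strictly with time, so
  that a chain meets every class at most once; the classes cut off at the ends of the window
  account for the ascents.\<close>

lemma card_chain_cover_le:
  fixes idx :: "int \<Rightarrow> nat" and e :: "nat \<Rightarrow> int"
  assumes n1: "1 \<le> n" and idx_range: "\<And>x. idx x \<in> {1..n}"
    and idx_eq: "\<And>x y. idx x = idx y \<longleftrightarrow> int n dvd x - y"
    and e: "\<And>i. i \<in> {1..n} \<Longrightarrow> s < e i \<and> e i \<le> s + int n \<and> idx (e i) = i"
    and N: "n \<le> N" and S: "S \<subseteq> {s<..s + int N * int n}"
    and cov: "chain_cover a (\<lambda>x. - int (idx x)) S"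
  shows "int (card S) \<le> int N * int a + (\<Sum>l\<in>asc_set n e. gain n a l)"
proof -
  have n0: "0 < int n" using n1 by simp
  have finS: "finite S" using S finite_subset by blast
  define Asc where "Asc = asc_set n e"
  have finA: "finite Asc" by (auto simp: Asc_def asc_set_def)
  define A where "A i = card {l \<in> Asc. l < i}" for i
  have A_mono: "A i \<le> A j" if "i \<le> j" for i j
    unfolding A_def by (rule card_mono) (use finA that in auto)
  have A_Suc: "A (Suc l) = (if l \<in> Asc then Suc (A l) else A l)" for l
  proof -
    have "{m \<in> Asc. m < Suc l} = (if l \<in> Asc then insert l {m \<in> Asc. m < l} else {m \<in> Asc. m < l})"
      by (auto simp: less_Suc_eq)
    then show ?thesis using finA by (simp add: A_def)
  qed
  \<comment> \<open>Subtracting one period for every earlier ascent turns the first letters into a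
    strictly decreasing sequence.\<close>
  define \<phi> where "\<phi> i = e i - int n * int (A i)" for i
  have phi_step: "\<phi> (Suc l) < \<phi> l" if "1 \<le> l" "Suc l \<le> n" for l
  proof -
    have el: "s < e l" "e (Suc l) \<le> s + int n" "e l \<noteq> e (Suc l)"
      using e[of l] e[of "Suc l"] that by auto
    show ?thesis
    proof (cases "l \<in> Asc")
      case True
      then show ?thesis using el A_Suc[of l] by (simp add: \<phi>_def algebra_simps)
    next
      case False
      then have "e (Suc l) < e l" using el that by (auto simp: Asc_def asc_set_def)
      then show ?thesis using False A_Suc[of l] by (simp add: \<phi>_def)
    qed
  qed
  have phi_mono: "\<phi> j < \<phi> i" if "1 \<le> i" "i < j" "j \<le> n" for i j
    using that(2,1,3)
  proof (induction rule: strict_inc_induct)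
    case (base i) then show ?case using phi_step[of i] by simp
  next
    case (step i) then show ?case using phi_step[of i] by simp
  qed
  define k where "k x = nat ((x - e (idx x)) div int n)" for x
  \<comment> \<open>With this class number, \<open>x = \<phi> (idx x) + n * d x\<close>. Inside a
    class a larger index therefore means an earlier letter, whereas along a chain the index
    increases weakly with time.\<close>
  define d where "d x = k x + A (idx x)" for x
  have kx: "x = e (idx x) + int n * int (k x) \<and> k x < N" if "x \<in> S" for x
  proof -
    have sx: "s < x" "x \<le> s + int N * int n" using that S by auto
    have ei: "s < e (idx x)" "e (idx x) \<le> s + int n" "idx (e (idx x)) = idx x"
      using e[OF idx_range] by auto
    have "int n dvd x - e (idx x)" using idx_eq[of x "e (idx x)"] ei by simp
    then obtain q where q: "x - e (idx x) = int n * q" by auto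
    have "int n * (- 1) < int n * q" using q sx ei by linarith
    then have "- 1 < q" unfolding mult_less_cancel_left_pos[OF n0] .
    then have "0 \<le> q" by simp
    have "int n * q < int N * int n" using q sx ei by linarith
    then have "int n * q < int n * int N" by (simp only: mult.commute)
    then have "q < int N" unfolding mult_less_cancel_left_pos[OF n0] .
    have "k x = nat q" using q n0 by (simp add: k_def)
    then show ?thesis using q \<open>0 \<le> q\<close> \<open>q < int N\<close> by auto
  qed
  have xd: "x = \<phi> (idx x) + int n * int (d x)" if "x \<in> S" for x
    using kx[OF that] by (simp add: \<phi>_def d_def algebra_simps)
  obtain f :: "int \<Rightarrow> nat" where fa: "\<forall>x\<in>S. f x < a"
    and f: "\<forall>x\<in>S. \<forall>y\<in>S. x < y \<longrightarrow> f x = f y \<longrightarrow> - int (idx y) \<le> - int (idx x)"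
    using cov unfolding chain_cover_def by blast
  \<comment> \<open>The indices that the window leaves in class \<open>\<delta>\<close>. Classes
    with \<open>\<delta>\<close> below the number of ascents can be cut off at the beginning, those
    with \<open>\<delta> \<ge> N\<close> at the end.\<close>
  define I where "I \<delta> = {i \<in> {1..n}. A i \<le> \<delta> \<and> \<delta> < A i + N}" for \<delta>
  have same: "x = y" if "x \<in> S" "y \<in> S" "d x = d y" "idx x = idx y" for x y
    using xd[OF that(1)] xd[OF that(2)] that by simp
  have cls: "card {x \<in> S. d x = \<delta>} \<le> min a (card (I \<delta>))" for \<delta>
  proof -
    have lt: "False" if "x \<in> S" "y \<in> S" "d x = d y" "f x = f y" "x < y" for x y
    proof -
      have "idx x \<le> idx y" using f that by force
      moreover have "idx x \<noteq> idx y" using same that by force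
      ultimately have "\<phi> (idx y) < \<phi> (idx x)"
        using phi_mono[of "idx x" "idx y"] idx_range[of x] idx_range[of y] by auto
      then show False using xd[OF that(1)] xd[OF that(2)] that by simp
    qed
    have "inj_on f {x \<in> S. d x = \<delta>}"
    proof (rule inj_onI)
      fix x y assume "x \<in> {x \<in> S. d x = \<delta>}" "y \<in> {x \<in> S. d x = \<delta>}" "f x = f y"
      then show "x = y" using lt[of x y] lt[of y x] by (cases x y rule: linorder_cases) auto
    qed
    moreover have "f ` {x \<in> S. d x = \<delta>} \<subseteq> {..<a}" using fa by auto
    ultimately have 1: "card {x \<in> S. d x = \<delta>} \<le> a"
      using card_inj_on_le[of f _ "{..<a}"] by auto
    have "inj_on idx {x \<in> S. d x = \<delta>}" using same by (intro inj_onI) auto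
    moreover have "idx ` {x \<in> S. d x = \<delta>} \<subseteq> I \<delta>"
      using kx idx_range by (force simp: I_def d_def)
    moreover have "finite (I \<delta>)" by (simp add: I_def)
    ultimately have "card {x \<in> S. d x = \<delta>} \<le> card (I \<delta>)" using card_inj_on_le by blast
    then show ?thesis using 1 by simp
  qed
  define M where "M = A n"
  have AscM: "card Asc = M"
  proof -
    have "{l \<in> Asc. l < n} = Asc" by (auto simp: Asc_def asc_set_def)
    then show ?thesis by (simp add: M_def A_def)
  qed
  have "card Asc \<le> card {1..<n}" by (rule card_mono) (auto simp: Asc_def asc_set_def)
  then have MN: "M \<le> N" using AscM N by simp
  have dr: "d x < N + M" if "x \<in> S" for x
    using kx[OF that] A_mono[of "idx x" n] idx_range[of x] by (simp add: d_def M_def)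
  \<comment> \<open>The size bound for the truncated class \<open>\<delta>\<close> at the beginning;
    the class \<open>N + \<delta>\<close> at the end is left with at most
    \<open>n - \<sigma> \<delta>\<close> indices.\<close>
  define \<sigma> where "\<sigma> \<delta> = card {i \<in> {1..n}. A i \<le> \<delta>}" for \<delta>
  have "card S = (\<Sum>\<delta><N + M. card {x \<in> S. d x = \<delta>})"
    using sum.group[OF finS, of "{..<N + M}" d "\<lambda>_. 1 :: nat"] dr by (auto simp: image_subset_iff)
  also have "\<dots> \<le> (\<Sum>\<delta><N + M. min a (card (I \<delta>)))" by (rule sum_mono) (rule cls)
  also have "\<dots> = (\<Sum>\<delta><N. min a (card (I \<delta>))) + (\<Sum>\<delta><M. min a (card (I (N + \<delta>))))"
  proof -
    have "(\<Sum>\<delta>=N..<N + M. min a (card (I \<delta>))) = (\<Sum>\<delta><M. min a (card (I (N + \<delta>))))"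
      by (rule sum.reindex_bij_witness[of _ "\<lambda>\<delta>. N + \<delta>" "\<lambda>\<delta>. \<delta> - N"]) auto
    then show ?thesis unfolding lessThan_atLeast0
      by (subst sum.atLeastLessThan_concat[symmetric, of 0 N "N + M"]) auto
  qed
  also have "(\<Sum>\<delta><N. min a (card (I \<delta>)))
      = (\<Sum>\<delta><M. min a (card (I \<delta>))) + (\<Sum>\<delta>=M..<N. min a (card (I \<delta>)))"
    unfolding lessThan_atLeast0 using MN by (subst sum.atLeastLessThan_concat) auto
  finally have c1: "card S \<le> (\<Sum>\<delta><M. min a (card (I \<delta>))) + (\<Sum>\<delta>=M..<N. min a (card (I \<delta>)))
      + (\<Sum>\<delta><M. min a (card (I (N + \<delta>))))" .
  have "(\<Sum>\<delta><M. min a (card (I \<delta>))) \<le> (\<Sum>\<delta><M. min a (\<sigma> \<delta>))"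
  proof (rule sum_mono)
    fix \<delta> :: nat
    have "card (I \<delta>) \<le> \<sigma> \<delta>" unfolding I_def \<sigma>_def by (rule card_mono) auto
    then show "min a (card (I \<delta>)) \<le> min a (\<sigma> \<delta>)" by simp
  qed
  moreover have "(\<Sum>\<delta>=M..<N. min a (card (I \<delta>))) \<le> (N - M) * a"
    using sum_bounded_above[of "{M..<N}" "\<lambda>\<delta>. min a (card (I \<delta>))" a] by simp
  moreover have "(\<Sum>\<delta><M. min a (card (I (N + \<delta>)))) \<le> (\<Sum>\<delta><M. min a (n - \<sigma> \<delta>))"
  proof (rule sum_mono)
    fix \<delta> :: nat
    have "I (N + \<delta>) \<subseteq> {1..n} - {i \<in> {1..n}. A i \<le> \<delta>}" by (auto simp: I_def)
    then have "card (I (N + \<delta>)) \<le> card ({1..n} - {i \<in> {1..n}. A i \<le> \<delta>})" by (intro card_mono) auto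
    also have "\<dots> = n - \<sigma> \<delta>" unfolding \<sigma>_def by (subst card_Diff_subset) auto
    finally show "min a (card (I (N + \<delta>))) \<le> min a (n - \<sigma> \<delta>)" by simp
  qed
  ultimately have c2: "card S \<le> (\<Sum>\<delta><M. min a (\<sigma> \<delta>)) + (N - M) * a + (\<Sum>\<delta><M. min a (n - \<sigma> \<delta>))"
    using c1 by linarith
  \<comment> \<open>\<open>A\<close> jumps exactly after an ascent, so the truncation sizes are the
    ascents themselves, each occurring once.\<close>
  have sig: "\<sigma> (A l) = l" if "l \<in> Asc" for l
  proof -
    have l: "1 \<le> l" "l < n" using that by (auto simp: Asc_def asc_set_def)
    have "A l < A i" if "l < i" for i
      using A_mono[of "Suc l" i] A_Suc[of l] \<open>l \<in> Asc\<close> that by auto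
    then have "i \<le> l" if "A i \<le> A l" for i using that by (meson not_le)
    then have "{i \<in> {1..n}. A i \<le> A l} = {1..l}" using A_mono l by auto
    then show ?thesis by (simp add: \<sigma>_def)
  qed
  have injA: "inj_on A Asc"
    by (rule inj_on_inverseI[of _ \<sigma>]) (rule sig)
  have "A ` Asc \<subseteq> {..<M}"
  proof
    fix y assume "y \<in> A ` Asc"
    then obtain l where l: "l \<in> Asc" "y = A l" by auto
    then have "A l < A (Suc l)" using A_Suc by simp
    also have "A (Suc l) \<le> A n" using l by (intro A_mono) (auto simp: Asc_def asc_set_def)
    finally show "y \<in> {..<M}" using l by (simp add: M_def)
  qed
  then have "A ` Asc = {..<M}"
    by (intro card_subset_eq) (auto simp: card_image[OF injA] AscM)
  then have bij: "bij_betw A Asc {..<M}" using injA by (simp add: bij_betw_def)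
  have re: "(\<Sum>\<delta><M. G (\<sigma> \<delta>)) = (\<Sum>l\<in>Asc. G l)" for G :: "nat \<Rightarrow> nat"
    using sum.reindex_bij_betw[OF bij, of "\<lambda>\<delta>. G (\<sigma> \<delta>)"] sig by simp
  have "int (card S) \<le> (\<Sum>l\<in>Asc. int (min a l)) + int ((N - M) * a) + (\<Sum>l\<in>Asc. int (min a (n - l)))"
    using c2 unfolding re[of "\<lambda>l. min a l"] re[of "\<lambda>l. min a (n - l)"]
    by (simp only: of_nat_sum[symmetric] of_nat_add[symmetric] of_nat_le_iff)
  also have "int ((N - M) * a) = int N * int a - (\<Sum>l\<in>Asc. int a)"
    using MN AscM by (simp add: of_nat_diff algebra_simps)
  finally show ?thesis
    by (simp add: gain_def Asc_def sum.distrib sum_subtractf)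
qed

lemma gain_flip: "a \<le> n \<Longrightarrow> l \<le> n \<Longrightarrow> gain n (n - a) l = gain n a l"
  unfolding gain_def by (auto simp: min_def of_nat_diff)

lemma gain_reflect: "l \<le> n \<Longrightarrow> gain n a (n - l) = gain n a l"
  unfolding gain_def by simp

text \<open>As a function of \<open>a\<close>, the gain is a trapezoid: piecewise linear with kinks
  at \<open>l\<close> and \<open>n - l\<close>.\<close>

lemma gain_second_difference:
  assumes "1 \<le> r" "r < n" "1 \<le> l" "l < n"
  shows "2 * gain n r l - gain n (r - 1) l - gain n (r + 1) l = (if l = r then 1 else 0) + (if l = n - r then 1 else 0)"
  using assms unfolding gain_def by (auto simp: min_def of_nat_diff split: if_splits)

text \<open>The total is the number of boxes common to the first \<open>a\<close> rows and the first
  \<open>n - a\<close> columns of the staircase. This coincidence turns the upper bounds into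
  equalities in \<open>card_rows\<close>.\<close>

lemma sum_gain: "a \<le> n \<Longrightarrow> (\<Sum>l\<in>{1..<n}. gain n a l) = int a * int (n - a)"
proof -
  assume a: "a \<le> n"
  have m: "2 * (\<Sum>l\<in>{1..<n}. int (min a l)) = int a * (2 * int n - 1 - int a)" if "1 \<le> n"
    using a that
  proof (induction n rule: dec_induct)
    case base
    show ?case
    proof (induction a)
      case (Suc a)
      show ?case
      proof (cases a)
        case (Suc b)
        have "(\<Sum>l = 1..<Suc a. int (min (Suc a) l)) = (\<Sum>l = 1..<a. int (min a l)) + int a"
          using Suc by (simp add: sum.atLeastLessThan_Suc)
        then show ?thesis using Suc.IH by (simp add: algebra_simps)
      qed simp
    qed simp
  next
    case (step n)
    show ?case
    proof (cases n)
      case (Suc k)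
      have "(\<Sum>l = 1..<Suc n. int (min a l)) = (\<Sum>l = 1..<n. int (min a l)) + int a"
        using Suc step by (simp add: sum.atLeastLessThan_Suc)
      then show ?thesis using step Suc by (simp add: algebra_simps)
    qed (use step in simp)
  qed
  show ?thesis
  proof (cases "n = 0")
    case False
    have "(\<Sum>l\<in>{1..<n}. int (min a (n - l))) = (\<Sum>l\<in>{1..<n}. int (min a l))"
      by (rule sum.reindex_bij_witness[of _ "\<lambda>l. n - l" "\<lambda>l. n - l"]) auto
    then have "(\<Sum>l\<in>{1..<n}. gain n a l) = 2 * (\<Sum>l\<in>{1..<n}. int (min a l)) - (int n - 1) * int a"
      using False by (simp add: gain_def sum.distrib sum_subtractf of_nat_diff)
    then show ?thesis using m False a by (simp add: of_nat_diff algebra_simps)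
  qed (use a in simp)
qed

section \<open>Staircases and promotion\<close>

lemma exists_card_atMost:
  fixes Y :: "int set"
  assumes "finite Y" "1 \<le> k" "k \<le> card Y"
  shows "\<exists>y\<in>Y. card {z \<in> Y. z \<le> y} = k"
  using assms
proof (induction Y rule: finite_linorder_max_induct)
  case (insert b A)
  have bA: "b \<notin> A" using insert(2) by auto
  show ?case
  proof (cases "k \<le> card A")
    case True
    then obtain y where y: "y \<in> A" "card {z \<in> A. z \<le> y} = k" using insert(3,4) by auto
    have "{z \<in> insert b A. z \<le> y} = {z \<in> A. z \<le> y}" using insert(2) y(1) by force
    then show ?thesis using y by (intro bexI[of _ y]) simp_all
  next
    case False
    then have "k = card (insert b A)" using insert(1,5) bA by simp
    moreover have "{z \<in> insert b A. z \<le> b} = insert b A" using insert(2) by force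
    ultimately show ?thesis by (intro bexI[of _ b]) auto
  qed
qed simp

text \<open>Letters of equal rank form the columns of the tableau recorded by a lattice word. Within
  a column the row increases with time, so each of the \<open>a\<close> chains takes at most one
  letter of it, and the column contributes no more than its boxes in the first \<open>a\<close>
  rows.\<close>

lemma lattice_word_cover_le:
  fixes \<rho> :: "int \<Rightarrow> int"
  assumes pos: "\<And>x. s < x \<Longrightarrow> 1 \<le> \<rho> x"
    and ballot: "\<And>r v. 1 \<le> r \<Longrightarrow> card {x \<in> {s<..v}. \<rho> x = r + 1} \<le> card {x \<in> {s<..v}. \<rho> x = r}"
    and S: "S \<subseteq> {s<..t}" and cov: "chain_cover a \<rho> S"
  shows "card S \<le> card {x \<in> {s<..t}. \<rho> x \<le> int a}"
proof -
  define rank where "rank x = card {y \<in> {s<..x}. \<rho> y = \<rho> x}" for x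
  have decr: "card {x \<in> {s<..v}. \<rho> x = r'} \<le> card {x \<in> {s<..v}. \<rho> x = r}" if "r \<le> r'" "1 \<le> r" for r r' v
    using that
  proof (induction r' rule: int_ge_induct)
    case (step i) then show ?case using ballot[of i v] by simp
  qed simp
  \<comment> \<open>By the ballot condition row \<open>r\<close> has received at least as many
    letters up to \<open>x\<close> as row \<open>\<rho> x\<close>, hence also one with the rank of
    \<open>x\<close>.\<close>
  have up: "\<exists>y. s < y \<and> y \<le> x \<and> \<rho> y = r \<and> rank y = rank x" if x: "s < x" and r: "1 \<le> r" "r \<le> \<rho> x" for x r
  proof -
    define Y where "Y = {y \<in> {s<..x}. \<rho> y = r}"
    have fY: "finite Y" unfolding Y_def by (rule finite_subset[of _ "{s<..x}"]) auto
    have "x \<in> {y \<in> {s<..x}. \<rho> y = \<rho> x}" using x by simp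
    moreover have "finite {y \<in> {s<..x}. \<rho> y = \<rho> x}" by (rule finite_subset[of _ "{s<..x}"]) auto
    ultimately have "0 < rank x" unfolding rank_def by (metis card_gt_0_iff empty_iff)
    then have "1 \<le> rank x" by simp
    moreover have "rank x \<le> card Y" unfolding rank_def Y_def by (rule decr[OF r(2,1)])
    ultimately obtain y where y: "y \<in> Y" "card {z \<in> Y. z \<le> y} = rank x"
      using exists_card_atMost[OF fY] by blast
    have "{z \<in> Y. z \<le> y} = {z \<in> {s<..y}. \<rho> z = \<rho> y}" using y(1) by (auto simp: Y_def)
    then show ?thesis using y by (auto simp: rank_def Y_def)
  qed
  have inj: "\<rho> x \<noteq> \<rho> y \<or> rank x \<noteq> rank y" if "s < x" "x < y" for x y
  proof (rule ccontr)
    assume n: "\<not> ?thesis"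
    have "{z \<in> {s<..x}. \<rho> z = \<rho> x} \<subset> {z \<in> {s<..y}. \<rho> z = \<rho> y}"
    proof
      show "{z \<in> {s<..x}. \<rho> z = \<rho> x} \<subseteq> {z \<in> {s<..y}. \<rho> z = \<rho> y}" using n that by auto
      have "y \<in> {z \<in> {s<..y}. \<rho> z = \<rho> y}" "y \<notin> {z \<in> {s<..x}. \<rho> z = \<rho> x}" using that by auto
      then show "{z \<in> {s<..x}. \<rho> z = \<rho> x} \<noteq> {z \<in> {s<..y}. \<rho> z = \<rho> y}" by blast
    qed
    moreover have "finite {z \<in> {s<..y}. \<rho> z = \<rho> y}" by (rule finite_subset[of _ "{s<..y}"]) auto
    ultimately have "rank x < rank y" unfolding rank_def by (intro psubset_card_mono)
    then show False using n by simp
  qed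
  obtain f :: "int \<Rightarrow> nat" where fa: "\<And>x. x \<in> S \<Longrightarrow> f x < a"
    and f: "\<And>x y. x \<in> S \<Longrightarrow> y \<in> S \<Longrightarrow> x < y \<Longrightarrow> f x = f y \<Longrightarrow> \<rho> y \<le> \<rho> x"
    using cov unfolding chain_cover_def by blast
  define X where "X = {s<..t}"
  have finX: "finite X" by (simp add: X_def)
  have finS: "finite S" using S finX finite_subset unfolding X_def by blast
  define P where "P = {x \<in> X. \<rho> x \<le> int a}"
  have each: "card {x \<in> S. rank x = k} \<le> card {x \<in> P. rank x = k}" for k
  \<comment> \<open>A column that reaches below row \<open>a\<close> meets all of the rows
    \<open>1\<close> to \<open>a\<close>; any other column lies in \<open>P\<close>
    altogether.\<close>
  proof (cases "\<exists>z\<in>X. rank z = k \<and> int a < \<rho> z")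
    case False
    then have "{x \<in> S. rank x = k} \<subseteq> {x \<in> P. rank x = k}" using S by (force simp: P_def X_def)
    then show ?thesis by (rule card_mono[rotated]) (use finX in \<open>simp add: P_def\<close>)
  next
    case True
    then obtain z where z: "z \<in> X" "rank z = k" "int a < \<rho> z" by blast
    have lt: "False" if xy: "x \<in> S" "y \<in> S" "rank x = k" "rank y = k" "f x = f y" "x < y" for x y
    proof -
      have sx: "s < x" "s < y" using xy S by auto
      have "\<rho> y \<le> \<rho> x" using f xy by blast
      then obtain y' where y': "s < y'" "y' \<le> x" "\<rho> y' = \<rho> y" "rank y' = rank x"
        using up[OF sx(1), of "\<rho> y"] pos[OF sx(2)] by blast
      then show False using inj[of y' y] xy by auto
    qed
    have "inj_on f {x \<in> S. rank x = k}"
    proof (rule inj_onI)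
      fix x y assume "x \<in> {x \<in> S. rank x = k}" "y \<in> {x \<in> S. rank x = k}" "f x = f y"
      then show "x = y" using lt[of x y] lt[of y x] by (cases x y rule: linorder_cases) auto
    qed
    moreover have "f ` {x \<in> S. rank x = k} \<subseteq> {..<a}" using fa by auto
    ultimately have "card {x \<in> S. rank x = k} \<le> a" using card_inj_on_le[of f _ "{..<a}"] by auto
    also have "a \<le> card {x \<in> P. rank x = k}"
    proof -
      have "int ` {1..a} \<subseteq> \<rho> ` {x \<in> P. rank x = k}"
      proof
        fix r assume "r \<in> int ` {1..a}"
        then have r: "1 \<le> r" "r \<le> int a" by auto
        obtain y where "s < y" "y \<le> z" "\<rho> y = r" "rank y = rank z"
          using up[of z r] z r by (auto simp: X_def)
        then show "r \<in> \<rho> ` {x \<in> P. rank x = k}" using z r by (auto simp: P_def X_def)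
      qed
      then have "card (int ` {1..a}) \<le> card (\<rho> ` {x \<in> P. rank x = k})"
        by (rule card_mono[rotated]) (use finX in \<open>simp add: P_def\<close>)
      also have "\<dots> \<le> card {x \<in> P. rank x = k}" by (rule card_image_le) (use finX in \<open>simp add: P_def\<close>)
      finally show ?thesis by (simp add: card_image)
    qed
    finally show ?thesis .
  qed
  have sum: "card Q = (\<Sum>k\<in>rank ` X. card {x \<in> Q. rank x = k})" if "Q \<subseteq> X" for Q
    using sum.group[where S = Q and T = "rank ` X" and g = rank and h = "\<lambda>_. 1 :: nat"] finX
      finite_subset[OF that finX] image_mono[OF that, of rank] by simp
  have SX: "S \<subseteq> X" "P \<subseteq> X" using S by (auto simp: P_def X_def)
  have "card S \<le> card P"
    unfolding sum[OF SX(1)] sum[OF SX(2)] by (rule sum_mono) (rule each)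
  then show ?thesis by (simp add: P_def X_def)
qed

text \<open>Equivalently, the progressions \<open>cv i + k * n\<close> and
  \<open>cv (i + 1) + k * n\<close> alternate from their first terms on.\<close>

definition close_values :: "nat \<Rightarrow> (nat \<Rightarrow> int) \<Rightarrow> bool" where
  "close_values n cv \<longleftrightarrow> (\<forall>i. 1 \<le> i \<longrightarrow> i < n \<longrightarrow> \<bar>cv (i + 1) - cv i\<bar> < int n)"

lemma close_valuesD: "close_values n cv \<Longrightarrow> 1 \<le> i \<Longrightarrow> i < n \<Longrightarrow> \<bar>cv (i + 1) - cv i\<bar> < int n"
  unfolding close_values_def by blast

lemma close_values_flip: "close_values n cv \<Longrightarrow> close_values n (\<lambda>i. cv (n + 1 - i))"
  unfolding close_values_def
proof (intro allI impI)
  fix i assume c: "\<forall>i. 1 \<le> i \<longrightarrow> i < n \<longrightarrow> \<bar>cv (i + 1) - cv i\<bar> < int n" and i: "1 \<le> i" "i < n"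
  have "n + 1 - i = (n - i) + 1" "n + 1 - (i + 1) = n - i" "1 \<le> n - i" "n - i < n" using i by auto
  then show "\<bar>cv (n + 1 - (i + 1)) - cv (n + 1 - i)\<bar> < int n"
    using c[rule_format, of "n - i"] by (simp add: abs_minus_commute)
qed

context corners
begin

lemma state_pos_in: "state s cv {} T \<Longrightarrow> pos T x \<in> L"
  using state_pos[of s cv "{}" T _ x] stateD(2)[of s cv "{}" T] pos_stuck[of T x] b_in[OF idx_range[of x]]
  by (metis Diff_empty domI)

text \<open>The word is constant on a row, so each row is a chain.\<close>

lemma chain_cover_rows:
  assumes "state s cv {} T"
  shows "chain_cover a (row T) {x \<in> X. row T x \<le> int a}"
  unfolding chain_cover_def
proof (intro exI[of _ "\<lambda>x. fst (pos T x) - 1"] conjI ballI impI)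
  have p: "1 \<le> fst (pos T x)" for x using young_pos[OF young state_pos_in[OF assms, of x]] by simp
  show "fst (pos T x) - 1 < a" if "x \<in> {x \<in> X. row T x \<le> int a}" for x using that p[of x] by (auto simp: row_def)
  show "row T y \<le> row T x" if "fst (pos T x) - 1 = fst (pos T y) - 1" for x y
    using that p[of x] p[of y] by (simp add: row_def)
qed

lemma chain_cover_cols:
  assumes "state s cv {} T"
  shows "chain_cover a (col T) {x \<in> X. col T x \<le> int a}"
  unfolding chain_cover_def
proof (intro exI[of _ "\<lambda>x. snd (pos T x) - 1"] conjI ballI impI)
  have p: "1 \<le> snd (pos T x)" for x using young_pos[OF young state_pos_in[OF assms, of x]] by simp
  show "snd (pos T x) - 1 < a" if "x \<in> {x \<in> X. col T x \<le> int a}" for x using that p[of x] by (auto simp: col_def)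
  show "col T y \<le> col T x" if "snd (pos T x) - 1 = snd (pos T y) - 1" for x y
    using that p[of x] p[of y] by (simp add: col_def)
qed

end

section \<open>Counting in full staircase tableaux\<close>

locale staircase = corners +
  assumes stair: "y \<in> L \<longleftrightarrow> 1 \<le> fst y \<and> 1 \<le> snd y \<and> fst y + snd y \<le> n + 1"
    and b_stair: "i \<in> {1..n} \<Longrightarrow> b i = (n + 1 - i, i)"
begin

lemma staircase_transpose:
  "staircase n (\<lambda>x. n + 1 - idx x) (prod.swap ` L) (\<lambda>i. prod.swap (b (n + 1 - i)))"
proof (intro staircase.intro transpose staircase_axioms.intro)
  show "y \<in> prod.swap ` L \<longleftrightarrow> 1 \<le> fst y \<and> 1 \<le> snd y \<and> fst y + snd y \<le> n + 1" for y
  proof -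
    have "y \<in> prod.swap ` L \<longleftrightarrow> prod.swap y \<in> L" by (metis image_iff swap_swap)
    then show ?thesis using stair[of "prod.swap y"] by auto
  qed
  show "prod.swap (b (n + 1 - i)) = (n + 1 - i, i)" if "i \<in> {1..n}" for i
  proof -
    have "n + 1 - i \<in> {1..n}" using that by auto
    then show ?thesis using b_stair[of "n + 1 - i"] that by simp
  qed
qed

text \<open>The first \<open>a\<close> rows and the first \<open>n - a\<close> columns are unions of
  chains, so the periodic word bounds both numbers of letters. Together they contain every letter,
  and the filled \<open>a\<close> by \<open>n - a\<close> rectangle twice. This is exactly the sum
  of the two bounds, so both are attained. The window must contain all entries for the rectangle to
  count in full.\<close>

lemma card_rows:
  assumes st: "state s cv {} T" and d: "dominated s T" and a: "a \<le> n"
    and e: "\<And>i. i \<in> {1..n} \<Longrightarrow> s < e i \<and> e i \<le> s + int n \<and> idx (e i) = i"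
    and N: "n \<le> N" "\<And>i. i \<in> {1..n} \<Longrightarrow> cv i \<le> s + int N * int n"
  shows "int (card {x \<in> {s<..s + int N * int n}. row T x \<le> int a})
    = int N * int a + (\<Sum>l\<in>asc_set n e. gain n a l)"
proof -
  define X where "X = {s<..s + int N * int n}"
  define R where "R = {x \<in> X. row T x \<le> int a}"
  define C where "C = {x \<in> X. col T x \<le> int (n - a)}"
  have finX: "finite X" by (simp add: X_def)
  have p1: "1 \<le> fst (pos T x)" "1 \<le> snd (pos T x)" "fst (pos T x) + snd (pos T x) \<le> n + 1" for x
    using state_pos_in[OF st, of x] stair by auto
  have "chain_cover a (row T) R"
    unfolding R_def by (rule chain_cover_rows[OF st])
  then obtain R' where R': "R' \<subseteq> X" "card R' = card R" "chain_cover a (\<lambda>x. - int (idx x)) R'"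
    using covers_belowD[of "row T" "\<lambda>x. - int (idx x)" X R a] d unfolding dominated_def X_def R_def by blast
  have Rle: "int (card R) \<le> int N * int a + (\<Sum>l\<in>asc_set n e. gain n a l)"
    using card_chain_cover_le[OF n1 idx_range idx_eq e N(1) R'(1)[unfolded X_def] R'(3)] R'(2) by simp
  have "chain_cover (n - a) (col T) C"
    unfolding C_def by (rule chain_cover_cols[OF st])
  then obtain C' where C': "C' \<subseteq> X" "card C' = card C" "chain_cover (n - a) (\<lambda>x. int (idx x)) C'"
    using covers_belowD[of "col T" "\<lambda>x. int (idx x)" X C "n - a"] d unfolding dominated_def X_def C_def by blast
  \<comment> \<open>For columns the index is reversed, so the ascents are the mirrored non-ascents
    of \<open>e\<close>, and the two sums of gains complement each other to
    \<open>sum_gain\<close>.\<close>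
  define e' where "e' i = e (n + 1 - i)" for i
  interpret tr: corners n "\<lambda>x. n + 1 - idx x" "prod.swap ` L" "\<lambda>i. prod.swap (b (n + 1 - i))"
    by (rule transpose)
  have cov': "chain_cover (n - a) (\<lambda>x. - int (n + 1 - idx x)) C'"
    by (rule chain_cover_cong[OF _ C'(3)]) auto
  have e'i: "s < e' i \<and> e' i \<le> s + int n \<and> n + 1 - idx (e' i) = i" if "i \<in> {1..n}" for i
  proof -
    have "n + 1 - i \<in> {1..n}" using that by auto
    then show ?thesis using e[of "n + 1 - i"] that by (auto simp: e'_def)
  qed
  have Cle: "int (card C) \<le> int N * int (n - a) + (\<Sum>l\<in>asc_set n e'. gain n (n - a) l)"
    using card_chain_cover_le[OF n1 tr.idx_range tr.idx_eq e'i N(1) C'(1)[unfolded X_def] cov'] C'(2) by simp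
  have "(\<Sum>l\<in>asc_set n e'. gain n (n - a) l) = (\<Sum>l\<in>{1..<n} - asc_set n e. gain n a l)"
  proof (rule sum.reindex_bij_witness[of _ "\<lambda>l. n - l" "\<lambda>l. n - l"])
    fix l assume l: "l \<in> asc_set n e'"
    then have ll: "1 \<le> l" "l < n" by (auto simp: asc_set_def)
    show "n - (n - l) = l" using ll by simp
    have "n + 1 - l = n - l + 1" using ll by simp
    then show "n - l \<in> {1..<n} - asc_set n e" using l ll by (auto simp: asc_set_def e'_def)
    show "gain n a (n - l) = gain n (n - a) l" using gain_flip[OF a] gain_reflect ll by simp
  next
    fix l assume l: "l \<in> {1..<n} - asc_set n e"
    then have ll: "1 \<le> l" "l < n" by auto
    show "n - (n - l) = l" using ll by simp
    have "e l \<noteq> e (l + 1)" using e[of l] e[of "l + 1"] ll by force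
    moreover have "n + 1 - (n - l) = l + 1" "n + 1 - (n - l + 1) = l" using ll by auto
    ultimately show "n - l \<in> asc_set n e'" using l ll by (auto simp: asc_set_def e'_def)
  qed
  also have "\<dots> = int a * int (n - a) - (\<Sum>l\<in>asc_set n e. gain n a l)"
  proof -
    have "asc_set n e \<subseteq> {1..<n}" by (auto simp: asc_set_def)
    then show ?thesis using sum_gain[OF a] sum.subset_diff[of "asc_set n e" "{1..<n}" "gain n a"] by simp
  qed
  finally have up: "int (card R) + int (card C) \<le> int N * int n + int a * int (n - a)
      \<and> int (card C) \<le> int N * int (n - a) + int a * int (n - a) - (\<Sum>l\<in>asc_set n e. gain n a l)"
    using Rle Cle a by (simp add: of_nat_diff algebra_simps)
  have "row T x \<le> int a \<or> col T x \<le> int (n - a)" for x using p1(3)[of x] a by (auto simp: row_def col_def)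
  then have "R \<union> C = X" by (auto simp: R_def C_def)
  then have "card (R \<union> C) = N * n" by (simp add: X_def nat_mult_distrib)
  moreover have "a * (n - a) \<le> card (R \<inter> C)"
  proof -
    have box: "y \<in> L" if "y \<in> {1..a} \<times> {1..n - a}" for y using that stair[of y] a by auto
    have Ty: "\<exists>x. T y = Some x" if "y \<in> {1..a} \<times> {1..n - a}" for y
      using stateD(2)[OF st] box[OF that] by blast
    have "inj_on (\<lambda>y. the (T y)) ({1..a} \<times> {1..n - a})"
      by (rule inj_onI) (use Ty stateD(4)[OF st] in \<open>metis option.sel\<close>)
    moreover have "(\<lambda>y. the (T y)) ` ({1..a} \<times> {1..n - a}) \<subseteq> R \<inter> C"
    proof
      fix x assume "x \<in> (\<lambda>y. the (T y)) ` ({1..a} \<times> {1..n - a})"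
      then obtain y where y: "y \<in> {1..a} \<times> {1..n - a}" "T y = Some x" using Ty by fastforce
      have "s < x" "x \<le> cv (idx x)" using stateD(5)[OF st, of x] y(2) by blast+
      then have "x \<in> X" using N(2)[OF idx_range[of x]] by (simp add: X_def)
      then show "x \<in> R \<inter> C" using y state_pos[OF st y(2)] by (auto simp: R_def C_def row_def col_def)
    qed
    ultimately have "card ({1..a} \<times> {1..n - a}) \<le> card (R \<inter> C)"
      by (rule card_inj_on_le) (use finX in \<open>simp add: R_def\<close>)
    then show ?thesis by simp
  qed
  moreover have "card R + card C = card (R \<union> C) + card (R \<inter> C)"
    by (rule card_Un_Int) (use finX in \<open>auto simp: R_def C_def\<close>)
  ultimately have "int N * int n + int a * int (n - a) \<le> int (card R) + int (card C)"
    by (metis add_left_mono of_nat_add of_nat_le_iff of_nat_mult)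
  moreover have "int N * int n = int N * int a + int N * int (n - a)" using a by (simp add: of_nat_diff algebra_simps)
  ultimately show ?thesis using Rle up unfolding R_def X_def by linarith
qed

text \<open>The number of letters of row \<open>r = n + 1 - i\<close> in a large window is a
  difference of two values of \<open>card_rows\<close>. Of these, \<open>i\<close> are entries and
  the rest wait in the corner. The number of waiting letters fixes the last placed one, which is
  \<open>cv i\<close>.\<close>

lemma corner_value:
  assumes st: "state s cv {} T" and d: "dominated s T"
    and e: "\<And>i. i \<in> {1..n} \<Longrightarrow> s < e i \<and> e i \<le> s + int n \<and> idx (e i) = i"
    and i: "i \<in> {1..n}"
  shows "cv i = e i + int n * (int i - 1 -
    ((\<Sum>l\<in>asc_set n e. gain n (n + 1 - i) l) - (\<Sum>l\<in>asc_set n e. gain n (n - i) l)))"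
proof -
  note S = stateD[OF st]
  have n0: "0 < int n" using n1 by simp
  define M where "M = Max (cv ` {1..n})"
  have M: "cv j \<le> M" if "j \<in> {1..n}" for j unfolding M_def using that by (intro Max_ge) auto
  \<comment> \<open>Any window that reaches beyond all entries would do; the summand
    \<open>n\<close> provides the hypothesis \<open>n \<le> N\<close> of the counting.\<close>
  define N where "N = n + nat (M - s)"
  have NM: "cv j \<le> s + int N * int n" if "j \<in> {1..n}" for j
  proof -
    have "cv j - s \<le> int (nat (M - s))" using M[OF that] by simp
    also have "\<dots> \<le> int N" by (simp add: N_def)
    also have "int N * 1 \<le> int N * int n" using n1 by (intro mult_left_mono) auto
    finally show ?thesis by simp
  qed
  define r where "r = n + 1 - i"
  have r: "1 \<le> r" "r \<le> n" "r - 1 = n - i" "r + i = n + 1" using i by (auto simp: r_def)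
  define X where "X = {s<..s + int N * int n}"
  have finX: "finite X" by (simp add: X_def)
  define E where "E a = (\<Sum>l\<in>asc_set n e. gain n a l)" for a
  have cR: "int (card {x \<in> X. row T x \<le> int a}) = int N * int a + E a" if "a \<le> n" for a
    unfolding X_def E_def by (rule card_rows[OF st d that e]) (use NM in \<open>auto simp: N_def\<close>)
  have "{x \<in> X. row T x \<le> int r} = {x \<in> X. row T x \<le> int (r - 1)} \<union> {x \<in> X. row T x = int r}"
    using r by auto
  then have "card {x \<in> X. row T x \<le> int r}
      = card {x \<in> X. row T x \<le> int (r - 1)} + card {x \<in> X. row T x = int r}"
    by (simp only:) (rule card_Un_disjoint, use finX r(1) in auto)
  then have row_r: "int (card {x \<in> X. row T x = int r}) = int N + E r - E (r - 1)"
    using cR[of r] cR[of "r - 1"] r by (simp add: of_nat_diff algebra_simps)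
  define F where "F = (\<lambda>c. the (T (r, c))) ` {1..i}"
  define W where "W = {x \<in> X. idx x = i \<and> cv i < x}"
  have Trc: "\<exists>x. T (r, c) = Some x" if "c \<in> {1..i}" for c
    using S(2) stair[of "(r, c)"] that r by (metis Diff_empty One_nat_def Suc_eq_plus1 add_le_cancel_left atLeastAtMost_iff domD fst_conv snd_conv)
  have bi: "b i = (r, i)" using b_stair[OF i] by (simp add: r_def)
  have "{x \<in> X. row T x = int r} = F \<union> W"
  proof (intro set_eqI iffI)
    fix x assume x: "x \<in> {x \<in> X. row T x = int r}"
    show "x \<in> F \<union> W"
    proof (cases "\<exists>y. T y = Some x")
      case True
      then obtain y where y: "T y = Some x" by blast
      then have "y \<in> L" "fst y = r" using S(2) x state_pos[OF st y] by (auto simp: row_def)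
      then have "y = (r, snd y)" "snd y \<in> {1..i}" using stair[of y] r by (auto simp: prod_eq_iff)
      then show ?thesis using y by (force simp: F_def)
    next
      case False
      then have "pos T x = b (idx x)" using pos_stuck by blast
      then have "n + 1 - idx x = r" using x b_stair[OF idx_range[of x]] by (simp add: row_def)
      then have "idx x = i" using idx_range[of x] i by (auto simp: r_def)
      moreover have "cv i < x" using S(5)[of x] False x \<open>idx x = i\<close> by (auto simp: X_def)
      ultimately show ?thesis using x by (simp add: W_def)
    qed
  next
    fix x assume "x \<in> F \<union> W"
    then show "x \<in> {x \<in> X. row T x = int r}"
    proof
      assume "x \<in> F"
      then obtain c where c: "c \<in> {1..i}" "T (r, c) = Some x" using Trc by (fastforce simp: F_def)
      have "s < x" "x \<le> cv (idx x)" using S(5)[of x] c(2) by blast+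
      then show ?thesis using NM[OF idx_range[of x]] state_pos[OF st c(2)] by (simp add: X_def row_def)
    next
      assume "x \<in> W"
      then have x: "x \<in> X" "idx x = i" "cv i < x" by (auto simp: W_def)
      then have "pos T x = b i" using pos_stuck[of T x] S(5)[of x] by fastforce
      then show ?thesis using x bi by (simp add: row_def)
    qed
  qed
  moreover have "F \<inter> W = {}"
  proof -
    have "x \<le> cv (idx x)" if "x \<in> F" for x
      using that Trc S(5)[of x] by (fastforce simp: F_def)
    then show ?thesis by (force simp: W_def)
  qed
  moreover have "card F = i"
  proof -
    have "inj_on (\<lambda>c. the (T (r, c))) {1..i}"
    proof (rule inj_onI)
      fix c c' assume a: "c \<in> {1..i}" "c' \<in> {1..i}" "the (T (r, c)) = the (T (r, c'))"
      obtain x x' where "T (r, c) = Some x" "T (r, c') = Some x'" using Trc a by metis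
      then show "c = c'" using S(4)[of "(r, c)" x "(r, c')"] a(3) by simp
    qed
    then show ?thesis by (simp add: F_def card_image)
  qed
  moreover have "finite F" "finite W" using finX by (auto simp: F_def W_def)
  ultimately have cW: "int (card W) = int N + E r - E (r - 1) - int i"
    using row_r by (simp add: card_Un_disjoint)
  obtain k where k: "cv i - e i = int n * k"
    using idx_eq[of "cv i" "e i"] S(8)[OF i] e[OF i] by auto
  have kN: "k < int N"
  proof -
    have "int n * k < int n * int N" using NM[OF i] e[OF i] k mult.commute[of "int N" "int n"] by linarith
    then show ?thesis using n0 by simp
  qed
  have "W = (\<lambda>j. e i + int n * j) ` {k<..<int N}"
  proof (intro set_eqI iffI)
    fix x assume x: "x \<in> W"
    then have "idx x = idx (e i)" using e[OF i] by (simp add: W_def)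
    then have "int n dvd x - e i" using idx_eq by simp
    then obtain j where j: "x - e i = int n * j" by auto
    have "int n * k < int n * j" using x k j by (simp add: W_def)
    moreover have "int n * j < int n * int N" 
    proof -
      have "x \<le> s + int N * int n" using x by (simp add: W_def X_def)
      then show ?thesis using j e[OF i] mult.commute[of "int N" "int n"] by linarith
    qed
    ultimately have "j \<in> {k<..<int N}" using n0 by simp
    then show "x \<in> (\<lambda>j. e i + int n * j) ` {k<..<int N}" using j by (intro image_eqI[of _ _ j]) auto
  next
    fix x assume "x \<in> (\<lambda>j. e i + int n * j) ` {k<..<int N}"
    then obtain j where "j \<in> {k<..<int N}" and j: "x = e i + int n * j" by blast
    then have j': "k < j" "j < int N" by auto
    have "idx x = i" using idx_eq[of x "e i"] j e[OF i] by simp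
    moreover have "int n * k < int n * j" using j' n0 by simp
    moreover have "int n * j \<le> int n * (int N - 1)" using j' n0 by simp
    moreover have "s < cv i" using S(5)[of "cv i"] S(7)[OF i] by blast
    moreover have "int n * (int N - 1) = int N * int n - int n" by (simp add: algebra_simps)
    ultimately have "idx x = i" "cv i < x" "s < x" "x \<le> s + int N * int n" using j k e[OF i] by linarith+
    then show "x \<in> W" by (simp add: W_def X_def)
  qed
  moreover have "inj_on (\<lambda>j. e i + int n * j) {k<..<int N}" using n0 by (intro inj_onI) simp
  ultimately have "int (card W) = int N - k - 1" using kN by (simp add: card_image)
  then have "k = int i - 1 - (E r - E (r - 1))" using cW by simp
  then show ?thesis using k r(3) by (simp add: E_def r_def)
qed

lemma exists_first_letters:
  obtains e where "\<And>i. i \<in> {1..n} \<Longrightarrow> s < e i \<and> e i \<le> s + int n \<and> idx (e i) = i"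
proof -
  have "inj_on idx {s<..s + int n}"
  proof (rule inj_onI)
    fix x y assume a: "x \<in> {s<..s + int n}" "y \<in> {s<..s + int n}" "idx x = idx y"
    have "int n dvd x - y" using a(3) idx_eq by simp
    moreover have "\<bar>x - y\<bar> < int n" using a(1,2) by auto
    ultimately show "x = y" using dvd_imp_le_int[of "x - y" "int n"] by force
  qed
  then have "card (idx ` {s<..s + int n}) = card {1..n}" by (simp add: card_image)
  moreover have "idx ` {s<..s + int n} \<subseteq> {1..n}" using idx_range by blast
  ultimately have im: "idx ` {s<..s + int n} = {1..n}" by (simp add: card_subset_eq)
  have "\<exists>x. s < x \<and> x \<le> s + int n \<and> idx x = i" if "i \<in> {1..n}" for i
  proof -
    have "i \<in> idx ` {s<..s + int n}" using that im by simp
    then show ?thesis by auto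
  qed
  then show ?thesis using that by metis
qed

text \<open>Neighbouring values differ by \<open>e (i + 1) - e i\<close> plus \<open>n\<close> times
  one minus a second difference of gains. That second difference is \<open>1\<close> or
  \<open>2\<close> if \<open>i\<close> is an ascent and \<open>0\<close> or \<open>1\<close> if not,
  which compensates the sign of \<open>e (i + 1) - e i\<close>.\<close>

lemma corner_values_close:
  assumes st: "state s cv {} T" and d: "dominated s T"
  shows "close_values n cv"
  unfolding close_values_def
proof (intro allI impI)
  fix i assume i: "1 \<le> i" "i < n"
  obtain e where e: "\<And>i. i \<in> {1..n} \<Longrightarrow> s < e i \<and> e i \<le> s + int n \<and> idx (e i) = i"
    using exists_first_letters by blast
  define E where "E a = (\<Sum>l\<in>asc_set n e. gain n a l)" for a
  define r where "r = n - i"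
  have r: "1 \<le> r" "r < n" "n - r = i" "n + 1 - i = r + 1" "n - (i + 1) = r - 1" "n + 1 - (i + 1) = r"
    using i by (auto simp: r_def)
  have fin: "finite (asc_set n e)" by (simp add: asc_set_def)
  have "2 * E r - E (r - 1) - E (r + 1)
      = (\<Sum>l\<in>asc_set n e. 2 * gain n r l - gain n (r - 1) l - gain n (r + 1) l)"
    by (simp add: E_def sum_subtractf sum_distrib_left)
  also have "\<dots> = (\<Sum>l\<in>asc_set n e. (if l = r then 1 else 0) + (if l = i then 1 else 0))"
    by (rule sum.cong) (use gain_second_difference[OF r(1,2)] r in \<open>auto simp: asc_set_def\<close>)
  also have "\<dots> = (if r \<in> asc_set n e then 1 else 0) + (if i \<in> asc_set n e then 1 else 0)"
    using fin by (simp add: sum.distrib)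
  finally have E2: "2 * E r - E (r - 1) - E (r + 1)
      = (if r \<in> asc_set n e then 1 else 0) + (if i \<in> asc_set n e then 1 else 0)" .
  have "cv i = e i + int n * (int i - 1 - (E (r + 1) - E r))"
    using corner_value[OF st d e, of i] i r unfolding E_def r_def by simp
  moreover have "cv (i + 1) = e (i + 1) + int n * (int i - (E r - E (r - 1)))"
    using corner_value[OF st d e, of "i + 1"] i r(5,6) unfolding E_def by simp
  ultimately have "cv (i + 1) - cv i = e (i + 1) - e i + int n * (1 - (2 * E r - E (r - 1) - E (r + 1)))"
    by (simp add: algebra_simps)
  moreover have "e i < e (i + 1) \<longleftrightarrow> i \<in> asc_set n e" using i by (simp add: asc_set_def)
  moreover have "\<bar>e (i + 1) - e i\<bar> < int n" "e i \<noteq> e (i + 1)" using e[of i] e[of "i + 1"] i by auto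
  ultimately show "\<bar>cv (i + 1) - cv i\<bar> < int n" using E2 by (auto split: if_splits)
qed

text \<open>A crude bound relative to \<open>s\<close> that depends only on \<open>n\<close>. It
  decides how early the promotions have to start.\<close>

lemma corner_values_bounded:
  assumes st: "state s cv {} T" and d: "dominated s T" and i: "i \<in> {1..n}"
  shows "cv i \<le> s + int (n + n * (n + 2 * (n * n)))"
proof -
  obtain e where e: "\<And>i. i \<in> {1..n} \<Longrightarrow> s < e i \<and> e i \<le> s + int n \<and> idx (e i) = i"
    using exists_first_letters by blast
  define E where "E a = (\<Sum>l\<in>asc_set n e. gain n a l)" for a
  have E: "\<bar>E a\<bar> \<le> int (n * n)" if "a \<le> n" for a
  proof -
    have "\<bar>E a\<bar> \<le> (\<Sum>l\<in>asc_set n e. \<bar>gain n a l\<bar>)" unfolding E_def by (rule sum_abs)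
    also have "\<dots> \<le> (\<Sum>l\<in>asc_set n e. int n)"
      by (rule sum_mono) (use that in \<open>auto simp: gain_def asc_set_def\<close>)
    also have "\<dots> = int (card (asc_set n e)) * int n" by simp
    also have "\<dots> \<le> int n * int n"
    proof (rule mult_right_mono)
      have "card (asc_set n e) \<le> card {1..<n}" by (rule card_mono) (auto simp: asc_set_def)
      then show "int (card (asc_set n e)) \<le> int n" by simp
    qed simp
    finally show ?thesis by simp
  qed
  have "int i - 1 - (E (n + 1 - i) - E (n - i)) \<le> int (n + 2 * (n * n))"
  proof -
    have "n + 1 - i \<le> n" "n - i \<le> n" "int i \<le> int n" using i by auto
    then show ?thesis using E[of "n + 1 - i"] E[of "n - i"] by simp
  qed
  then have "int n * (int i - 1 - (E (n + 1 - i) - E (n - i))) \<le> int n * int (n + 2 * (n * n))"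
    by (rule mult_left_mono) simp
  then have "cv i - e i \<le> int n * int (n + 2 * (n * n))"
    using corner_value[OF st d e i] unfolding E_def by linarith
  then show ?thesis using e[OF i] by simp
qed

text \<open>The letters of row \<open>r + 1\<close> are matched with smaller letters of row \<open>r\<close>: a letter in a box with the
  entry above it, and the letters waiting in the corner with the corner entry of row \<open>r\<close> and
  the letters waiting there.\<close>

lemma exists_row_matching:
  assumes inj: "\<And>y z u. T y = Some u \<Longrightarrow> T z = Some u \<Longrightarrow> y = z"
    and filled: "\<And>x. (\<exists>y. T y = Some x) \<longleftrightarrow> s < x \<and> x \<le> cv (idx x)"
    and dom: "dom T \<subseteq> L"
    and r: "1 \<le> r" "r < n" and Tb: "T (b (n + 1 - r)) = Some (cv (n + 1 - r))"
    and cv: "\<And>i. i \<in> {1..n} \<Longrightarrow> idx (cv i) = i"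
    and close: "\<bar>cv (n - r + 1) - cv (n - r)\<bar> < int n"
    and A: "\<And>x. x \<in> A \<Longrightarrow> s < x \<and> row T x = int (r + 1)"
    and above: "\<And>x c. x \<in> A \<Longrightarrow> T (r + 1, c) = Some x \<Longrightarrow> \<exists>u. T (r, c) = Some u \<and> u < x"
  shows "\<exists>g. inj_on g A \<and> (\<forall>x\<in>A. row T (g x) = int r \<and> g x < x \<and>
    ((\<exists>c. T (r + 1, c) = Some x \<and> T (r, c) = Some (g x)) \<or> cv (n + 1 - r) \<le> g x))"
proof -
  define i where "i = n - r"
  have i: "i \<in> {1..n}" "i + 1 \<in> {1..n}" "n + 1 - r = i + 1" "n + 1 - i = r + 1" "n + 1 - (i + 1) = r"
    using r by (auto simp: i_def)
  have bi: "b i = (r + 1, i)" "b (i + 1) = (r, i + 1)" using b_stair[OF i(1)] b_stair[OF i(2)] i(4,5) by auto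
  \<comment> \<open>The shift that carries the first letter \<open>cv i + n\<close> waiting in row
    \<open>r + 1\<close> to the corner entry \<open>cv (i + 1)\<close> of row \<open>r\<close>.
    Closeness makes it positive, so partners are smaller.\<close>
  define \<Delta> where "\<Delta> = cv i + int n - cv (i + 1)"
  have D: "0 < \<Delta>" using close by (simp add: \<Delta>_def i_def)
  define g where "g x = (if \<exists>y. T y = Some x then the (T (r, snd (pos T x))) else x - \<Delta>)" for x
  have boxed: "\<exists>c. T (r + 1, c) = Some x \<and> T (r, c) = Some (g x) \<and> g x < x \<and> c \<le> i"
    if x: "x \<in> A" "\<exists>y. T y = Some x" for x
  proof -
    obtain y where y: "T y = Some x" using x(2) by blast
    have py: "pos T x = y" by (rule pos_eq) (use inj y in blast)+
    have yc: "y = (r + 1, snd y)" using A[OF x(1)] py by (auto simp: row_def prod_eq_iff)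
    then have T1: "T (r + 1, snd y) = Some x" using y by simp
    obtain u where u: "T (r, snd y) = Some u" "u < x" using above[OF x(1) T1] by blast
    have "y \<in> L" using y dom by blast
    then have "snd y \<le> i" using stair[of y] yc r by (cases y) (auto simp: i_def)
    moreover have "g x = u" using x(2) u py by (simp add: g_def)
    ultimately show ?thesis using T1 u by blast
  qed
  have waiting: "pos T (g x) = b (i + 1) \<and> g x = x - \<Delta> \<and> cv (i + 1) \<le> g x"
    if x: "x \<in> A" "\<nexists>y. T y = Some x" for x
  proof -
    have "pos T x = b (idx x)" using pos_stuck x(2) by blast
    then have "n + 1 - idx x = r + 1" using A[OF x(1)] b_stair[OF idx_range[of x]] by (simp add: row_def)
    then have ix: "idx x = i" using idx_range[of x] by (auto simp: i_def)
    then have "cv i < x" using filled[of x] x A[OF x(1)] by auto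
    moreover have "int n dvd x - cv i" using idx_eq[of x "cv i"] ix cv[OF i(1)] by simp
    then obtain k where k: "x - cv i = int n * k" by auto
    ultimately have "0 < int n * k" by simp
    then have k1: "1 \<le> k" using n1 by (simp add: zero_less_mult_iff)
    have gx: "g x = x - \<Delta>" using x(2) by (simp add: g_def)
    have gk: "g x - cv (i + 1) = int n * (k - 1)" using gx k by (simp add: \<Delta>_def algebra_simps)
    have ge: "cv (i + 1) \<le> g x" using gk k1 n1 by (smt (verit) mult_nonneg_nonneg of_nat_0_le_iff)
    have ig: "idx (g x) = i + 1" using idx_eq[of "g x" "cv (i + 1)"] gk cv[OF i(2)] by simp
    have "pos T (g x) = b (i + 1)"
    proof (cases "\<exists>y. T y = Some (g x)")
      case True
      then have "g x \<le> cv (i + 1)" using filled[of "g x"] ig by simp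
      then have "g x = cv (i + 1)" using ge by simp
      moreover have "T (b (i + 1)) = Some (cv (i + 1))" using Tb i(3) by simp
      ultimately show ?thesis by (intro pos_eq) (use inj in auto)
    next
      case False then show ?thesis using pos_stuck[of T "g x"] ig by auto
    qed
    then show ?thesis using gx ge by blast
  qed
  have gpos: "T (r, c) = Some (g x) \<Longrightarrow> pos T (g x) = (r, c)" for x c
    by (rule pos_eq) (use inj in blast)+
  have "inj_on g A"
  proof (rule inj_onI)
    fix x x' assume a: "x \<in> A" "x' \<in> A" "g x = g x'"
    have mixed: "False" if uv: "u \<in> A" "v \<in> A" "g u = g v" "\<exists>y. T y = Some u" "\<nexists>y. T y = Some v" for u v
    proof -
      obtain c where c: "T (r, c) = Some (g u)" "c \<le> i" using boxed[OF uv(1,4)] by blast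
      have "pos T (g v) = (r, c)" using gpos[OF c(1)] uv(3) by simp
      moreover have "pos T (g v) = (r, i + 1)" using waiting[OF uv(2,5)] bi(2) by metis
      ultimately show False using c(2) by simp
    qed
    consider "\<exists>y. T y = Some x" "\<exists>y. T y = Some x'" | "\<nexists>y. T y = Some x" "\<nexists>y. T y = Some x'"
      using mixed[OF a] mixed[OF a(2,1) a(3)[symmetric]] by blast
    then show "x = x'"
    proof cases
      case 1
      obtain c where c: "T (r + 1, c) = Some x" "T (r, c) = Some (g x)" using boxed[OF a(1) 1(1)] by blast
      obtain c' where c': "T (r + 1, c') = Some x'" "T (r, c') = Some (g x')" using boxed[OF a(2) 1(2)] by blast
      have "(r, c) = (r, c')" using inj[OF c(2)] c'(2) a(3) by simp
      then show ?thesis using c(1) c'(1) by simp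
    next
      case 2
      then have "g x = x - \<Delta>" "g x' = x' - \<Delta>" using waiting[OF a(1)] waiting[OF a(2)] by blast+
      then show ?thesis using a(3) by linarith
    qed
  qed
  moreover have "row T (g x) = int r \<and> g x < x \<and>
    ((\<exists>c. T (r + 1, c) = Some x \<and> T (r, c) = Some (g x)) \<or> cv (n + 1 - r) \<le> g x)" if x: "x \<in> A" for x
  proof (cases "\<exists>y. T y = Some x")
    case True
    then obtain c where c: "T (r + 1, c) = Some x" "T (r, c) = Some (g x)" "g x < x" using boxed[OF x] by blast
    then show ?thesis using gpos[OF c(2)] by (auto simp: row_def)
  next
    case False
    then have w: "pos T (g x) = b (i + 1)" "g x = x - \<Delta>" "cv (i + 1) \<le> g x" using waiting[OF x] by blast+
    have "row T (g x) = int r" unfolding row_def w(1) bi(2) by simp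
    moreover have "g x < x" using w(2) D by linarith
    ultimately show ?thesis using w(3) unfolding i(3) by blast
  qed
  ultimately show ?thesis by blast
qed

text \<open>Here the letters after \<open>\<tau>\<close> must be matched. The partners stay above
  \<open>\<tau>\<close>: entries of row \<open>r\<close> to the right of the hole, in particular its
  corner entry, exceed the moved letter, and the other partners are at least that corner
  entry.\<close>

lemma holed_push_rows:
  assumes h: "holed s cv {} T h" and m: "slide_move T h z" and s: "s \<le> s'"
    and close: "close_values n cv"
  shows "covers_below (row T) (row (T(h := T z, z := None))) {s'<..t}"
proof -
  note H = holedD[OF h] and M = holed_move[OF h m]
  define T' where "T' = T(h := T z, z := None)"
  obtain \<tau> where tau: "T z = Some \<tau>" using m unfolding slide_move_def by auto
  have row': "row T' = (row T)(\<tau> := int (fst h))" using M(2) tau unfolding T'_def row_def by auto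
  have rowt: "row T \<tau> = int (fst z)" using M(3) tau by (simp add: row_def)
  show ?thesis
  proof (cases "z = right_of h \<or> \<tau> \<notin> {s'<..t}")
    case True
    then have "row T x = row T' x" if "x \<in> {s'<..t}" for x
      using that row' rowt by (auto simp: right_of_conv)
    then show ?thesis unfolding T'_def[symmetric] by (intro covers_below_refl) auto
  next
    case False
    then have z: "z = below h" and tX: "\<tau> \<in> {s'<..t}" using m unfolding slide_move_def by auto
    obtain r c where hrc: "h = (r, c)" by (cases h)
    have zrc: "z = (r + 1, c)" using z hrc by simp
    have zL: "z \<in> L" using tau H(4) by blast
    have r: "1 \<le> r" "r < n" "1 \<le> c" "r + c \<le> n" using stair[of z] stair[of h] zL H(2) hrc zrc by auto
    have later: "\<tau> < u" if "T y = Some u" "fst y = r" "c < snd y" for y u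
    proof -
      have ry: "nw (right_of h) y" using that hrc by (auto simp: nw_def)
      have "right_of h \<in> L" using stair[of "right_of h"] hrc r by auto
      then have d: "right_of h \<in> dom T" using holed_neighbour[OF h] by simp
      then obtain u' where u': "T (right_of h) = Some u'" by auto
      have "the (T z) \<le> the (T (right_of h))" using m d unfolding slide_move_def by blast
      then have "\<tau> \<le> u'" using u' tau by simp
      moreover have "\<tau> \<noteq> u'" using H(6)[of z \<tau> "right_of h"] tau u' z
        by (auto simp: right_of_conv below_conv)
      moreover have "u' \<le> u" using H(5)[OF u' that(1) ry] u' that(1) by (cases "right_of h = y") auto
      ultimately show ?thesis by auto
    qed
    have rn: "n + 1 - r \<in> {1..n}" using r by auto
    then have bc: "b (n + 1 - r) = (r, n + 1 - r)" using b_stair[of "n + 1 - r"] r by simp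
    have Tb: "T (b (n + 1 - r)) = Some (cv (n + 1 - r))" using H(9)[OF rn] bc hrc r by auto
    have cvt: "\<tau> < cv (n + 1 - r)" using later[OF Tb] bc r by auto
    have "covers_below (row T) ((row T)(\<tau> := int r)) {s'<..t}"
    proof (rule covers_below_lower)
      show "row T \<tau> = int r + 1" using rowt zrc by simp
      fix v
      define A where "A = {x \<in> {s'<..t}. \<tau> < x \<and> x \<le> v \<and> row T x = int r + 1}"
      define B where "B = {x \<in> {s'<..t}. \<tau> < x \<and> x \<le> v \<and> row T x = int r}"
      have right: "c < c'" if "x \<in> A" "T (r + 1, c') = Some x" for x c'
      proof (rule ccontr)
        assume "\<not> c < c'"
        then have "x \<le> \<tau>" using H(5)[OF that(2) tau] zrc that(2) tau
          by (cases "c' = c") (auto simp: nw_def)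
        then show False using that(1) by (simp add: A_def)
      qed
      have "\<exists>g. inj_on g A \<and> (\<forall>x\<in>A. row T (g x) = int r \<and> g x < x \<and>
        ((\<exists>c. T (r + 1, c) = Some x \<and> T (r, c) = Some (g x)) \<or> cv (n + 1 - r) \<le> g x))"
      proof (rule exists_row_matching[of T s cv r A])
        show "(\<exists>y. T y = Some x) = (s < x \<and> x \<le> cv (idx x))" for x by (rule H(7))
        show "dom T \<subseteq> L" using H(4) by blast
        show "1 \<le> r" "r < n" by (fact r)+
        show "T (b (n + 1 - r)) = Some (cv (n + 1 - r))" by (fact Tb)
        show "idx (cv i) = i" if "i \<in> {1..n}" for i using H(10)[OF that] .
        show "\<bar>cv (n - r + 1) - cv (n - r)\<bar> < int n" using close_valuesD[OF close, of "n - r"] r by simp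
        show "s < x \<and> row T x = int (r + 1)" if "x \<in> A" for x using that s by (auto simp: A_def)
        show "\<exists>u. T (r, c') = Some u \<and> u < x" if x: "x \<in> A" "T (r + 1, c') = Some x" for x c'
        proof -
          have "c < c'" using right[OF x] .
          have "(r + 1, c') \<in> L" using x(2) H(4) by blast
          then have "(r, c') \<in> L" using stair[of "(r + 1, c')"] stair[of "(r, c')"] r by simp
          then have "(r, c') \<in> dom T" using H(4) hrc \<open>c < c'\<close> by auto
          then obtain u where u: "T (r, c') = Some u" by auto
          then show ?thesis using H(5)[OF u x(2)] by (auto simp: nw_def)
        qed
      qed (use H(6) in blast)
      then obtain g where g: "inj_on g A" "\<And>x. x \<in> A \<Longrightarrow> row T (g x) = int r" "\<And>x. x \<in> A \<Longrightarrow> g x < x"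
        "\<And>x. x \<in> A \<Longrightarrow> (\<exists>c. T (r + 1, c) = Some x \<and> T (r, c) = Some (g x)) \<or> cv (n + 1 - r) \<le> g x"
        by blast
      have "g ` A \<subseteq> B"
      proof
        fix y assume "y \<in> g ` A"
        then obtain x where x: "x \<in> A" "y = g x" by blast
        have "\<tau> < g x" using g(4)[OF x(1)]
        proof
          assume "\<exists>c. T (r + 1, c) = Some x \<and> T (r, c) = Some (g x)"
          then obtain c' where "T (r + 1, c') = Some x" "T (r, c') = Some (g x)" by blast
          then show ?thesis using later[of "(r, c')" "g x"] right[OF x(1)] by simp
        qed (use cvt in simp)
        then show "y \<in> B" using g(2,3)[OF x(1)] x tX by (auto simp: A_def B_def)
      qed
      moreover have "finite B" by (rule finite_subset[of _ "{s'<..t}"]) (auto simp: B_def)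
      ultimately have "card A \<le> card B" using card_inj_on_le[OF g(1)] by blast
      then show "card {x \<in> {s'<..t}. \<tau> < x \<and> x \<le> v \<and> row T x = int r + 1}
        \<le> card {x \<in> {s'<..t}. \<tau> < x \<and> x \<le> v \<and> row T x = int r}"
        by (simp add: A_def B_def)
    qed (use tX in auto)
    then show ?thesis using row' hrc unfolding T'_def[symmetric] by simp
  qed
qed

lemma holed_push_cols:
  assumes h: "holed s cv {} T h" and m: "slide_move T h z" and s: "s \<le> s'"
    and close: "close_values n cv"
  shows "covers_below (col T) (col (T(h := T z, z := None))) {s'<..t}"
proof -
  interpret tr: staircase n "\<lambda>x. n + 1 - idx x" "prod.swap ` L" "\<lambda>i. prod.swap (b (n + 1 - i))"
    by (rule staircase_transpose)
  define T' where "T' = T(h := T z, z := None)"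
  have eq: "T' \<circ> prod.swap = (T \<circ> prod.swap)(prod.swap h := (T \<circ> prod.swap) (prod.swap z), prod.swap z := None)"
    by (rule ext) (auto simp: T'_def)
  have h': "holed s cv {} T' z" unfolding T'_def by (rule holed_move(1)[OF h m])
  have "tr.row (T' \<circ> prod.swap) = col T'"
    unfolding tr.row_def col_def using pos_swap[of T'] holedD(6)[OF h'] by fastforce
  moreover have "tr.row (T \<circ> prod.swap) = col T"
    unfolding tr.row_def col_def using pos_swap[of T] holedD(6)[OF h] by fastforce
  moreover have hs: "tr.holed s (\<lambda>i. cv (n + 1 - i)) {} (T \<circ> prod.swap) (prod.swap h)"
    using holed_swap[OF h] by simp
  ultimately show ?thesis
    using tr.holed_push_rows[OF hs slide_move_swap[OF m] s close_values_flip[OF close], of t] eq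
    unfolding T'_def by simp
qed

lemma slides_push:
  assumes sl: "slides slide_source T h T' z" and h: "holed s cv {} T h" and s: "s \<le> s'"
    and close: "close_values n cv"
  shows "covers_below (row T) (row T') {s'<..t}" "covers_below (col T) (col T') {s'<..t}"
proof -
  show "covers_below (row T) (row T') {s'<..t}"
    by (rule slides_holed_rel[OF sl h, where Q = "\<lambda>T T'. covers_below (row T) (row T') {s'<..t}"])
      (auto intro: covers_below_refl covers_below_trans holed_push_rows[OF _ _ s close])
  show "covers_below (col T) (col T') {s'<..t}"
    by (rule slides_holed_rel[OF sl h, where Q = "\<lambda>T T'. covers_below (col T) (col T') {s'<..t}"])
      (auto intro: covers_below_refl covers_below_trans holed_push_cols[OF _ _ s close])
qed

text \<open>One step of promotion: the smallest letter is removed and its box is slid out.\<close>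

lemma promotion:
  assumes st: "state s cv {} T" and d: "dominated s T"
  shows "\<exists>cv' T'. state (s + 1) cv' {} T' \<and> dominated (s + 1) T' \<and>
    (\<forall>s' t. s + 1 \<le> s' \<longrightarrow> covers_below (row T) (row T') {s'<..t} \<and> covers_below (col T) (col T') {s'<..t})"
proof -
  note S = stateD[OF st]
  have one: "(1, 1) \<in> L" using stair[of "(1, 1)"] n1 by simp
  have sc: "s < cv i" if "i \<in> {1..n}" for i using S(5)[of "cv i"] S(7)[OF that] by blast
  have "\<exists>y. T y = Some (s + 1)" using S(5)[of "s + 1"] sc[OF idx_range[of "s + 1"]] by simp
  then obtain y where y: "T y = Some (s + 1)" by blast
  have "y \<in> L" using y S(2) by blast
  then have nwy: "nw (1, 1) y" using stair[of y] by (simp add: nw_def)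
  obtain u where u: "T (1, 1) = Some u" using one S(2) by blast
  have "s < u" using S(5)[of u] u by blast
  then have y1: "y = (1, 1)" using S(3)[OF u y nwy] by force
  define T1 where "T1 = T((1, 1) := None)"
  have T1v: "T1 z = Some x \<longleftrightarrow> T z = Some x \<and> z \<noteq> (1, 1)" for z x by (auto simp: T1_def)
  \<comment> \<open>The removed letter disappears from consideration because the bound becomes
    \<open>s + 1\<close>. For \<open>n = 1\<close> the emptied box is itself the corner and
    \<open>cv i = s + 1\<close>; this is why \<open>holed\<close> only asks for
    \<open>s < cv i + int n\<close>.\<close>
  have h: "holed (s + 1) cv {} T1 (1, 1)"
    unfolding holed_def
  proof (intro conjI allI impI ballI)
    show "down_closed {}" by (simp add: down_closed_def)
    show "(1, 1) \<in> L - {}" using one by simp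
    show "dom T1 = L - {} - {(1, 1)}" using S(2) by (auto simp: T1_def)
  next
    fix y z u v assume "T1 y = Some u" "T1 z = Some v" "nw y z" "y \<noteq> z"
    then show "u < v" using S(3)[of y u z v] T1v by blast
  next
    fix y z u assume "T1 y = Some u" "T1 z = Some u"
    then show "y = z" using S(4) T1v by blast
  next
    fix x
    have "(\<exists>z. T1 z = Some x) \<longleftrightarrow> (\<exists>z. T z = Some x) \<and> x \<noteq> s + 1"
      using T1v y y1 S(4) by (metis option.inject)
    then show "(\<exists>z. T1 z = Some x) = (s + 1 < x \<and> x \<le> cv (idx x))" using S(5)[of x] by auto
  next
    fix y x assume "T1 y = Some x"
    then show "nw y (b (idx x))" using S(6) T1v by blast
  next
    fix i assume i: "i \<in> {1..n}"
    show "T1 (b i) = Some (cv i)" if "b i \<noteq> (1, 1)" using S(7)[OF i] that T1v by blast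
    show "idx (cv i) = i" by (rule S(8)[OF i])
    show "s + 1 < cv i + int n" using sc[OF i] n1 by linarith
  next
    fix y u i assume a: "T1 y = Some u" "i \<in> {1..n}" "nw y (b i)"
    have Ty: "T y = Some u" using a(1) T1v by blast
    show "u \<le> cv i"
    proof (cases "y = b i")
      case True then show ?thesis using S(7)[OF a(2)] Ty by simp
    next
      case False then show ?thesis using S(3)[OF Ty S(7)[OF a(2)] a(3)] by simp
    qed
  qed
  have pos1: "pos T1 x = pos T x" if "s + 1 < x" for x
  proof (cases "\<exists>z. T z = Some x")
    case True
    then obtain z where z: "T z = Some x" by blast
    then have "z \<noteq> (1, 1)" using y y1 that by auto
    then have "T1 z = Some x" using z T1v by blast
    then show ?thesis using holed_pos[OF h, of z x] state_pos[OF st z] by simp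
  next
    case False
    then have "\<And>z. T1 z \<noteq> Some x" using T1v by blast
    then show ?thesis using pos_stuck[of T1 x] pos_stuck[of T x] False by auto
  qed
  have eq1: "row T1 x = row T x" "col T1 x = col T x" if "s + 1 < x" for x
    using pos1[OF that] by (simp_all add: row_def col_def)
  have same: "covers_below (row T) (row T1) {s'<..t}" "covers_below (row T1) (row T) {s'<..t}"
    "covers_below (col T) (col T1) {s'<..t}" "covers_below (col T1) (col T) {s'<..t}" if "s + 1 \<le> s'" for s' t
    by (rule covers_below_refl, use eq1 that in auto)+
  have d1: "dominated (s + 1) T1"
    unfolding dominated_def
  proof (intro allI impI)
    fix s' t assume s': "s + 1 \<le> s'"
    have "s \<le> s'" using s' by simp
    then have "covers_below (row T) (\<lambda>x. - int (idx x)) {s'<..t}" "covers_below (col T) (\<lambda>x. int (idx x)) {s'<..t}"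
      using d unfolding dominated_def by blast+
    then show "covers_below (row T1) (\<lambda>x. - int (idx x)) {s'<..t} \<and> covers_below (col T1) (\<lambda>x. int (idx x)) {s'<..t}"
      using same(2,4)[OF s'] covers_below_trans by blast
  qed
  obtain T2 z where sl: "slides slide_source T1 (1, 1) T2 z" using slides_exists[OF h] by blast
  obtain i where i: "i \<in> {1..n}" "z = b i"
    "state (s + 1) (cv(i := cv i + int n)) {} (T2(z := Some (cv i + int n)))"
    "pos (T2(z := Some (cv i + int n))) = pos T2"
    using slide_step[OF h sl] by blast
  define T3 where "T3 = T2(z := Some (cv i + int n))"
  have rc: "row T3 = row T2" "col T3 = col T2" using i(4) by (auto simp: T3_def row_def col_def)
  have "dominated (s + 1) T3"
    using slides_dominated[OF h sl d1] dominated_cong[OF i(4)] by (simp add: T3_def)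
  moreover have "covers_below (row T) (row T3) {s'<..t} \<and> covers_below (col T) (col T3) {s'<..t}"
    if s': "s + 1 \<le> s'" for s' t
    unfolding rc using slides_push[OF sl h s' corner_values_close[OF st d], of t]
      same(1,3)[OF s'] covers_below_trans by blast
  ultimately show ?thesis using i(3) unfolding T3_def[symmetric] by blast
qed

lemma run_exists: "\<exists>cv T. state s cv {} T \<and> dominated s T"
proof -
  obtain e where e: "\<And>i. i \<in> {1..n} \<Longrightarrow> s < e i \<and> e i \<le> s + int n \<and> idx (e i) = i"
    using exists_first_letters by blast
  define T where "T y = (if y \<in> b ` {1..n} then Some (e (THE i. i \<in> {1..n} \<and> y = b i)) else None)" for y
  have the: "(THE j. j \<in> {1..n} \<and> b i = b j) = i" if "i \<in> {1..n}" for i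
  proof (rule the_equality)
    show "j = i" if j: "j \<in> {1..n} \<and> b i = b j" for j using b_inj[OF \<open>i \<in> {1..n}\<close>, of j] j by metis
  qed (use that in simp)
  have Tv: "T y = Some x \<longleftrightarrow> (\<exists>i\<in>{1..n}. y = b i \<and> x = e i)" for y x
  proof (cases "y \<in> b ` {1..n}")
    case True
    then obtain i where i: "i \<in> {1..n}" "y = b i" by blast
    then have "T y = Some (e i)" unfolding T_def using the by simp
    then show ?thesis using i b_inj by (metis option.inject)
  next
    case False then show ?thesis unfolding T_def by auto
  qed
  have e': "idx (e i) = i \<and> s < e i \<and> e i \<le> s + int n" if "i \<in> {1..n}" for i using e[OF that] by blast
  note I = initial_state[OF Tv e']
  obtain cv' T'' where r: "(lower_step n L b)\<^sup>*\<^sup>* T T''" "state s cv' {} T''"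
    using lower_steps_exist[OF I(1)] by blast
  obtain cv2 \<mu>2 where "state s cv2 \<mu>2 T''" "dominated s T''"
    using lower_steps_state[OF r(1) I] by blast
  then show ?thesis using r(2) by blast
qed

text \<open>Starting the promotions so early that all letters \<open>> 0\<close> are still waiting in the corners, one
  obtains a tableau whose words have chains at least as large as the word of the corners.\<close>

lemma exists_extremal:
  "\<exists>cv T. state 0 cv {} T \<and> dominated 0 T \<and>
    (\<forall>t. covers_below (\<lambda>x. - int (idx x)) (row T) {0<..t} \<and> covers_below (\<lambda>x. int (idx x)) (col T) {0<..t})"
proof -
  \<comment> \<open>The bound from \<open>corner_values_bounded\<close>: a full tableau for the
    letters above \<open>- K\<close> has no positive entry, and \<open>K\<close> promotions bring
    the bound to \<open>0\<close>.\<close>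
  define K where "K = n + n * (n + 2 * (n * n))"
  have "\<exists>cv T. state (int k - int K) cv {} T \<and> dominated (int k - int K) T \<and>
    (\<forall>t. covers_below (\<lambda>x. - int (idx x)) (row T) {0<..t} \<and> covers_below (\<lambda>x. int (idx x)) (col T) {0<..t})"
    if "k \<le> K" for k
    using that
  proof (induction k)
    case 0
    obtain cv T where T: "state (- int K) cv {} T" "dominated (- int K) T" using run_exists by blast
    have "pos T x = b (idx x)" if "0 < x" for x
    proof (rule pos_stuck)
      have "cv (idx x) \<le> 0" using corner_values_bounded[OF T idx_range[of x]] by (simp add: K_def)
      then show "T y \<noteq> Some x" for y using stateD(5)[OF T(1), of x] that by auto
    qed
    then have "row T x = int (n + 1 - idx x)" "col T x = int (idx x)" if "0 < x" for x
      using that b_stair[OF idx_range[of x]] by (simp_all add: row_def col_def)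
    then have "covers_below (\<lambda>x. - int (idx x)) (row T) {0<..t}"
      "covers_below (\<lambda>x. int (idx x)) (col T) {0<..t}" for t
      by (intro covers_below_order; simp)+
    then show ?case using T by auto
  next
    case (Suc k)
    then obtain cv T where T: "state (int k - int K) cv {} T" "dominated (int k - int K) T"
      "\<And>t. covers_below (\<lambda>x. - int (idx x)) (row T) {0<..t}"
      "\<And>t. covers_below (\<lambda>x. int (idx x)) (col T) {0<..t}" by auto
    obtain cv' T' where T': "state (int k - int K + 1) cv' {} T'" "dominated (int k - int K + 1) T'"
      "\<And>s' t. int k - int K + 1 \<le> s' \<Longrightarrow> covers_below (row T) (row T') {s'<..t}"
      "\<And>s' t. int k - int K + 1 \<le> s' \<Longrightarrow> covers_below (col T) (col T') {s'<..t}"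
      using promotion[OF T(1,2)] by blast
    have "int k - int K + 1 \<le> 0" using Suc(2) by simp
    then have "covers_below (\<lambda>x. - int (idx x)) (row T') {0<..t}"
      "covers_below (\<lambda>x. int (idx x)) (col T') {0<..t}" for t
      using T(3,4)[of t] T'(3,4)[of 0 t] covers_below_trans by blast+
    moreover have "int k - int K + 1 = int (Suc k) - int K" by simp
    ultimately show ?case using T'(1,2) by metis
  qed
  from this[of K] show ?thesis by simp
qed

text \<open>The row matching says that the rows of a full staircase tableau form a lattice word. Its
  Greene invariants are therefore plain counts of the letters in the first rows.\<close>

lemma row_cover_le:
  assumes st: "state s cv {} T" and d: "dominated s T"
    and S: "S \<subseteq> {s<..t}" "chain_cover a (row T) S"
  shows "card S \<le> card {x \<in> {s<..t}. row T x \<le> int a}"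
proof (rule lattice_word_cover_le[OF _ _ S])
  note D = stateD[OF st]
  show "1 \<le> row T x" for x using state_pos_in[OF st, of x] stair[of "pos T x"] by (simp add: row_def)
  show "card {x \<in> {s<..v}. row T x = r + 1} \<le> card {x \<in> {s<..v}. row T x = r}" if r1: "1 \<le> r" for r v
  proof (cases "r < int n")
    case False
    have "row T x \<noteq> r + 1" for x
      using False state_pos_in[OF st, of x] stair[of "pos T x"] by (simp add: row_def)
    then show ?thesis by simp
  next
    case True
    define k where "k = nat r"
    have k: "1 \<le> k" "k < n" "r = int k" using True r1 by (auto simp: k_def)
    define A where "A = {x \<in> {s<..v}. row T x = r + 1}"
    define B where "B = {x \<in> {s<..v}. row T x = r}"
    have kn: "n + 1 - k \<in> {1..n}" using k by auto
    have "\<exists>g. inj_on g A \<and> (\<forall>x\<in>A. row T (g x) = int k \<and> g x < x \<and>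
      ((\<exists>c. T (k + 1, c) = Some x \<and> T (k, c) = Some (g x)) \<or> cv (n + 1 - k) \<le> g x))"
    proof (rule exists_row_matching[of T s cv k A])
      show "(\<exists>y. T y = Some x) = (s < x \<and> x \<le> cv (idx x))" for x by (rule D(5))
      show "dom T \<subseteq> L" using D(2) by blast
      show "1 \<le> k" "k < n" by (fact k)+
      show "T (b (n + 1 - k)) = Some (cv (n + 1 - k))" by (rule D(7)[OF kn])
      show "idx (cv i) = i" if "i \<in> {1..n}" for i using D(8)[OF that] .
      show "\<bar>cv (n - k + 1) - cv (n - k)\<bar> < int n"
        using close_valuesD[OF corner_values_close[OF st d], of "n - k"] k by simp
      show "s < x \<and> row T x = int (k + 1)" if "x \<in> A" for x using that k by (auto simp: A_def)
      show "\<exists>u. T (k, c') = Some u \<and> u < x" if x: "x \<in> A" "T (k + 1, c') = Some x" for x c'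
      proof -
        have "(k + 1, c') \<in> L" using x(2) D(2) by blast
        then have "(k, c') \<in> L" using stair[of "(k + 1, c')"] stair[of "(k, c')"] k by simp
        then obtain u where u: "T (k, c') = Some u" using D(2) by blast
        then show ?thesis using D(3)[OF u x(2)] by (auto simp: nw_def)
      qed
    qed (use D(4) in blast)
    then obtain g where g: "inj_on g A" "\<And>x. x \<in> A \<Longrightarrow> row T (g x) = int k" "\<And>x. x \<in> A \<Longrightarrow> g x < x"
      "\<And>x. x \<in> A \<Longrightarrow> (\<exists>c. T (k + 1, c) = Some x \<and> T (k, c) = Some (g x)) \<or> cv (n + 1 - k) \<le> g x"
      by blast
    have "g ` A \<subseteq> B"
    proof
      fix y assume "y \<in> g ` A"
      then obtain x where x: "x \<in> A" "y = g x" by blast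
      have "s < g x" using g(4)[OF x(1)]
      proof
        assume "\<exists>c. T (k + 1, c) = Some x \<and> T (k, c) = Some (g x)"
        then show ?thesis using D(5)[of "g x"] by blast
      next
        have "s < cv (n + 1 - k)" using D(5)[of "cv (n + 1 - k)"] D(7)[OF kn] by blast
        then show "cv (n + 1 - k) \<le> g x \<Longrightarrow> s < g x" by simp
      qed
      then show "y \<in> B" using g(2,3)[OF x(1)] x k by (auto simp: A_def B_def)
    qed
    moreover have "finite B" by (rule finite_subset[of _ "{s<..v}"]) (auto simp: B_def)
    ultimately have "card A \<le> card B" using card_inj_on_le[OF g(1)] by blast
    then show ?thesis by (simp add: A_def B_def)
  qed
qed

end

section \<open>Transposition of complete states\<close>

context corners
begin

lemma state_swap:
  assumes st: "state s cv \<mu> T"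
  shows "corners.state n (\<lambda>x. n + 1 - idx x) (prod.swap ` L) (\<lambda>i. prod.swap (b (n + 1 - i)))
    s (\<lambda>i. cv (n + 1 - i)) (prod.swap ` \<mu>) (T \<circ> prod.swap)"
proof -
  interpret tr: corners n "\<lambda>x. n + 1 - idx x" "prod.swap ` L" "\<lambda>i. prod.swap (b (n + 1 - i))"
    by (rule transpose)
  note H = stateD[OF st]
  have ii: "n + 1 - (n + 1 - idx x) = idx x" for x using idx_range[of x] by auto
  have flip: "n + 1 - i \<in> {1..n}" if "i \<in> {1..n}" for i using that by auto
  show ?thesis
    unfolding tr.state_def swap_eqs
  proof (intro conjI allI impI ballI)
    show "tr.down_closed (prod.swap ` \<mu>)" by (rule down_closed_swap[OF H(1)])
    show "dom (T \<circ> prod.swap) = prod.swap ` L - prod.swap ` \<mu>"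
      unfolding dom_swap H(2) by (simp add: image_set_diff)
  next
    fix y z u v assume a: "T (prod.swap y) = Some u" "T (prod.swap z) = Some v" "nw y z" "y \<noteq> z"
    have "nw (prod.swap y) (prod.swap z)" "prod.swap y \<noteq> prod.swap z"
      using a(3,4) by (simp, metis swap_swap)
    then show "u < v" using H(3)[OF a(1,2)] by blast
  next
    fix y z u assume "T (prod.swap y) = Some u" "T (prod.swap z) = Some u"
    then show "y = z" using H(4) by (metis swap_swap)
  next
    fix x
    have "(\<exists>y. T (prod.swap y) = Some x) = (\<exists>y. T y = Some x)" by (metis swap_swap)
    then show "(\<exists>y. T (prod.swap y) = Some x) = (s < x \<and> x \<le> cv (n + 1 - (n + 1 - idx x)))"
      unfolding ii H(5)[symmetric] .
  next
    fix y x assume "T (prod.swap y) = Some x"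
    then have "nw (prod.swap y) (b (idx x))" by (rule H(6))
    then show "nw y (prod.swap (b (n + 1 - (n + 1 - idx x))))" unfolding ii by (simp add: nw_def)
  next
    fix i assume i: "i \<in> {1..n}"
    then show "T (prod.swap (prod.swap (b (n + 1 - i)))) = Some (cv (n + 1 - i))"
      "n + 1 - idx (cv (n + 1 - i)) = i"
      using H(7,8)[OF flip[OF i]] by auto
  qed
qed

lemma row_col_swap:
  assumes st: "state s cv \<mu> T"
  shows "corners.row (\<lambda>x. n + 1 - idx x) (\<lambda>i. prod.swap (b (n + 1 - i))) (T \<circ> prod.swap) = col T"
    "corners.col (\<lambda>x. n + 1 - idx x) (\<lambda>i. prod.swap (b (n + 1 - i))) (T \<circ> prod.swap) = row T"
proof -
  interpret tr: corners n "\<lambda>x. n + 1 - idx x" "prod.swap ` L" "\<lambda>i. prod.swap (b (n + 1 - i))"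
    by (rule transpose)
  have p: "tr.pos (T \<circ> prod.swap) x = prod.swap (pos T x)" for x
    by (rule pos_swap) (use stateD(4)[OF st] in blast)
  show "tr.row (T \<circ> prod.swap) = col T" by (rule ext, unfold tr.row_def col_def p, simp)
  show "tr.col (T \<circ> prod.swap) = row T" by (rule ext, unfold tr.col_def row_def p, simp)
qed

lemma dominated_swap:
  assumes st: "state s cv \<mu> T" and d: "dominated s T"
  shows "corners.dominated (\<lambda>x. n + 1 - idx x) (\<lambda>i. prod.swap (b (n + 1 - i))) s (T \<circ> prod.swap)"
proof -
  interpret tr: corners n "\<lambda>x. n + 1 - idx x" "prod.swap ` L" "\<lambda>i. prod.swap (b (n + 1 - i))"
    by (rule transpose)
  show ?thesis
    unfolding tr.dominated_def row_col_swap[OF st]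
  proof (intro allI impI conjI)
    fix s' t assume s': "s \<le> s'"
    have c: "covers_below (row T) (\<lambda>x. - int (idx x)) {s'<..t}" "covers_below (col T) (\<lambda>x. int (idx x)) {s'<..t}"
      using d s' unfolding dominated_def by blast+
    have "covers_below (\<lambda>x. int (idx x)) (\<lambda>x. - int (n + 1 - idx x)) {s'<..t}"
      by (rule covers_below_order) auto
    then show "covers_below (col T) (\<lambda>x. - int (n + 1 - idx x)) {s'<..t}"
      using c(2) covers_below_trans by blast
    have "covers_below (\<lambda>x. - int (idx x)) (\<lambda>x. int (n + 1 - idx x)) {s'<..t}"
      by (rule covers_below_order) auto
    then show "covers_below (row T) (\<lambda>x. int (n + 1 - idx x)) {s'<..t}"
      using c(1) covers_below_trans by blast
  qed
qed

end

context staircase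
begin

lemma col_cover_le:
  assumes st: "state s cv {} T" and d: "dominated s T"
    and S: "S \<subseteq> {s<..t}" "chain_cover a (col T) S"
  shows "card S \<le> card {x \<in> {s<..t}. col T x \<le> int a}"
proof -
  interpret tr: staircase n "\<lambda>x. n + 1 - idx x" "prod.swap ` L" "\<lambda>i. prod.swap (b (n + 1 - i))"
    by (rule staircase_transpose)
  have st': "tr.state s (\<lambda>i. cv (n + 1 - i)) {} (T \<circ> prod.swap)" using state_swap[OF st] by simp
  have d': "tr.dominated s (T \<circ> prod.swap)" by (rule dominated_swap[OF st d])
  show ?thesis using tr.row_cover_le[OF st' d' S(1), of a] S(2) unfolding row_col_swap[OF st] by blast
qed

end

section \<open>Comparison with the extremal staircase tableau\<close>

context corners
begin

text \<open>Waiting letters respect the order as well, since they exceed the entry of their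
  corner.\<close>

lemma state_beyond:
  assumes st: "state s cv {} T" and y: "T y = Some t" and x: "s < x" "nw y (pos T x)"
  shows "t \<le> x"
proof (cases "\<exists>z. T z = Some x")
  case True
  then obtain z where z: "T z = Some x" by blast
  then show ?thesis using stateD(3)[OF st y z] state_pos[OF st z] x(2) y by (cases "y = z") auto
next
  case False
  have i: "idx x \<in> {1..n}" by (rule idx_range)
  have p: "pos T x = b (idx x)" using False pos_stuck by blast
  have "cv (idx x) < x" using stateD(5)[OF st, of x] False x(1) by auto
  moreover have "t \<le> cv (idx x)"
    using stateD(3)[OF st y stateD(7)[OF st i]] stateD(7)[OF st i] y x(2) p by (cases "y = b (idx x)") auto
  ultimately show ?thesis by simp
qed

lemma row_filled:
  assumes st: "state s cv {} T" and t: "T (r, c) = Some t" and k: "k \<in> {1..c}"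
  shows "\<exists>x. T (r, k) = Some x \<and> s < x \<and> x \<le> t \<and> row T x = int r"
proof -
  have "(r, c) \<in> L" using t stateD(2)[OF st] by blast
  then have "(r, k) \<in> L"
    by (rule young_downD[OF young]) (use k young_pos[OF young \<open>(r, c) \<in> L\<close>] in \<open>auto simp: nw_def\<close>)
  then obtain x where x: "T (r, k) = Some x" using stateD(2)[OF st] by blast
  moreover have "x \<le> t" using stateD(3)[OF st x t] k x t by (cases "k = c") (auto simp: nw_def)
  ultimately show ?thesis using stateD(5)[OF st, of x] state_pos[OF st x] by (auto simp: row_def)
qed

lemma le_card_row:
  assumes st: "state s cv {} T" and u: "T (r, k) = Some u" "u \<le> v"
  shows "k \<le> card {x \<in> {s<..v}. row T x = int r}"
proof -
  have ex: "\<exists>x. T (r, j) = Some x \<and> s < x \<and> x \<le> u \<and> row T x = int r" if "j \<in> {1..k}" for j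
    using row_filled[OF st u(1) that] .
  have "inj_on (\<lambda>j. the (T (r, j))) {1..k}"
  proof (rule inj_onI)
    fix i j assume a: "i \<in> {1..k}" "j \<in> {1..k}" "the (T (r, i)) = the (T (r, j))"
    obtain x x' where "T (r, i) = Some x" "T (r, j) = Some x'" using ex a by metis
    then show "i = j" using stateD(4)[OF st, of "(r, i)" x "(r, j)"] a(3) by simp
  qed
  moreover have "(\<lambda>j. the (T (r, j))) ` {1..k} \<subseteq> {x \<in> {s<..v}. row T x = int r}"
  proof
    fix x assume "x \<in> (\<lambda>j. the (T (r, j))) ` {1..k}"
    then obtain j where "j \<in> {1..k}" "x = the (T (r, j))" by blast
    then have "s < x \<and> x \<le> u \<and> row T x = int r" using ex[of j] by (metis option.sel)
    then show "x \<in> {x \<in> {s<..v}. row T x = int r}" using u(2) by simp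
  qed
  moreover have "finite {x \<in> {s<..v}. row T x = int r}" by (rule finite_subset[of _ "{s<..v}"]) auto
  ultimately have "card {1..k} \<le> card {x \<in> {s<..v}. row T x = int r}" by (rule card_inj_on_le)
  then show ?thesis by simp
qed

text \<open>Waiting letters do not disturb the count: if the corner of row \<open>r\<close> is
  weakly to the right of column \<open>c\<close>, they exceed \<open>t\<close>, and a corner further
  left would contradict its maximality.\<close>

lemma card_row:
  assumes st: "state s cv {} T" and t: "T (r, c) = Some t"
  shows "card {x \<in> {s<..t}. row T x = int r} = c"
proof (rule antisym)
  show "c \<le> card {x \<in> {s<..t}. row T x = int r}" by (rule le_card_row[OF st t]) simp
  have "{x \<in> {s<..t}. row T x = int r} \<subseteq> (\<lambda>k. the (T (r, k))) ` {1..c}"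
  proof
    fix x assume "x \<in> {x \<in> {s<..t}. row T x = int r}"
    then have x: "s < x" "x \<le> t" "fst (pos T x) = r" by (auto simp: row_def)
    obtain k where k: "pos T x = (r, k)" using x(3) by (cases "pos T x") auto
    have pL: "pos T x \<in> L" by (rule state_pos_in[OF st])
    have tL: "(r, c) \<in> L" using t stateD(2)[OF st] by blast
    show "x \<in> (\<lambda>k. the (T (r, k))) ` {1..c}"
    proof (cases "\<exists>z. T z = Some x")
      case True
      then obtain z where "T z = Some x" by blast
      then have z: "T (r, k) = Some x" using state_pos[OF st, of z x] k by simp
      have "k \<le> c"
      proof (rule ccontr)
        assume "\<not> k \<le> c"
        then have "t < x" using stateD(3)[OF st t z] by (simp add: nw_def)
        then show False using x by simp
      qed
      moreover have "1 \<le> k" using young_pos[OF young pL] k by simp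
      ultimately show ?thesis using z by (intro image_eqI[of _ _ k]) auto
    next
      case False
      then have b: "b (idx x) = (r, k)" using pos_stuck[of T x] k by auto
      show ?thesis
      proof (cases "c \<le> k")
        case True
        then have "t \<le> x" using state_beyond[OF st t x(1)] k by (simp add: nw_def)
        then show ?thesis using False t x(2) by (metis antisym)
      next
        case False
        then have "(r, c) = (r, k)" using b_max[OF idx_range[of x] tL] b by (simp add: nw_def)
        then show ?thesis using False by simp
      qed
    qed
  qed
  then have "card {x \<in> {s<..t}. row T x = int r} \<le> card {1..c}" by (rule surj_card_le[rotated]) simp
  then show "card {x \<in> {s<..t}. row T x = int r} \<le> c" by simp
qed

text \<open>A letter outside both regions lies weakly below row \<open>r\<close> and to the right of
  column \<open>c\<close>, hence comes after \<open>t\<close>. The rectangle of \<open>r - 1\<close>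
  rows and \<open>c\<close> columns is filled with smaller letters and counted twice.\<close>

lemma le_card_rows_cols:
  assumes st: "state s cv {} T" and t: "T (r, c) = Some t"
  shows "nat (t - s) + (r - 1) * c
    \<le> card {x \<in> {s<..t}. row T x \<le> int (r - 1)} + card {x \<in> {s<..t}. col T x \<le> int c}"
proof -
  define R where "R = {x \<in> {s<..t}. row T x \<le> int (r - 1)}"
  define C where "C = {x \<in> {s<..t}. col T x \<le> int c}"
  have fin: "finite R" "finite C" by (rule finite_subset[of _ "{s<..t}"], auto simp: R_def C_def)+
  have tL: "(r, c) \<in> L" using t stateD(2)[OF st] by blast
  have "R \<union> C = {s<..t}"
  proof (intro equalityI subsetI)
    fix x assume x: "x \<in> {s<..t}"
    show "x \<in> R \<union> C"
    proof (rule ccontr)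
      assume "x \<notin> R \<union> C"
      then have p: "r \<le> fst (pos T x)" "c < snd (pos T x)" using x by (auto simp: R_def C_def row_def col_def)
      then have "t \<le> x" using state_beyond[OF st t, of x] x by (simp add: nw_def)
      then have "x = t" using x by simp
      then show False using state_pos[OF st t] p by simp
    qed
  qed (auto simp: R_def C_def)
  then have 1: "card (R \<union> C) = nat (t - s)" by simp
  have box: "\<exists>x. T y = Some x \<and> x \<in> R \<inter> C" if y: "y \<in> {1..r - 1} \<times> {1..c}" for y
  proof -
    have yy: "nw y (r, c)" "y \<noteq> (r, c)" "1 \<le> fst y" "1 \<le> snd y" "fst y \<le> r - 1" "snd y \<le> c"
      using y by (auto simp: nw_def)
    then obtain x where x: "T y = Some x" using stateD(2)[OF st] young_downD[OF young tL] by blast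
    have "x < t" by (rule stateD(3)[OF st x t yy(1,2)])
    moreover have "s < x" using stateD(5)[OF st, of x] x by blast
    ultimately show ?thesis using x yy state_pos[OF st x] by (auto simp: R_def C_def row_def col_def)
  qed
  have "inj_on (\<lambda>y. the (T y)) ({1..r - 1} \<times> {1..c})"
    by (rule inj_onI) (use box stateD(4)[OF st] in \<open>metis option.sel\<close>)
  moreover have "(\<lambda>y. the (T y)) ` ({1..r - 1} \<times> {1..c}) \<subseteq> R \<inter> C"
    using box by (metis image_subsetI option.sel)
  ultimately have "card ({1..r - 1} \<times> {1..c}) \<le> card (R \<inter> C)" by (rule card_inj_on_le) (use fin in simp)
  then have "(r - 1) * c \<le> card (R \<inter> C)" by simp
  then show ?thesis using card_Un_Int[OF fin] 1 unfolding R_def[symmetric] C_def[symmetric] by simp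
qed

end

lemma card_upto_split:
  fixes t :: int
  assumes "0 < t"
  shows "card {x \<in> {0<..t}. P x} = card {x \<in> {0<..t - 1}. P x} + (if P t then 1 else 0)"
proof -
  have "{x \<in> {0<..t}. P x} = {x \<in> {0<..t - 1}. P x} \<union> (if P t then {t} else {})"
    using assms by (auto split: if_splits) (metis antisym_conv3 not_le zle_diff1_eq)+
  moreover have "finite {x \<in> {0<..t - 1}. P x}" by (rule finite_subset[of _ "{0<..t - 1}"]) auto
  ultimately show ?thesis by (simp add: card_insert_if)
qed

text \<open>\<open>D_dominated\<close> bounds the invariants of \<open>D\<close> from above, the
  last two assumptions bound them from below, so they coincide with those of the periodic word in
  every window beginning at \<open>0\<close>.\<close>

locale extremal = staircase +
  fixes cv :: "nat \<Rightarrow> int" and D :: filling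
  assumes D_state: "state 0 cv {} D" and D_dominated: "dominated 0 D"
    and D_rows: "covers_below (\<lambda>x. - int (idx x)) (row D) {0<..t}"
    and D_cols: "covers_below (\<lambda>x. int (idx x)) (col D) {0<..t}"
begin

section \<open>The rows of the extremal tableau as sequences of letters\<close>

lemma cv_pos: "i \<in> {1..n} \<Longrightarrow> 0 < cv i"
  using stateD(5)[OF D_state, of "cv i"] stateD(7)[OF D_state, of i] by blast

lemma D_filled: "1 \<le> r \<Longrightarrow> 1 \<le> c \<Longrightarrow> r + c \<le> n + 1 \<Longrightarrow> \<exists>x. D (r, c) = Some x"
  using stateD(2)[OF D_state] stair[of "(r, c)"] by auto

text \<open>The letters of row \<open>r\<close> of the extremal tableau in increasing order, including those waiting in the
  corner.\<close>

definition letter :: "nat \<Rightarrow> nat \<Rightarrow> int" where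
  "letter r c = (if r + c \<le> n + 1 then the (D (r, c)) else cv (n + 1 - r) + int (r + c - (n + 1)) * int n)"

lemma letter_box: "1 \<le> r \<Longrightarrow> 1 \<le> c \<Longrightarrow> r + c \<le> n + 1 \<Longrightarrow> D (r, c) = Some (letter r c)"
  using D_filled[of r c] by (auto simp: letter_def)

lemma letter_corner: "i \<in> {1..n} \<Longrightarrow> letter (n + 1 - i) (i + k) = cv i + int k * int n"
proof -
  assume i: "i \<in> {1..n}"
  then have ii: "n + 1 - (n + 1 - i) = i" "n + 1 - i + (i + k) = n + 1 + k" by auto
  show ?thesis
  proof (cases k)
    case 0
    have "D (n + 1 - i, i) = Some (cv i)" using stateD(7)[OF D_state i] b_stair[OF i] by simp
    then show ?thesis using 0 ii by (simp add: letter_def)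
  next
    case (Suc j)
    then show ?thesis using ii by (simp add: letter_def)
  qed
qed

lemma letter_beyond:
  assumes "1 \<le> r" "r \<le> n" "n + 1 \<le> r + c"
  shows "letter r c = cv (n + 1 - r) + int (r + c - (n + 1)) * int n"
proof -
  have "n + 1 - r \<in> {1..n}" "n + 1 - (n + 1 - r) = r" "n + 1 - r + (r + c - (n + 1)) = c"
    using assms by auto
  then show ?thesis using letter_corner[of "n + 1 - r" "r + c - (n + 1)"] by metis
qed

lemma pos_cv: 
  assumes i: "i \<in> {1..n}"
  shows "pos D (cv i + int k * int n) = b i"
proof (cases k)
  case 0 then show ?thesis using state_pos[OF D_state stateD(7)[OF D_state i]] by simp
next
  case (Suc j)
  have ix: "idx (cv i + int k * int n) = i"
    using idx_eq[of "cv i + int k * int n" "cv i"] stateD(8)[OF D_state i] by simp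
  have "0 < int k * int n" using Suc n1 by simp
  then have "D y \<noteq> Some (cv i + int k * int n)" for y
    using stateD(5)[OF D_state, of "cv i + int k * int n"] ix by force
  then show ?thesis using pos_stuck ix by metis
qed

lemma letter_row:
  assumes "1 \<le> r" "r \<le> n" "1 \<le> c"
  shows "0 < letter r c" "row D (letter r c) = int r"
proof -
  have rn: "n + 1 - r \<in> {1..n}" "n + 1 - (n + 1 - r) = r" using assms by auto
  show "0 < letter r c"
  proof (cases "r + c \<le> n + 1")
    case True
    then show ?thesis using stateD(5)[OF D_state, of "letter r c"] letter_box assms by blast
  next
    case False
    then have "letter r c = cv (n + 1 - r) + int (r + c - (n + 1)) * int n"
      using letter_beyond[of r c] assms by linarith
    also have "0 < \<dots>" by (rule add_pos_nonneg[OF cv_pos[OF rn(1)]]) simp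
    finally show ?thesis .
  qed
  show "row D (letter r c) = int r"
  proof (cases "r + c \<le> n + 1")
    case True
    then show ?thesis using state_pos[OF D_state letter_box] assms by (simp add: row_def)
  next
    case False
    then have "letter r c = cv (n + 1 - r) + int (r + c - (n + 1)) * int n"
      using letter_beyond[of r c] assms by linarith
    then have "pos D (letter r c) = b (n + 1 - r)" using pos_cv[OF rn(1)] by metis
    then show ?thesis using b_stair[OF rn(1)] rn(2) by (simp add: row_def)
  qed
qed

lemma letter_Suc:
  assumes r: "1 \<le> r" "r \<le> n" and c: "1 \<le> c"
  shows "letter r c < letter r (Suc c)"
proof (cases "r + c \<le> n")
  case True
  then show ?thesis
    using stateD(3)[OF D_state letter_box[of r c] letter_box[of r "Suc c"]] assms by (simp add: nw_def)
next
  case False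
  then have "r + Suc c - (n + 1) = Suc (r + c - (n + 1))" by simp
  moreover have "n + 1 \<le> r + c" "n + 1 \<le> r + Suc c" using False by auto
  ultimately have "letter r (Suc c) = letter r c + int n"
    using letter_beyond[OF r, of c] letter_beyond[OF r, of "Suc c"] by (simp only: of_nat_Suc) (simp add: algebra_simps)
  then show ?thesis using n1 by simp
qed

lemma letter_mono:
  assumes r: "1 \<le> r" "r \<le> n" and c: "1 \<le> c" "c < c'"
  shows "letter r c < letter r c'"
proof -
  have "letter r (Suc k) < letter r (Suc (Suc k))" for k by (rule letter_Suc[OF r]) simp
  then have "letter r (Suc (c - 1)) < letter r (Suc (c' - 1))"
    using lift_Suc_mono_less[of "\<lambda>k. letter r (Suc k)" "c - 1" "c' - 1"] c by auto
  then show ?thesis using c by simp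
qed

text \<open>Inside the staircase this is column strictness; beyond it, the alternation of the
  letters waiting in neighbouring corners. It provides the column strictness of the glued
  tableau.\<close>

lemma letter_down:
  assumes r: "1 \<le> r" "r < n" and c: "1 \<le> c"
  shows "letter r c < letter (r + 1) c"
proof (cases "r + 1 + c \<le> n + 1")
  case True
  then show ?thesis
    using stateD(3)[OF D_state letter_box[of r c] letter_box[of "r + 1" c]] assms by (simp add: nw_def)
next
  case False
  define k where "k = r + c - (n + 1)"
  have k: "n + 1 \<le> r + c" "r + 1 + c - (n + 1) = Suc k" "n + 1 - (r + 1) = n - r" "n + 1 - r = n - r + 1"
    using False r by (auto simp: k_def)
  have "letter r c = cv (n - r + 1) + int k * int n"
    using letter_beyond[of r c] r k(1,4) by (simp add: k_def)
  moreover have "letter (r + 1) c = cv (n - r) + int (Suc k) * int n"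
    using letter_beyond[of "r + 1" c] r k(1,2,3) by simp
  moreover have "\<bar>cv (n - r + 1) - cv (n - r)\<bar> < int n"
    using close_valuesD[OF corner_values_close[OF D_state D_dominated], of "n - r"] r by simp
  ultimately show ?thesis by (simp add: algebra_simps)
qed

lemma letter_le_cv:
  assumes "1 \<le> r" "1 \<le> c" "r + c \<le> n + 1"
  shows "letter r c \<le> cv (idx (letter r c))"
  using stateD(5)[OF D_state, of "letter r c"] letter_box[OF assms] by blast

lemma letter_surj:
  assumes x: "0 < x" "row D x = int r"
  shows "\<exists>c\<ge>1. x = letter r c"
proof (cases "\<exists>y. D y = Some x")
  case True
  then obtain y where y: "D y = Some x" by blast
  then have "y \<in> L" using stateD(2)[OF D_state] by blast
  moreover have "y = (r, snd y)" using state_pos[OF D_state y] x(2) by (simp add: row_def prod_eq_iff)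
  ultimately show ?thesis using y stair[of y] by (metis fst_conv letter_box option.inject)
next
  case False
  have i: "idx x \<in> {1..n}" by (rule idx_range)
  have "pos D x = b (idx x)" using False pos_stuck by blast
  then have r: "n + 1 - idx x = r" using x(2) b_stair[OF i] by (simp add: row_def)
  have lt: "cv (idx x) < x" using stateD(5)[OF D_state, of x] False x(1) by auto
  have "int n dvd x - cv (idx x)" using idx_eq[of x "cv (idx x)"] stateD(8)[OF D_state i] by simp
  then obtain k where k: "x - cv (idx x) = int n * k" by auto
  then have "0 < int n * k" using lt by simp
  then have "0 \<le> k" by (simp add: zero_less_mult_iff)
  then have "x = cv (idx x) + int (nat k) * int n" using k by (simp add: algebra_simps)
  then have "x = letter r (idx x + nat k)" using letter_corner[OF i, of "nat k"] r by simp
  then show ?thesis using i by (intro exI[of _ "idx x + nat k"]) simp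
qed

definition rank :: "nat \<Rightarrow> int \<Rightarrow> nat" where
  "rank r x = card {y \<in> {0<..x}. row D y = int r}"

lemma rank_letter:
  assumes r: "1 \<le> r" "r \<le> n" and c: "1 \<le> c"
  shows "rank r (letter r c) = c"
proof -
  have less: "letter r k < letter r k' \<longleftrightarrow> k < k'" if "1 \<le> k" "1 \<le> k'" for k k'
    using letter_mono[OF r, of k k'] letter_mono[OF r, of k' k] that by (cases k k' rule: linorder_cases) auto
  have "{y \<in> {0<..letter r c}. row D y = int r} = letter r ` {1..c}"
  proof (intro set_eqI iffI)
    fix y assume y: "y \<in> {y \<in> {0<..letter r c}. row D y = int r}"
    then obtain k where k: "1 \<le> k" "y = letter r k" using letter_surj[of y r] by auto
    then have "k \<le> c" using y less[of c k] c by (auto simp: not_less[symmetric])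
    then show "y \<in> letter r ` {1..c}" using k by auto
  next
    fix y assume "y \<in> letter r ` {1..c}"
    then obtain k where k: "1 \<le> k" "k \<le> c" "y = letter r k" by auto
    then have "y \<le> letter r c" using less[of k c] c by (cases "k = c") auto
    then show "y \<in> {y \<in> {0<..letter r c}. row D y = int r}" using letter_row[OF r k(1)] k(3) by simp
  qed
  moreover have "inj_on (letter r) {1..c}" using less by (intro inj_onI) (metis atLeastAtMost_iff linorder_neqE_nat less_irrefl)
  ultimately show ?thesis by (simp add: rank_def card_image)
qed

lemma letter_inj:
  assumes "1 \<le> r" "r \<le> n" "1 \<le> c" "1 \<le> r'" "r' \<le> n" "1 \<le> c'" "letter r c = letter r' c'"
  shows "r = r' \<and> c = c'"
  using letter_row(2)[OF assms(1-3)] letter_row(2)[OF assms(4-6)] rank_letter[OF assms(1-3)]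
    rank_letter[OF assms(4-6)] assms(7) by (metis of_nat_eq_iff)

text \<open>Waiting letters sit in boxes with coordinate sum \<open>n + 1 > a + c\<close>, so the
  two regions share only entries of an \<open>a\<close> by \<open>c\<close> rectangle. On these
  regions this reverses \<open>le_card_rows_cols\<close>.\<close>

lemma card_rows_cols_le:
  assumes ab: "a + c \<le> n" and t: "0 \<le> t"
  shows "card {x \<in> {0<..t}. row D x \<le> int a} + card {x \<in> {0<..t}. col D x \<le> int c} \<le> nat t + a * c"
proof -
  define R where "R = {x \<in> {0<..t}. row D x \<le> int a}"
  define C where "C = {x \<in> {0<..t}. col D x \<le> int c}"
  have fin: "finite R" "finite C" by (rule finite_subset[of _ "{0<..t}"], auto simp: R_def C_def)+
  have "card (R \<union> C) \<le> card {0<..t}" by (rule card_mono) (auto simp: R_def C_def)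
  then have 1: "card (R \<union> C) \<le> nat t" using t by simp
  have "R \<inter> C \<subseteq> (\<lambda>y. the (D y)) ` ({1..a} \<times> {1..c})"
  proof
    fix x assume x: "x \<in> R \<inter> C"
    have p: "fst (pos D x) \<le> a" "snd (pos D x) \<le> c" using x by (auto simp: R_def C_def row_def col_def)
    have "\<exists>y. D y = Some x"
    proof (rule ccontr)
      assume "\<not> ?thesis"
      then have "pos D x = b (idx x)" using pos_stuck by blast
      then show False using p ab b_stair[OF idx_range[of x]] idx_range[of x] by simp
    qed
    then obtain y where y: "D y = Some x" by blast
    have "y \<in> {1..a} \<times> {1..c}"
      using p state_pos[OF D_state y] young_pos[OF young state_pos_in[OF D_state, of x]] by (cases y) auto
    then show "x \<in> (\<lambda>y. the (D y)) ` ({1..a} \<times> {1..c})" using y by (intro image_eqI[of _ _ y]) auto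
  qed
  then have "card (R \<inter> C) \<le> card ({1..a} \<times> {1..c})" by (rule surj_card_le[rotated]) simp
  then have "card (R \<inter> C) \<le> a * c" by simp
  then show ?thesis using card_Un_Int[OF fin] 1 unfolding R_def[symmetric] C_def[symmetric] by simp
qed

text \<open>Induction over the letters. If \<open>t\<close> lay higher in \<open>T\<close> than in
  \<open>D\<close>, then \<open>T\<close> would have too many letters in its first rows. If it lay
  lower, \<open>D\<close> would have an additional letter in the first \<open>r - 1\<close> rows and
  would have to lack one in the first columns, against the column bound. This count works only for
  boxes of the staircase; the others need a separate argument.\<close>

lemma row_eq:
  assumes C: "corners n idx L' b'" and b'row: "\<And>i. i \<in> {1..n} \<Longrightarrow> fst (b' i) = n + 1 - i"
    and st: "corners.state n idx L' b' 0 cv' {} T" and d: "corners.dominated idx b' 0 T" and t: "0 < t"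
  shows "corners.row idx b' T t = row D t"
  using t
proof (induction "nat t" arbitrary: t rule: less_induct)
  case less
  interpret c: corners n idx L' b' by (rule C)
  have t: "0 < t" by fact
  have IH: "c.row T x = row D x" if "0 < x" "x < t" for x using less(1)[of x] that by auto
  have sameR: "{x \<in> {0<..t - 1}. P (c.row T x)} = {x \<in> {0<..t - 1}. P (row D x)}" for P using IH by auto
  have Rle: "card {x \<in> {0<..t}. c.row T x \<le> int a} \<le> card {x \<in> {0<..t}. row D x \<le> int a}" for a
  proof -
    define S where "S = {x \<in> {0<..t}. c.row T x \<le> int a}"
    have "covers_below (c.row T) (row D) {0<..t}"
      using d D_rows[of t] covers_below_trans unfolding c.dominated_def by blast
    moreover have "S \<subseteq> {0<..t}" by (auto simp: S_def)
    moreover have "chain_cover a (c.row T) S" unfolding S_def by (rule c.chain_cover_rows[OF st])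
    ultimately obtain S' where S': "S' \<subseteq> {0<..t}" "card S' = card S" "chain_cover a (row D) S'"
      by (rule covers_belowD)
    show ?thesis using row_cover_le[OF D_state D_dominated S'(1,3)] S'(2) by (simp add: S_def)
  qed
  have Cle: "card {x \<in> {0<..t}. c.col T x \<le> int a} \<le> card {x \<in> {0<..t}. col D x \<le> int a}" for a
  proof -
    define S where "S = {x \<in> {0<..t}. c.col T x \<le> int a}"
    have "covers_below (c.col T) (col D) {0<..t}"
      using d D_cols[of t] covers_below_trans unfolding c.dominated_def by blast
    moreover have "S \<subseteq> {0<..t}" by (auto simp: S_def)
    moreover have "chain_cover a (c.col T) S" unfolding S_def by (rule c.chain_cover_cols[OF st])
    ultimately obtain S' where S': "S' \<subseteq> {0<..t}" "card S' = card S" "chain_cover a (col D) S'"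
      by (rule covers_belowD)
    show ?thesis using col_cover_le[OF D_state D_dominated S'(1,3)] S'(2) by (simp add: S_def)
  qed
  have itn: "idx t \<in> {1..n}" by (rule idx_range)
  define r where "r = fst (c.pos T t)"
  define k where "k = snd (c.pos T t)"
  have rowT: "c.row T t = int r" by (simp add: c.row_def r_def)
  have r1: "1 \<le> r" using young_pos[OF c.young c.state_pos_in[OF st, of t]] by (simp add: r_def)
  have rowD1: "1 \<le> row D t" using young_pos[OF young state_pos_in[OF D_state, of t]] by (simp add: row_def)
  define N where "N j = card {x \<in> {0<..t - 1}. row D x = int j}" for j
  have NT: "N j = card {x \<in> {0<..t - 1}. c.row T x = int j}" for j
    unfolding N_def sameR[of "\<lambda>v. v = int j"] ..
  have "\<not> int r < row D t"
  proof
    assume "int r < row D t"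
    then have "card {x \<in> {0<..t}. row D x \<le> int r} = card {x \<in> {0<..t - 1}. row D x \<le> int r}"
      using card_upto_split[OF t, of "\<lambda>x. row D x \<le> int r"] by simp
    moreover have "card {x \<in> {0<..t}. c.row T x \<le> int r} = card {x \<in> {0<..t - 1}. row D x \<le> int r} + 1"
      using card_upto_split[OF t, of "\<lambda>x. c.row T x \<le> int r"] rowT sameR[of "\<lambda>v. v \<le> int r"] by simp
    ultimately show False using Rle[of r] by simp
  qed
  moreover have "\<not> row D t < int r"
  proof
    assume lt: "row D t < int r"
    \<comment> \<open>If the corner of the index of \<open>t\<close> is in row \<open>r\<close> but
      \<open>D\<close> has \<open>t\<close> in a higher row, then \<open>t\<close> is an entry of
      \<open>D\<close> and not beyond the corner entry. That entry is letter number
      \<open>idx t\<close> of row \<open>r\<close>, so fewer than \<open>idx t\<close> letters of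
      the row precede \<open>t\<close>.\<close>
    have early: False if "n + 1 - idx t = r" "idx t \<le> N r"
    proof -
      have le: "t \<le> cv (idx t)"
      proof (rule ccontr)
        assume "\<not> ?thesis"
        then have "D y \<noteq> Some t" for y using stateD(5)[OF D_state, of t] by auto
        then have "pos D t = b (idx t)" by (rule pos_stuck)
        then show False using b_stair[OF itn] that(1) lt by (simp add: row_def)
      qed
      have rn: "r \<le> n" using that(1) itn by auto
      have le': "t \<le> letter r (idx t)" using le letter_corner[OF itn, of 0] that(1) by simp
      have "{x \<in> {0<..t - 1}. row D x = int r} \<subseteq> letter r ` {1..<idx t}"
      proof
        fix x assume x: "x \<in> {x \<in> {0<..t - 1}. row D x = int r}"
        then obtain j where j: "1 \<le> j" "x = letter r j" using letter_surj[of x r] by auto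
        have "\<not> idx t \<le> j"
        proof
          assume "idx t \<le> j"
          then have "letter r (idx t) \<le> letter r j"
            using letter_mono[OF r1 rn, of "idx t" j] itn by (cases "idx t = j") auto
          then show False using x j le' by simp
        qed
        then show "x \<in> letter r ` {1..<idx t}" using j by auto
      qed
      then have "N r \<le> card {1..<idx t}" unfolding N_def by (rule surj_card_le[rotated]) simp
      then show False using that(2) itn by auto
    qed
    \<comment> \<open>Corner columns increase strictly, so the corner with index \<open>i\<close>
      lies at or to the right of its place in the staircase.\<close>
    have wide: "i \<le> snd (b' i)" if "1 \<le> i" "i \<le> n" for i
      using that
    proof (induction i rule: nat_induct_at_least)
      case base
      then show ?case using young_pos[OF c.young c.b_in[of 1]] by simp
    next
      case (Suc i)
      then show ?case using c.b_mono[of i "Suc i"] by simp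
    qed
    have "\<exists>y. T y = Some t"
    proof (rule ccontr)
      assume no: "\<nexists>y. T y = Some t"
      then have p: "c.pos T t = b' (idx t)" using c.pos_stuck by blast
      then have ri: "n + 1 - idx t = r" using b'row[OF itn] by (simp add: r_def)
      have "cv' (idx t) < t" using c.stateD(5)[OF st, of t] no t by auto
      then have "cv' (idx t) \<le> t - 1" by simp
      moreover have "T (r, snd (b' (idx t))) = Some (cv' (idx t))"
        using c.stateD(7)[OF st itn] p by (metis prod.collapse r_def)
      ultimately have "snd (b' (idx t)) \<le> N r" unfolding NT by (intro c.le_card_row[OF st])
      then show False using early[OF ri] wide[of "idx t"] itn by simp
    qed
    then obtain y where "T y = Some t" by blast
    then have Tt: "T (r, k) = Some t" using c.state_pos[OF st, of y t] by (simp add: r_def k_def)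
    have Nr: "N r + 1 = k"
      using c.card_row[OF st Tt] card_upto_split[OF t, of "\<lambda>x. c.row T x = int r"] rowT by (simp add: NT)
    show False
    \<comment> \<open>Inside the staircase the counts of rows and columns are bounded above for
      \<open>D\<close> and below for \<open>T\<close> by the same number.\<close>
    proof (cases "k \<le> n + 1 - r")
      case True
      have "card {x \<in> {0<..t}. row D x \<le> int (r - 1)} + card {x \<in> {0<..t}. col D x \<le> int k}
        \<le> nat t + (r - 1) * k"
        by (rule card_rows_cols_le) (use True r1 t Nr in auto)
      moreover have "nat t + (r - 1) * k \<le>
        card {x \<in> {0<..t}. c.row T x \<le> int (r - 1)} + card {x \<in> {0<..t}. c.col T x \<le> int k}"
        using c.le_card_rows_cols[OF st Tt] by simp
      moreover have "card {x \<in> {0<..t}. row D x \<le> int (r - 1)} = card {x \<in> {0<..t - 1}. row D x \<le> int (r - 1)} + 1"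
        using card_upto_split[OF t, of "\<lambda>x. row D x \<le> int (r - 1)"] lt r1 by (simp add: of_nat_diff)
      moreover have "card {x \<in> {0<..t}. c.row T x \<le> int (r - 1)} = card {x \<in> {0<..t - 1}. row D x \<le> int (r - 1)}"
        using card_upto_split[OF t, of "\<lambda>x. c.row T x \<le> int (r - 1)"] rowT r1 sameR[of "\<lambda>v. v \<le> int (r - 1)"]
        by (simp add: of_nat_diff)
      ultimately show False using Cle[of k] by simp
    next
      case False
      \<comment> \<open>Outside, the corner of \<open>t\<close> lies below row \<open>r\<close>, so
        \<open>idx t < k\<close>. In \<open>D\<close> the letter stands in a higher row
        \<open>r2\<close>, in a column of at most \<open>idx t\<close>; but \<open>T\<close> already
        has \<open>k\<close> smaller letters in row \<open>r2\<close>, and the rows of smaller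
        letters agree.\<close>
      have "n + 1 - idx t \<noteq> r" using early False Nr itn by auto
      moreover have "r \<le> n + 1 - idx t" using c.stateD(6)[OF st Tt] b'row[OF itn] by (simp add: nw_def)
      ultimately have r_lt: "r < n + 1 - idx t" by simp
      have "\<exists>z. D z = Some t"
      proof (rule ccontr)
        assume "\<nexists>z. D z = Some t"
        then have "pos D t = b (idx t)" using pos_stuck by blast
        then show False using b_stair[OF itn] r_lt lt by (simp add: row_def)
      qed
      then obtain r2 k2 where Dt: "D (r2, k2) = Some t" by auto
      have r2: "row D t = int r2" using state_pos[OF D_state Dt] by (simp add: row_def)
      have "k2 \<le> idx t" using stateD(6)[OF D_state Dt] b_stair[OF itn] by (simp add: nw_def)
      moreover have "k2 = N r2 + 1"
        using card_row[OF D_state Dt] card_upto_split[OF t, of "\<lambda>x. row D x = int r2"] r2 by (simp add: N_def)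
      moreover have "k \<le> N r2"
      proof -
        have rk: "(r, k) \<in> L'" using Tt c.stateD(2)[OF st] by blast
        have nw2: "nw (r2, k) (r, k)" "(r2, k) \<noteq> (r, k)" using lt r2 by (auto simp: nw_def)
        have "(r2, k) \<in> L'"
          by (rule young_downD[OF c.young rk nw2(1)]) (use rowD1 r2 young_pos[OF c.young rk] in auto)
        then obtain u where u: "T (r2, k) = Some u" using c.stateD(2)[OF st] by blast
        have "u < t" by (rule c.stateD(3)[OF st u Tt nw2])
        then have "u \<le> t - 1" by simp
        then show ?thesis unfolding NT by (rule c.le_card_row[OF st u])
      qed
      ultimately show False using False r_lt by simp
    qed
  qed
  ultimately show ?case using rowT by simp
qed

text \<open>Once the rows agree, box \<open>(r, c)\<close> can only hold the letter with rank
  \<open>c\<close> in row \<open>r\<close>, whatever the shape is.\<close>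

lemma entry_eq:
  assumes C: "corners n idx L' b'" and b'row: "\<And>i. i \<in> {1..n} \<Longrightarrow> fst (b' i) = n + 1 - i"
    and st: "corners.state n idx L' b' 0 cv' {} T" and d: "corners.dominated idx b' 0 T"
    and x: "T (r, c) = Some x"
  shows "x = letter r c"
proof -
  interpret c: corners n idx L' b' by (rule C)
  have eq: "c.row T y = row D y" if "0 < y" for y using row_eq[OF C b'row st d that] by simp
  have x0: "0 < x" using c.stateD(5)[OF st, of x] x by blast
  have "row D x = int r" using eq[OF x0] c.state_pos[OF st x] by (simp add: c.row_def)
  then obtain k where k: "1 \<le> k" "x = letter r k" using letter_surj[OF x0] by blast
  have "1 \<le> r" "r \<le> n"
    using \<open>row D x = int r\<close> state_pos_in[OF D_state, of x] stair[of "pos D x"] by (auto simp: row_def)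
  then have "rank r x = k" using rank_letter k by simp
  moreover have "rank r x = c"
    using c.card_row[OF st x] eq unfolding rank_def by (metis (no_types, lifting) Collect_cong greaterThanAtMost_iff)
  ultimately show ?thesis using k by simp
qed

end

section \<open>Gluing\<close>

lemma staircase_standard:
  assumes "1 \<le> n" and idx_range: "\<And>x. idx x \<in> {1..n}"
    and idx_eq: "\<And>x y. idx x = idx y \<longleftrightarrow> int n dvd x - y"
  shows "staircase n idx {y. 1 \<le> fst y \<and> 1 \<le> snd y \<and> fst y + snd y \<le> n + 1} (\<lambda>i. (n + 1 - i, i))"
    (is "staircase n idx ?L ?b")
proof (intro staircase.intro corners.intro staircase_axioms.intro)
  show "young_diagram ?L"
  proof (rule young_diagramI)
    have "?L \<subseteq> {1..n} \<times> {1..n}" by auto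
    then show "finite ?L" by (rule finite_subset) simp
  qed (auto simp: nw_def)
  show "y = ?b i" if "i \<in> {1..n}" "y \<in> ?L" "nw (?b i) y" for i y
    using that by (cases y) (auto simp: nw_def)
  show "\<exists>i\<in>{1..n}. y = ?b i" if "y \<in> ?L" "right_of y \<notin> ?L" "below y \<notin> ?L" for y
    using that by (cases y) (auto intro!: bexI[of _ "snd y"])
qed (use assms in auto)

lemma exists_extremal_standard:
  assumes "1 \<le> n" "\<And>x. idx x \<in> {1..n}" "\<And>x y. idx x = idx y \<longleftrightarrow> int n dvd x - y"
  shows "\<exists>cv D. extremal n idx {y. 1 \<le> fst y \<and> 1 \<le> snd y \<and> fst y + snd y \<le> n + 1} (\<lambda>i. (n + 1 - i, i)) cv D"
proof -
  interpret staircase n idx "{y. 1 \<le> fst y \<and> 1 \<le> snd y \<and> fst y + snd y \<le> n + 1}" "\<lambda>i. (n + 1 - i, i)"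
    by (rule staircase_standard[OF assms])
  show ?thesis using exists_extremal staircase_axioms unfolding extremal_def extremal_axioms_def by blast
qed

text \<open>Rotating a rectangular tableau by 180 degrees and replacing \<open>x\<close> by \<open>mn + 1 - x\<close> exchanges the
  index \<open>idx x\<close> with \<open>n + 1 - idx (mn + 1 - x)\<close>.\<close>

lemma corner_values_complementary:
  assumes X: "extremal n idx L b cv D"
    and Y: "extremal n (\<lambda>x. n + 1 - idx (int (m * n) + 1 - x)) L' b' cv' D'"
    and i: "i \<in> {1..n}"
  shows "cv i + cv' (n + 1 - i) = int n * int n + 1"
proof -
  interpret X: extremal n idx L b cv D by (rule X)
  interpret Y: extremal n "\<lambda>x. n + 1 - idx (int (m * n) + 1 - x)" L' b' cv' D' by (rule Y)
  obtain e where e: "\<And>i. i \<in> {1..n} \<Longrightarrow> 0 < e i \<and> e i \<le> 0 + int n \<and> idx (e i) = i"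
    using X.exists_first_letters by blast
  \<comment> \<open>The rotated word runs through a period from its other end. The number
    \<open>m * n\<close> is a multiple of \<open>n\<close> and does not affect the index.\<close>
  define e' where "e' i = int n + 1 - e (n + 1 - i)" for i
  have e': "0 < e' i \<and> e' i \<le> 0 + int n \<and> n + 1 - idx (int (m * n) + 1 - e' i) = i" if i: "i \<in> {1..n}" for i
  proof -
    have j: "n + 1 - i \<in> {1..n}" using i by auto
    have "idx (int (m * n) + 1 - e' i) = idx (e (n + 1 - i))"
      unfolding X.idx_eq by (simp add: e'_def)
    then show ?thesis using e[OF j] i by (auto simp: e'_def)
  qed
  define E where "E a = (\<Sum>l\<in>asc_set n e. gain n a l)" for a
  \<comment> \<open>Ascents are mirrored, and the gain is symmetric under \<open>l\<close> to
    \<open>n - l\<close>.\<close>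
  have E': "(\<Sum>l\<in>asc_set n e'. gain n a l) = E a" for a
    unfolding E_def
  proof (rule sum.reindex_bij_witness[of _ "\<lambda>l. n - l" "\<lambda>l. n - l"])
    fix l assume l: "l \<in> asc_set n e'"
    then have "1 \<le> l" "l < n" by (auto simp: asc_set_def)
    then have "n + 1 - l = n - l + 1" "n + 1 - (l + 1) = n - l" by auto
    then show "n - l \<in> asc_set n e" using l by (auto simp: asc_set_def e'_def)
    show "n - (n - l) = l" "gain n a (n - l) = gain n a l" using \<open>l < n\<close> gain_reflect[of l n a] by auto
  next
    fix l assume l: "l \<in> asc_set n e"
    then have "1 \<le> l" "l < n" by (auto simp: asc_set_def)
    then have "n + 1 - (n - l) = l + 1" "n + 1 - (n - l + 1) = l" by auto
    then show "n - l \<in> asc_set n e'" using l by (auto simp: asc_set_def e'_def)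
    show "n - (n - l) = l" using \<open>l < n\<close> by auto
  qed
  have flip: "E (n - a) = E a" if "a \<le> n" for a
    unfolding E_def by (rule sum.cong) (use gain_flip[OF that] in \<open>auto simp: asc_set_def\<close>)
  have j: "n + 1 - i \<in> {1..n}" "n + 1 - (n + 1 - i) = i" "n - (n + 1 - i) = i - 1" "n + 1 - i = n - (i - 1)"
    using i by auto
  have "cv i = e i + int n * (int i - 1 - (E (n + 1 - i) - E (n - i)))"
    using X.corner_value[OF X.D_state X.D_dominated e i] unfolding E_def by simp
  moreover have "E (n + 1 - i) = E (i - 1)" "E (n - i) = E i" using flip[of "i - 1"] flip[of i] i j(4) by auto
  moreover have "cv' (n + 1 - i) = e' (n + 1 - i) + int n * (int (n + 1 - i) - 1 - (E i - E (i - 1)))"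
    using Y.corner_value[OF Y.D_state Y.D_dominated e' j(1)] unfolding E' j(2,3) .
  moreover have "e' (n + 1 - i) = int n + 1 - e i" unfolding e'_def j(2) ..
  moreover have "int (n + 1 - i) = int n + 1 - int i" using i by auto
  ultimately show ?thesis by (simp add: algebra_simps)
qed

text \<open>Going up, the corner columns increase strictly, so the corner of row \<open>r\<close>
  leaves at least \<open>r - 1\<close> columns free on its right. Every lower shape thus stays where
  the formula of the lower half is valid.\<close>

lemma row_shape_fst_plus_snd_le:
  assumes "corners n idx L b" "L \<subseteq> rect n m" "\<And>i. i \<in> {1..n} \<Longrightarrow> fst (b i) = n + 1 - i" and y: "y \<in> L"
  shows "fst y + snd y \<le> m + 1"
proof -
  interpret corners n idx L b by fact
  have yR: "1 \<le> fst y" "fst y \<le> n" using y assms(2) by (auto simp: rect_def)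
  define i where "i = n + 1 - fst y"
  have i: "i \<in> {1..n}" "fst y + i = n + 1" using yR by (auto simp: i_def)
  have snd_b: "snd (b j) + (n - j) \<le> m" if "1 \<le> j" "j \<le> n" for j
    using that(2,1)
  proof (induction rule: inc_induct)
    case base
    then show ?case using b_in[of n] assms(2) n1 by (auto simp: rect_def)
  next
    case (step j)
    then have "snd (b j) < snd (b (Suc j))" using b_mono[of j "Suc j"] by simp
    then show ?case using step by auto
  qed
  have "snd y \<le> snd (b i)"
  proof (rule ccontr)
    assume "\<not> ?thesis"
    then have "nw (b i) y" using assms(3)[OF i(1)] i(2) by (auto simp: nw_def)
    then have "y = b i" using b_max[OF i(1) y] by simp
    then show False using \<open>\<not> snd y \<le> snd (b i)\<close> by simp
  qed
  then show ?thesis using snd_b[of i] i by auto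
qed

text \<open>One function \<open>F\<close> gives the entries for all shapes in \<open>P\<close> and
  all outcomes of the choices; this is the independence statement in the form in which it can be
  transposed and rotated.\<close>

definition forced :: "nat \<Rightarrow> (int \<Rightarrow> nat) \<Rightarrow> (box set \<Rightarrow> (nat \<Rightarrow> box) \<Rightarrow> bool) \<Rightarrow> (box \<Rightarrow> int) \<Rightarrow> bool" where
  "forced n idx P F \<longleftrightarrow> (\<forall>L b cv T y. P L b \<longrightarrow> corners.state n idx L b 0 cv {} T \<longrightarrow>
     corners.dominated idx b 0 T \<longrightarrow> y \<in> L \<longrightarrow> T y = Some (F y))"

definition row_shape :: "nat \<Rightarrow> nat \<Rightarrow> (int \<Rightarrow> nat) \<Rightarrow> box set \<Rightarrow> (nat \<Rightarrow> box) \<Rightarrow> bool" where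
  "row_shape n m idx L b \<longleftrightarrow> corners n idx L b \<and> L \<subseteq> rect n m \<and> (\<forall>i\<in>{1..n}. fst (b i) = n + 1 - i)"

lemma forcedI:
  assumes "\<And>L b cv T y. P L b \<Longrightarrow> corners.state n idx L b 0 cv {} T \<Longrightarrow> corners.dominated idx b 0 T \<Longrightarrow>
    y \<in> L \<Longrightarrow> T y = Some (F y)"
  shows "forced n idx P F"
  using assms unfolding forced_def by (intro allI impI)

lemma forcedD:
  assumes "forced n idx P F" "P L b" "corners.state n idx L b 0 cv {} T" "corners.dominated idx b 0 T" "y \<in> L"
  shows "T y = Some (F y)"
  by (rule assms(1)[unfolded forced_def, rule_format, OF assms(2-5)])

lemma rotated_index:
  assumes idx_range: "\<And>x. idx x \<in> {1..n}" and idx_eq: "\<And>x y. idx x = idx y \<longleftrightarrow> int n dvd x - y"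
  shows "n + 1 - idx (k - x) \<in> {1..n}" "n + 1 - idx (k - x) = n + 1 - idx (k - y) \<longleftrightarrow> int n dvd x - y"
proof -
  show "n + 1 - idx (k - x) \<in> {1..n}" using idx_range[of "k - x"] by auto
  have "n + 1 - idx (k - x) = n + 1 - idx (k - y) \<longleftrightarrow> idx (k - x) = idx (k - y)"
    using idx_range[of "k - x"] idx_range[of "k - y"] by auto
  also have "\<dots> \<longleftrightarrow> int n dvd y - x" unfolding idx_eq by simp
  finally show "n + 1 - idx (k - x) = n + 1 - idx (k - y) \<longleftrightarrow> int n dvd x - y"
    by (simp add: dvd_diff_commute)
qed

lemma exists_tableau_rows:
  assumes nm: "1 \<le> n" "n \<le> m" and idx_range: "\<And>x. idx x \<in> {1..n}"
    and idx_eq: "\<And>x y. idx x = idx y \<longleftrightarrow> int n dvd x - y"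
  defines "idx' \<equiv> \<lambda>x. n + 1 - idx (int (m * n) + 1 - x)"
  shows "\<exists>G. standard_young_tableau (rect n m) (\<lambda>y. if y \<in> rect n m then Some (G y) else None) \<and>
    forced n idx (row_shape n m idx) G \<and>
    forced n idx' (row_shape n m idx') (\<lambda>y. int (m * n) + 1 - G (n + 1 - fst y, m + 1 - snd y))"
proof -
  define K where "K = int (m * n) + 1"
  let ?L = "{y. 1 \<le> fst y \<and> 1 \<le> snd y \<and> fst y + snd y \<le> n + 1}" and ?b = "\<lambda>i. (n + 1 - i, i)"
  have idx'_range: "idx' x \<in> {1..n}" and idx'_eq: "idx' x = idx' y \<longleftrightarrow> int n dvd x - y" for x y
    unfolding idx'_def by (rule rotated_index[OF idx_range idx_eq])+
  obtain cv D where X: "extremal n idx ?L ?b cv D"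
    using exists_extremal_standard[OF nm(1) idx_range idx_eq] by blast
  obtain cv' D' where Y: "extremal n idx' ?L ?b cv' D'"
    using exists_extremal_standard[OF nm(1) idx'_range idx'_eq] by blast
  interpret X: extremal n idx ?L ?b cv D by (rule X)
  interpret Y: extremal n idx' ?L ?b cv' D' by (rule Y)
  have compl: "cv i + cv' (n + 1 - i) = int n * int n + 1" if "i \<in> {1..n}" for i
    by (rule corner_values_complementary[OF X Y[unfolded idx'_def] that])
  \<comment> \<open>On this strip both sides are corner entries or waiting letters: progressions
    with difference \<open>n\<close>, one increasing and one decreasing along the row, whose
    constants fit by \<open>compl\<close>.\<close>
  have overlap: "X.letter r c = K - Y.letter (n + 1 - r) (m + 1 - c)"
    if r: "1 \<le> r" "r \<le> n" and c: "n + 1 \<le> r + c" "r + c \<le> m + 1" for r c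
  proof -
    have i: "n + 1 - r \<in> {1..n}" "n + 1 - (n + 1 - r) = r" using r by auto
    have "X.letter r c = cv (n + 1 - r) + int (r + c - (n + 1)) * int n" by (rule X.letter_beyond[OF r c(1)])
    moreover have "Y.letter (n + 1 - r) (m + 1 - c)
        = cv' (n + 1 - (n + 1 - r)) + int (n + 1 - r + (m + 1 - c) - (n + 1)) * int n"
      by (rule Y.letter_beyond) (use r c in auto)
    moreover have "cv (n + 1 - r) + cv' r = int n * int n + 1" using compl[OF i(1)] i(2) by simp
    moreover have "int (r + c - (n + 1)) + int (n + 1 - r + (m + 1 - c) - (n + 1)) = int m - int n"
      using r c by auto
    then have "int (r + c - (n + 1)) * int n + int (n + 1 - r + (m + 1 - c) - (n + 1)) * int n = (int m - int n) * int n"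
      by (metis distrib_right)
    ultimately show ?thesis unfolding i(2) K_def by (simp add: algebra_simps)
  qed
  \<comment> \<open>The cut is made along the staircase boundary. Because of \<open>overlap\<close>,
    the first formula holds up to \<open>r + c = m + 1\<close> and the second from
    \<open>r + c = n + 1\<close> on, so every pair of neighbouring boxes is covered by one of the
    two.\<close>
  define G where "G y = (if fst y + snd y \<le> n + 1 then X.letter (fst y) (snd y)
    else K - Y.letter (n + 1 - fst y) (m + 1 - snd y))" for y
  have low: "G (r, c) = X.letter r c" if "1 \<le> r" "r \<le> n" "r + c \<le> m + 1" for r c
    using overlap[of r c] that by (auto simp: G_def)
  have high: "G (r, c) = K - Y.letter (n + 1 - r) (m + 1 - c)" if "1 \<le> r" "r \<le> n" "n + 1 \<le> r + c" for r c
    using overlap[of r c] that nm(2) by (auto simp: G_def)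
  have right: "G (r, c) < G (r, c + 1)" if "1 \<le> r" "r \<le> n" "1 \<le> c" "c + 1 \<le> m" for r c
  proof (cases "r + c \<le> n")
    case True
    then show ?thesis using low[of r c] low[of r "c + 1"] X.letter_mono[of r c "c + 1"] that nm(2) by simp
  next
    case False
    then show ?thesis
      using high[of r c] high[of r "c + 1"] Y.letter_mono[of "n + 1 - r" "m + 1 - (c + 1)" "m + 1 - c"] that by simp
  qed
  have down: "G (r, c) < G (r + 1, c)" if "1 \<le> r" "r + 1 \<le> n" "1 \<le> c" "c \<le> m" for r c
  proof (cases "r + c \<le> n")
    case True
    then show ?thesis using low[of r c] low[of "r + 1" c] X.letter_down[of r c] that nm(2) by simp
  next
    case False
    have "n + 1 - r = n - r + 1" "n + 1 - (r + 1) = n - r" using that by auto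
    then show ?thesis
      using False high[of r c] high[of "r + 1" c] Y.letter_down[of "n - r" "m + 1 - c"] that by simp
  qed
  have "G (r, c) < G (r, c + d + 1)" if "1 \<le> r" "r \<le> n" "1 \<le> c" "c + d + 1 \<le> m" for r c d
    using that(4)
  proof (induction d)
    case 0 then show ?case using right[of r c] that by simp
  next
    case (Suc d) then show ?case using right[of r "c + d + 1"] that by simp
  qed
  then have rows: "G (r, c) < G (r, c')" if "1 \<le> r" "r \<le> n" "1 \<le> c" "c < c'" "c' \<le> m" for r c c'
    using that less_imp_Suc_add[OF that(4)] by fastforce
  have "G (r, c) < G (r + d + 1, c)" if "1 \<le> r" "r + d + 1 \<le> n" "1 \<le> c" "c \<le> m" for r c d
    using that(2)
  proof (induction d)
    case 0 then show ?case using down[of r c] that by simp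
  next
    case (Suc d) then show ?case using down[of "r + d + 1" c] that by simp
  qed
  then have cols: "G (r, c) < G (r', c)" if "1 \<le> r" "r < r'" "r' \<le> n" "1 \<le> c" "c \<le> m" for r r' c
    using that less_imp_Suc_add[OF that(2)] by fastforce
  have mono: "G (r, c) \<le> G (r', c')" if "1 \<le> r" "r \<le> r'" "r' \<le> n" "1 \<le> c" "c \<le> c'" "c' \<le> m" for r c r' c'
  proof -
    have "G (r, c) \<le> G (r', c)" using cols[of r r' c] that by (cases "r = r'") auto
    also have "\<dots> \<le> G (r', c')" using rows[of r' c c'] that by (cases "c = c'") auto
    finally show ?thesis .
  qed
  have range: "G (r, c) \<in> {1..int (m * n)}" if "1 \<le> r" "r \<le> n" "1 \<le> c" "c \<le> m" for r c
  proof -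
    have "0 < G (1, 1)" using low[of 1 1] X.letter_row(1)[of 1 1] nm by simp
    moreover have "G (n, m) < K" using high[of n m] Y.letter_row(1)[of 1 1] nm by simp
    moreover have "G (1, 1) \<le> G (r, c)" "G (r, c) \<le> G (n, m)" by (rule mono; use that nm in simp)+
    ultimately show ?thesis by (simp add: K_def)
  qed
  \<comment> \<open>As an entry of the staircase, \<open>x\<close> is at most the corner entry of
    its class. By \<open>compl\<close>, \<open>K - x\<close> is then at least \<open>m - n\<close>
    periods beyond the corner entry of its class on the rotated side, which leads back to
    \<open>r2 + c2 \<le> n + 1\<close>.\<close>
  have mixed: False
    if y: "1 \<le> r" "1 \<le> c" "r + c \<le> n + 1"
      and z: "r2 \<le> n" "1 \<le> r2" "c2 \<le> m" "n + 1 < r2 + c2" and eq: "G (r, c) = G (r2, c2)" for r c r2 c2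
  proof -
    define x where "x = G (r, c)"
    have x: "x = X.letter r c" "K - x = Y.letter (n + 1 - r2) (m + 1 - c2)"
      using low[of r c] high[of r2 c2] y z eq nm(2) by (auto simp: x_def)
    define j where "j = n + 1 - idx x"
    have i: "idx x \<in> {1..n}" by (rule idx_range)
    have j: "j \<in> {1..n}" using i by (auto simp: j_def)
    have xle: "x \<le> cv (idx x)" unfolding x(1) by (rule X.letter_le_cv[OF y])
    have "idx' (K - x) = j" by (simp add: idx'_def j_def K_def)
    then have "idx' (K - x) = idx' (cv' j)" using Y.stateD(8)[OF Y.D_state j] by simp
    then have "int n dvd (K - x) - cv' j" unfolding idx'_eq .
    then obtain k where k: "(K - x) - cv' j = int n * k" by auto
    have "cv (idx x) + cv' j = int n * int n + 1" using compl[OF i] by (simp add: j_def)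
    then have "int n * (int m - int n) \<le> int n * k" using k xle by (simp add: K_def algebra_simps)
    then have mk: "int m - int n \<le> k" using nm by simp
    then have "K - x = cv' j + int (nat k) * int n" using k nm by (simp add: algebra_simps)
    then have "Y.letter (n + 1 - r2) (m + 1 - c2) = Y.letter (n + 1 - j) (j + nat k)"
      using Y.letter_corner[OF j, of "nat k"] x(2) by simp
    then have "n + 1 - r2 = n + 1 - j \<and> m + 1 - c2 = j + nat k"
      by (rule Y.letter_inj[rotated 6]) (use z j in auto)
    then show False using z j mk nm by auto
  qed
  have inj: "r = r2 \<and> c = c2"
    if y: "1 \<le> r" "r \<le> n" "1 \<le> c" "c \<le> m" and z: "1 \<le> r2" "r2 \<le> n" "1 \<le> c2" "c2 \<le> m"
      and eq: "G (r, c) = G (r2, c2)" for r c r2 c2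
  proof (cases "r + c \<le> n + 1"; cases "r2 + c2 \<le> n + 1")
    assume "r + c \<le> n + 1" "r2 + c2 \<le> n + 1"
    then show ?thesis using X.letter_inj[of r c r2 c2] low[of r c] low[of r2 c2] y z eq nm(2) by simp
  next
    assume "r + c \<le> n + 1" "\<not> r2 + c2 \<le> n + 1"
    then show ?thesis using mixed[of r c r2 c2] y z eq by simp
  next
    assume "\<not> r + c \<le> n + 1" "r2 + c2 \<le> n + 1"
    then show ?thesis using mixed[of r2 c2 r c] y z eq by simp
  next
    assume "\<not> r + c \<le> n + 1" "\<not> r2 + c2 \<le> n + 1"
    then have "Y.letter (n + 1 - r) (m + 1 - c) = Y.letter (n + 1 - r2) (m + 1 - c2)"
      using high[of r c] high[of r2 c2] y z eq by simp
    then have "n + 1 - r = n + 1 - r2 \<and> m + 1 - c = m + 1 - c2"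
      by (rule Y.letter_inj[rotated 6]) (use y z in auto)
    then show ?thesis using y z by auto
  qed
  define R where "R = rect n m"
  have R: "(r, c) \<in> R \<longleftrightarrow> 1 \<le> r \<and> r \<le> n \<and> 1 \<le> c \<and> c \<le> m" for r c by (auto simp: R_def rect_def)
  have cardR: "card R = m * n" by (simp add: R_def rect_def)
  have syt: "standard_young_tableau R (\<lambda>y. if y \<in> R then Some (G y) else None)"
    unfolding standard_young_tableau_def
  proof (intro conjI allI impI)
    show "dom (\<lambda>y. if y \<in> R then Some (G y) else None) = R" by (auto split: if_splits)
    have "inj_on G R"
    proof (rule inj_onI)
      fix y z assume "y \<in> R" "z \<in> R" "G y = G z"
      then show "y = z" using inj[of "fst y" "snd y" "fst z" "snd z"] R[of "fst y" "snd y"] R[of "fst z" "snd z"]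
        by (simp add: prod_eq_iff)
    qed
    moreover have "G ` R \<subseteq> {1..int (card R)}"
    proof
      fix x assume "x \<in> G ` R"
      then obtain r c where "(r, c) \<in> R" "x = G (r, c)" by auto
      then show "x \<in> {1..int (card R)}" using range[of r c] R[of r c] cardR by simp
    qed
    moreover from calculation have "G ` R = {1..int (card R)}"
      by (intro card_subset_eq) (simp_all add: card_image)
    ultimately have "bij_betw G R {1..int (card R)}" by (simp add: bij_betw_def)
    then show "bij_betw (\<lambda>x. the (if x \<in> R then Some (G x) else None)) R {1..int (card R)}"
      by (rule bij_betw_cong[THEN iffD1, rotated]) simp
  qed (use rows cols R in auto)
  have c1: "T y = Some (G y)"
    if C: "corners n idx L b" and LR: "L \<subseteq> R" and b: "\<forall>i\<in>{1..n}. fst (b i) = n + 1 - i"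
      and st: "corners.state n idx L b 0 cv1 {} T" and d: "corners.dominated idx b 0 T" and y: "y \<in> L"
    for L b cv1 T y
  proof -
    interpret c: corners n idx L b by (rule C)
    obtain r c where rc: "y = (r, c)" by (cases y)
    obtain x where x: "T y = Some x" using y c.stateD(2)[OF st] by blast
    have "x = X.letter r c" by (rule X.entry_eq[OF C _ st d]) (use b x rc in auto)
    moreover have "r + c \<le> m + 1" using row_shape_fst_plus_snd_le[OF C _ _ y, of m] LR b rc by (auto simp: R_def)
    moreover have "1 \<le> r" "r \<le> n" using y LR R[of r c] rc by auto
    ultimately show ?thesis using x low[of r c] rc by simp
  qed
  have c2: "T y = Some (K - G (n + 1 - fst y, m + 1 - snd y))"
    if C: "corners n idx' L b" and LR: "L \<subseteq> R" and b: "\<forall>i\<in>{1..n}. fst (b i) = n + 1 - i"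
      and st: "corners.state n idx' L b 0 cv1 {} T" and d: "corners.dominated idx' b 0 T" and y: "y \<in> L"
    for L b cv1 T y
  proof -
    interpret c: corners n idx' L b by (rule C)
    obtain r c where rc: "y = (r, c)" by (cases y)
    obtain x where x: "T y = Some x" using y c.stateD(2)[OF st] by blast
    have "x = Y.letter r c" by (rule Y.entry_eq[OF C _ st d]) (use b x rc in auto)
    moreover have "r + c \<le> m + 1" using row_shape_fst_plus_snd_le[OF C _ _ y, of m] LR b rc by (auto simp: R_def)
    moreover have rr: "1 \<le> r" "r \<le> n" "1 \<le> c" "c \<le> m" using y LR R[of r c] rc by auto
    moreover have "n + 1 - (n + 1 - r) = r" "m + 1 - (m + 1 - c) = c" using rr by auto
    ultimately show ?thesis using x high[of "n + 1 - r" "m + 1 - c"] rc by auto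
  qed
  have "forced n idx (row_shape n m idx) G"
    using c1 unfolding R_def by (intro forcedI) (auto simp: row_shape_def)
  moreover have "forced n idx' (row_shape n m idx') (\<lambda>y. int (m * n) + 1 - G (n + 1 - fst y, m + 1 - snd y))"
    using c2 unfolding R_def K_def by (intro forcedI) (auto simp: row_shape_def)
  ultimately show ?thesis using syt unfolding R_def by blast
qed

section \<open>Diagonals of rectangles\<close>

lemma diagonal_mono:
  assumes d: "diagonal n R Lm Lp b" and ij: "1 \<le> i" "i < j" "j \<le> n"
  shows "fst (b j) < fst (b i) \<and> snd (b i) < snd (b j)"
proof -
  have step: "fst (b (Suc i)) < fst (b i) \<and> snd (b i) < snd (b (Suc i))" if "1 \<le> i" "Suc i \<le> n" for i
    using d that unfolding diagonal_def by auto
  show ?thesis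
    using ij(2,1,3)
  proof (induction rule: strict_inc_induct)
    case (base i) then show ?case using step[of i] by auto
  next
    case (step i) then show ?case using \<open>\<And>i. \<lbrakk>1 \<le> i; Suc i \<le> n\<rbrakk> \<Longrightarrow> _\<close>[of i] by fastforce
  qed
qed

lemma diagonal_in: "diagonal n R Lm Lp b \<Longrightarrow> i \<in> {1..n} \<Longrightarrow> b i \<in> Lp - Lm"
  unfolding diagonal_def by blast

text \<open>\<open>n\<close> boxes in strictly rising rows must use each of the \<open>n\<close>
  rows.\<close>

lemma diagonal_rows:
  assumes d: "diagonal n (rect n m) Lm Lp b" and i: "i \<in> {1..n}"
  shows "fst (b i) = n + 1 - i"
proof -
  have in_rect: "1 \<le> fst (b j) \<and> fst (b j) \<le> n" if "j \<in> {1..n}" for j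
  proof -
    have "b j \<in> rect n m" using diagonal_in[OF d that] d unfolding diagonal_def by blast
    then show ?thesis by (auto simp: rect_def)
  qed
  have "fst (b j) + j \<le> n + 1" if "1 \<le> j" "j \<le> n" for j
    using that
  proof (induction j rule: nat_induct_at_least)
    case base then show ?case using in_rect[of 1] by simp
  next
    case (Suc j) then show ?case using diagonal_mono[OF d, of j "Suc j"] by simp
  qed
  moreover have "n + 1 \<le> fst (b j) + j" if "1 \<le> j" "j \<le> n" for j
    using that(2,1)
  proof (induction rule: inc_induct)
    case base then show ?case using in_rect[of n] by simp
  next
    case (step j) then show ?case using diagonal_mono[OF d, of j "Suc j"] by simp
  qed
  ultimately have "fst (b i) + i = n + 1" using i by (simp add: antisym)
  then show ?thesis by simp
qed

lemma diagonal_cols: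
  assumes d: "diagonal n (rect m n) Lm Lp b" and i: "i \<in> {1..n}"
  shows "snd (b i) = i"
proof -
  have in_rect: "1 \<le> snd (b j) \<and> snd (b j) \<le> n" if "j \<in> {1..n}" for j
  proof -
    have "b j \<in> rect m n" using diagonal_in[OF d that] d unfolding diagonal_def by blast
    then show ?thesis by (auto simp: rect_def)
  qed
  have "j \<le> snd (b j)" if "1 \<le> j" "j \<le> n" for j
    using that
  proof (induction j rule: nat_induct_at_least)
    case base then show ?case using in_rect[of 1] by simp
  next
    case (Suc j) then show ?case using diagonal_mono[OF d, of j "Suc j"] by simp
  qed
  moreover have "snd (b j) \<le> j" if "1 \<le> j" "j \<le> n" for j
    using that(2,1)
  proof (induction rule: inc_induct)
    case base then show ?case using in_rect[of n] by simp
  next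
    case (step j) then show ?case using diagonal_mono[OF d, of j "Suc j"] by simp
  qed
  ultimately show ?thesis using i by (simp add: antisym)
qed

text \<open>A box of \<open>Lm\<close> is never maximal in \<open>Lp\<close>: with \<open>n\<close>
  rows the diagonal box of its row lies to its right, with \<open>n\<close> columns that of its
  column lies below it. This is where the shape of the rectangle enters.\<close>

lemma diagonal_corners:
  assumes pq: "p = n \<or> q = n" and d: "diagonal n (rect p q) Lm Lp b"
    and n1: "1 \<le> n" and idx: "\<And>x. idx x \<in> {1..n}" "\<And>x y. idx x = idx y \<longleftrightarrow> int n dvd x - y"
  shows "corners n idx Lp b"
proof
  have Lm: "young_diagram Lm" and Lp: "young_diagram Lp" and sub: "Lm \<subseteq> Lp" "Lp \<subseteq> rect p q"
    and img: "Lp - Lm = b ` {1..n}"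
    using d unfolding diagonal_def by blast+
  show "young_diagram Lp" by (rule Lp)
  show "b i \<in> Lp" if "i \<in> {1..n}" for i using diagonal_in[OF d that] by blast
  show "fst (b j) < fst (b i) \<and> snd (b i) < snd (b j)" if "1 \<le> i" "i < j" "j \<le> n" for i j
    by (rule diagonal_mono[OF d that])
  show "y = b i" if i: "i \<in> {1..n}" "y \<in> Lp" "nw (b i) y" for i y
  proof -
    have bi: "b i \<in> Lp" "b i \<notin> Lm" using diagonal_in[OF d i(1)] by auto
    have "y \<notin> Lm" using young_downD[OF Lm _ i(3)] young_pos[OF Lp bi(1)] bi(2) by blast
    then obtain j where j: "j \<in> {1..n}" "y = b j" using i(2) img by blast
    then show ?thesis
      using diagonal_mono[OF d, of i j] diagonal_mono[OF d, of j i] i(1,3)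
      by (cases i j rule: linorder_cases) (auto simp: nw_def)
  qed
  show "\<exists>i\<in>{1..n}. y = b i" if y: "y \<in> Lp" "right_of y \<notin> Lp" "below y \<notin> Lp" for y
  proof (cases "y \<in> Lm")
    case False then show ?thesis using y(1) img by blast
  next
    case True
    have y1: "1 \<le> fst y" "1 \<le> snd y" "fst y \<le> p" "snd y \<le> q" using y(1) sub(2) by (auto simp: rect_def)
    from pq show ?thesis
    proof
      assume p: "p = n"
      define i where "i = n + 1 - fst y"
      have i1: "i \<in> {1..n}" using y1 p by (auto simp: i_def)
      then have i: "i \<in> {1..n}" "fst (b i) = fst y"
        using diagonal_rows[OF d[unfolded p], of i] y1 p by (auto simp: i_def)
      have bi: "b i \<in> Lp" "b i \<notin> Lm" using diagonal_in[OF d i(1)] by auto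
      have "snd y < snd (b i)"
      proof (rule ccontr)
        assume "\<not> ?thesis"
        then have "nw (b i) y" using i(2) by (simp add: nw_def)
        then show False using young_downD[OF Lm True] bi young_pos[OF Lp bi(1)] by blast
      qed
      then have "right_of y \<in> Lp"
        by (intro young_downD[OF Lp bi(1)]) (use i(2) y1 in \<open>auto simp: nw_def right_of_conv\<close>)
      then show ?thesis using y(2) by blast
    next
      assume q: "q = n"
      define i where "i = snd y"
      have i1: "i \<in> {1..n}" using y1 q by (auto simp: i_def)
      then have i: "i \<in> {1..n}" "snd (b i) = snd y"
        using diagonal_cols[OF d[unfolded q], of i] y1 q by (auto simp: i_def)
      have bi: "b i \<in> Lp" "b i \<notin> Lm" using diagonal_in[OF d i(1)] by auto
      have "fst y < fst (b i)"
      proof (rule ccontr)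
        assume "\<not> ?thesis"
        then have "nw (b i) y" using i(2) by (simp add: nw_def)
        then show False using young_downD[OF Lm True] bi young_pos[OF Lp bi(1)] by blast
      qed
      then have "below y \<in> Lp"
        by (intro young_downD[OF Lp bi(1)]) (use i(2) y1 in \<open>auto simp: nw_def below_conv\<close>)
      then show ?thesis using y(3) by blast
    qed
  qed
qed (use n1 idx in auto)

lemma diagonal_filling_Some:
  assumes d: "diagonal n R Lm Lp b"
  shows "diagonal_filling n b e y = Some x \<longleftrightarrow> (\<exists>i\<in>{1..n}. y = b i \<and> x = e i)"
proof -
  have "inj_on b {1..n}"
    using d unfolding diagonal_def by (metis card_atLeastAtMost diff_Suc_1 eq_card_imp_inj_on finite_atLeastAtMost)
  moreover have "set [1..<n + 1] = {1..n}" by auto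
  ultimately have "distinct (map fst (map (\<lambda>i. (b i, e i)) [1..<n + 1]))"
    by (simp add: comp_def distinct_map)
  then have "diagonal_filling n b e y = Some x \<longleftrightarrow> (y, x) \<in> set (map (\<lambda>i. (b i, e i)) [1..<n + 1])"
    unfolding diagonal_filling_def by (rule map_of_eq_Some_iff)
  then show ?thesis by auto
qed

lemma lower_output_state:
  assumes pq: "p = n \<or> q = n" and d: "diagonal n (rect p q) Lm Lp b"
    and n1: "1 \<le> n" and idx: "\<And>x. idx x \<in> {1..n}" "\<And>x y. idx x = idx y \<longleftrightarrow> int n dvd x - y"
    and w: "\<And>i. i \<in> {1..n} \<Longrightarrow> idx (int (w i)) = i \<and> w i \<in> {1..n}"
  shows "\<exists>T. lower_output n Lp b w T"
    and "lower_output n Lp b w T \<Longrightarrow>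
      \<exists>cv. corners.state n idx Lp b 0 cv {} T \<and> corners.dominated idx b 0 T"
proof -
  interpret corners n idx Lp b by (rule diagonal_corners[OF pq d n1 idx])
  define T0 where "T0 = diagonal_filling n b (\<lambda>i. int (w i))"
  have T0: "T0 y = Some x \<longleftrightarrow> (\<exists>i\<in>{1..n}. y = b i \<and> x = int (w i))" for y x
    unfolding T0_def by (rule diagonal_filling_Some[OF d])
  have w': "idx (int (w i)) = i \<and> 0 < int (w i) \<and> int (w i) \<le> 0 + int n" if "i \<in> {1..n}" for i
    using w[OF that] by auto
  note I = initial_state[OF T0 w']
  show "\<exists>T. lower_output n Lp b w T"
    using lower_steps_exist[OF I(1)] stateD(2) unfolding lower_output_def T0_def by (metis Diff_empty)
  show "\<exists>cv. state 0 cv {} T \<and> dominated 0 T" if T: "lower_output n Lp b w T"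
  proof -
    obtain cv \<mu> where st: "state 0 cv \<mu> T" "dominated 0 T"
      using lower_steps_state[OF _ I] T unfolding lower_output_def T0_def by blast
    have "\<mu> \<subseteq> Lp" "dom T = Lp - \<mu>" using stateD(1,2)[OF st(1)] unfolding down_closed_def by blast+
    then have "\<mu> = {}" using T unfolding lower_output_def by blast
    then show ?thesis using st by blast
  qed
qed

section \<open>Rotation\<close>

definition rotate_box :: "nat \<Rightarrow> nat \<Rightarrow> box \<Rightarrow> box" where
  "rotate_box p q y = (p + 1 - fst y, q + 1 - snd y)"

text \<open>The restriction to the rectangle is essential because truncated subtraction makes
  \<open>rotate_box\<close> non-injective far outside.\<close>

definition rotate_filling :: "nat \<Rightarrow> nat \<Rightarrow> int \<Rightarrow> filling \<Rightarrow> filling" where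
  "rotate_filling p q K T y = (if y \<in> rect p q then map_option (\<lambda>x. K - x) (T (rotate_box p q y)) else None)"

lemma rotate_in [simp]: "y \<in> rect p q \<Longrightarrow> rotate_box p q y \<in> rect p q"
  by (auto simp: rotate_box_def rect_def)

lemma rotate_rotate [simp]: "y \<in> rect p q \<Longrightarrow> rotate_box p q (rotate_box p q y) = y"
  by (auto simp: rotate_box_def rect_def)

lemma inj_rotate: "inj_on (rotate_box p q) (rect p q)"
  by (rule inj_on_inverseI[of _ "rotate_box p q"]) simp

lemma rotate_image_image: "A \<subseteq> rect p q \<Longrightarrow> rotate_box p q ` rotate_box p q ` A = A"
  unfolding image_image by (rule trans[OF image_cong[OF refl, of A _ "\<lambda>x. x"]]) auto

lemma rotate_image_subset: "A \<subseteq> rect p q \<Longrightarrow> rotate_box p q ` A \<subseteq> rect p q"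
  by auto

lemma rotate_image_iff: "A \<subseteq> rect p q \<Longrightarrow> z \<in> rect p q \<Longrightarrow> rotate_box p q z \<in> rotate_box p q ` A \<longleftrightarrow> z \<in> A"
  using inj_rotate[of p q] by (meson inj_on_image_mem_iff)

lemma dom_rotate_filling:
  assumes "dom T \<subseteq> rect p q"
  shows "dom (rotate_filling p q K T) = rotate_box p q ` dom T"
proof (intro set_eqI iffI)
  fix y assume "y \<in> dom (rotate_filling p q K T)"
  then have y: "y \<in> rect p q" "rotate_box p q y \<in> dom T" by (auto simp: rotate_filling_def split: if_splits)
  then show "y \<in> rotate_box p q ` dom T" using rotate_rotate[OF y(1)] by (metis image_eqI)
next
  fix y assume "y \<in> rotate_box p q ` dom T"
  then obtain z where "z \<in> dom T" "y = rotate_box p q z" by blast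
  then show "y \<in> dom (rotate_filling p q K T)" using assms by (auto simp: rotate_filling_def subset_iff)
qed

lemma dom_rotate_filling_subset: "dom (rotate_filling p q K T) \<subseteq> rect p q"
  by (auto simp: rotate_filling_def split: if_splits)

lemma rotate_filling_twice:
  assumes "dom T \<subseteq> rect p q"
  shows "rotate_filling p q K (rotate_filling p q K T) = T"
proof
  fix y
  show "rotate_filling p q K (rotate_filling p q K T) y = T y"
  proof (cases "y \<in> rect p q")
    case True
    then show ?thesis by (cases "T y") (auto simp: rotate_filling_def)
  next
    case False
    then have "T y = None" using assms by (auto simp: domIff)
    then show ?thesis using False by (simp add: rotate_filling_def)
  qed
qed

text \<open>The bounds include the frame around the rectangle, coordinate \<open>0\<close> among it,
  where \<open>left_of\<close> and \<open>above\<close> may lead. The rotated frame is still outside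
  the rectangle.\<close>

lemma rotate_filling_apply:
  assumes "dom T \<subseteq> rect p q" "fst z \<le> p + 1" "snd z \<le> q + 1"
  shows "rotate_filling p q K T (rotate_box p q z) = map_option (\<lambda>x. K - x) (T z)"
proof (cases "z \<in> rect p q")
  case True then show ?thesis by (simp add: rotate_filling_def)
next
  case False
  then have "rotate_box p q z \<notin> rect p q" using assms(2,3) by (cases z) (auto simp: rotate_box_def rect_def)
  moreover have "T z = None" using False assms(1) by (auto simp: domIff)
  ultimately show ?thesis by (simp add: rotate_filling_def)
qed

text \<open>Rotation exchanges right with left and below with above, and \<open>K - x\<close>
  exchanges smaller with larger. Ties also correspond, since both rules then choose the vertical
  neighbour.\<close>

lemma slide_source_rotate:
  assumes U: "dom U \<subseteq> rect p q" and x: "x \<in> rect p q"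
  shows "slide_source (rotate_filling p q K U) (rotate_box p q x) = map_option (rotate_box p q) (rev_slide_source U x)"
proof -
  have x1: "1 \<le> fst x" "fst x \<le> p" "1 \<le> snd x" "snd x \<le> q" using x by (auto simp: rect_def)
  have r: "right_of (rotate_box p q x) = rotate_box p q (left_of x)" "below (rotate_box p q x) = rotate_box p q (above x)"
    using x1 by (cases x; auto simp: rotate_box_def)+
  have "fst (left_of x) \<le> p + 1" "snd (left_of x) \<le> q + 1" "fst (above x) \<le> p + 1" "snd (above x) \<le> q + 1"
    using x1 by (cases x; auto)+
  then have v: "rotate_filling p q K U (rotate_box p q (left_of x)) = map_option (\<lambda>x. K - x) (U (left_of x))"
    "rotate_filling p q K U (rotate_box p q (above x)) = map_option (\<lambda>x. K - x) (U (above x))"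
    using rotate_filling_apply[OF U] by blast+
  show ?thesis
    unfolding slide_source_def rev_slide_source_def r v
    by (cases "U (left_of x)"; cases "U (above x)") auto
qed

lemma rev_slide_source_rotate:
  assumes V: "dom V \<subseteq> rect p q" and x: "x \<in> rect p q"
  shows "map_option (rotate_box p q) (rev_slide_source (rotate_filling p q K V) (rotate_box p q x)) = slide_source V x"
proof -
  have "slide_source (rotate_filling p q K (rotate_filling p q K V)) (rotate_box p q (rotate_box p q x))
    = map_option (rotate_box p q) (rev_slide_source (rotate_filling p q K V) (rotate_box p q x))"
    by (rule slide_source_rotate[OF dom_rotate_filling_subset rotate_in[OF x]])
  then show ?thesis unfolding rotate_filling_twice[OF V] rotate_rotate[OF x] by simp
qed

lemma rotate_filling_move:
  assumes U: "dom U \<subseteq> rect p q" and x: "x \<in> rect p q" and y: "y \<in> rect p q"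
  shows "rotate_filling p q K (U(x := U y, y := None))
    = (rotate_filling p q K U)(rotate_box p q x := rotate_filling p q K U (rotate_box p q y), rotate_box p q y := None)"
proof
  fix z
  have inj: "rotate_box p q z = u \<longleftrightarrow> z = rotate_box p q u" if "z \<in> rect p q" "u \<in> rect p q" for u
    using that rotate_rotate by metis
  show "rotate_filling p q K (U(x := U y, y := None)) z
    = ((rotate_filling p q K U)(rotate_box p q x := rotate_filling p q K U (rotate_box p q y), rotate_box p q y := None)) z"
  proof (cases "z \<in> rect p q")
    case True
    then show ?thesis using inj[OF True x] inj[OF True y] x y by (auto simp: rotate_filling_def)
  next
    case False
    then have "z \<noteq> rotate_box p q x" "z \<noteq> rotate_box p q y" using x y by auto
    then show ?thesis using False by (simp add: rotate_filling_def)
  qed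
qed

lemma slide_source_dom: "slide_source T x = Some y \<Longrightarrow> y \<in> dom T"
  unfolding slide_source_def by (auto split: option.splits if_splits)

lemma rev_slide_source_dom: "rev_slide_source T x = Some y \<Longrightarrow> y \<in> dom T"
  unfolding rev_slide_source_def by (auto split: option.splits if_splits)

lemma slides_dom:
  assumes "slides src T x T' z" "\<And>T x y. src T x = Some y \<Longrightarrow> y \<in> dom T" "x \<notin> dom T"
  shows "dom T' = insert x (dom T) - {z} \<and> z \<in> insert x (dom T)"
  using assms(1,3)
proof (induction rule: slides.induct)
  case (stop T x) then show ?case by auto
next
  case (move T x y T' z)
  have y: "y \<in> dom T" using assms(2)[OF move(1)] .
  then have "y \<noteq> x" using move(4) by blast
  then have d: "dom (T(x := T y, y := None)) = insert x (dom T) - {y}" using y by auto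
  have "y \<notin> dom (T(x := T y, y := None))" by simp
  then have "dom T' = insert y (insert x (dom T) - {y}) - {z} \<and> z \<in> insert y (insert x (dom T) - {y})"
    using move(3) unfolding d by simp
  moreover have "insert y (insert x (dom T) - {y}) = insert x (dom T)"
    using y by (metis insertCI insert_Diff)
  ultimately show ?case by (simp only:)
qed

lemma slides_rotate:
  assumes "slides rev_slide_source U x U' z" "dom U \<subseteq> rect p q" "x \<in> rect p q"
  shows "slides slide_source (rotate_filling p q K U) (rotate_box p q x) (rotate_filling p q K U') (rotate_box p q z)"
  using assms
proof (induction rule: slides.induct)
  case (stop U x)
  have "slide_source (rotate_filling p q K U) (rotate_box p q x) = None"
    using slide_source_rotate[OF stop(2,3)] stop(1) by simp
  then show ?case by (rule slides.stop)
next
  case (move U x y U' z)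
  have y: "y \<in> rect p q" using rev_slide_source_dom[OF move(1)] move(4) by blast
  have "slide_source (rotate_filling p q K U) (rotate_box p q x) = Some (rotate_box p q y)"
    using slide_source_rotate[OF move(4,5)] move(1) by simp
  moreover have "dom (U(x := U y, y := None)) \<subseteq> rect p q" using move(4,5) by auto
  then have "slides slide_source (rotate_filling p q K (U(x := U y, y := None))) (rotate_box p q y)
    (rotate_filling p q K U') (rotate_box p q z)" by (rule move(3)[OF _ y])
  ultimately show ?case unfolding rotate_filling_move[OF move(4,5) y] by (rule slides.move)
qed

lemma rev_slides_rotate:
  assumes "slides slide_source V x V' z" "dom V \<subseteq> rect p q" "x \<in> rect p q"
  shows "slides rev_slide_source (rotate_filling p q K V) (rotate_box p q x) (rotate_filling p q K V') (rotate_box p q z)"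
  using assms
proof (induction rule: slides.induct)
  case (stop V x)
  have "map_option (rotate_box p q) (rev_slide_source (rotate_filling p q K V) (rotate_box p q x)) = slide_source V x"
    by (rule rev_slide_source_rotate[OF stop(2,3)])
  then have "rev_slide_source (rotate_filling p q K V) (rotate_box p q x) = None" using stop(1) by simp
  then show ?case by (rule slides.stop)
next
  case (move V x y V' z)
  have y: "y \<in> rect p q" using slide_source_dom[OF move(1)] move(4) by blast
  have "map_option (rotate_box p q) (rev_slide_source (rotate_filling p q K V) (rotate_box p q x)) = slide_source V x"
    by (rule rev_slide_source_rotate[OF move(4,5)])
  then obtain u where u: "rev_slide_source (rotate_filling p q K V) (rotate_box p q x) = Some u" "y = rotate_box p q u"
    using move(1) by auto
  have "u \<in> rect p q" using rev_slide_source_dom[OF u(1)] dom_rotate_filling_subset by blast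
  then have "rev_slide_source (rotate_filling p q K V) (rotate_box p q x) = Some (rotate_box p q y)" using u by simp
  moreover have "dom (V(x := V y, y := None)) \<subseteq> rect p q" using move(4,5) by auto
  then have "slides rev_slide_source (rotate_filling p q K (V(x := V y, y := None))) (rotate_box p q y)
    (rotate_filling p q K V') (rotate_box p q z)" by (rule move(3)[OF _ y])
  ultimately show ?case unfolding rotate_filling_move[OF move(4,5) y] by (rule slides.move)
qed

text \<open>The complement of an order ideal is closed towards the southeast, and rotation reverses
  the order.\<close>

lemma young_complement:
  assumes N: "N \<subseteq> rect p q" "young_diagram N"
  shows "young_diagram (rotate_box p q ` (rect p q - N))"
proof (rule young_diagramI)
  show "finite (rotate_box p q ` (rect p q - N))" by (simp add: rect_def)
  show "1 \<le> fst y \<and> 1 \<le> snd y" if "y \<in> rotate_box p q ` (rect p q - N)" for y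
    using that by (auto simp: rotate_box_def rect_def)
  show "z \<in> rotate_box p q ` (rect p q - N)"
    if y: "y \<in> rotate_box p q ` (rect p q - N)" and z: "nw z y" "1 \<le> fst z" "1 \<le> snd z" for y z
  proof -
    obtain u where u: "u \<in> rect p q" "u \<notin> N" "y = rotate_box p q u" using y by blast
    have zR: "z \<in> rect p q" using z u by (cases z) (auto simp: rect_def rotate_box_def nw_def)
    have nwu: "nw u (rotate_box p q z)" using z(1) u zR by (auto simp: nw_def rotate_box_def rect_def)
    have "rotate_box p q z \<notin> N"
    proof
      assume "rotate_box p q z \<in> N"
      then have "u \<in> N" by (rule young_downD[OF N(2) _ nwu]) (use u(1) in \<open>auto simp: rect_def\<close>)
      then show False using u(2) by simp
    qed
    then show ?thesis using zR rotate_rotate[OF zR] by (intro image_eqI[of _ _ "rotate_box p q z"]) auto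
  qed
qed

text \<open>All diagonal boxes are filled before the slide, so \<open>the\<close> is applied to
  genuine entries on both sides; negation of entries changes the sign of \<open>k\<close>.\<close>

lemma rotate_filling_refill:
  assumes dom: "dom U \<subseteq> rect p q" "dom U' \<subseteq> rect p q" and b: "b ` {1..n} \<subseteq> dom U"
    and b': "b' ` {1..n} = rotate_box p q ` b ` {1..n}" and z: "z \<in> rect p q"
  shows "rotate_filling p q K (refill n b k U U' z)
    = refill n b' (- k) (rotate_filling p q K U) (rotate_filling p q K U') (rotate_box p q z)"
proof -
  have bR: "b ` {1..n} \<subseteq> rect p q" using b dom by blast
  have iff: "rotate_box p q z \<in> b' ` {1..n} \<longleftrightarrow> z \<in> b ` {1..n}"
    unfolding b' by (rule rotate_image_iff[OF bR z])
  show ?thesis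
  proof (cases "z \<in> b ` {1..n}")
    case False then show ?thesis using iff by (simp add: refill_def)
  next
    case True
    then obtain u where u: "U z = Some u" using b by blast
    have "rotate_filling p q K U (rotate_box p q z) = Some (K - u)" using u z by (simp add: rotate_filling_def)
    then have 1: "refill n b' (- k) (rotate_filling p q K U) (rotate_filling p q K U') (rotate_box p q z)
        = (rotate_filling p q K U')(rotate_box p q z := Some (K - u - k))"
      using iff True by (simp add: refill_def)
    have 2: "refill n b k U U' z = U'(z := Some (u + k))" using True u by (simp add: refill_def)
    show ?thesis unfolding 1 2
    proof
      fix y
      show "rotate_filling p q K (U'(z := Some (u + k))) y
        = ((rotate_filling p q K U')(rotate_box p q z := Some (K - u - k))) y"
      proof (cases "y \<in> rect p q")
        case True
        then have "rotate_box p q y = z \<longleftrightarrow> y = rotate_box p q z" using z rotate_rotate by metis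
        then show ?thesis using True z by (auto simp: rotate_filling_def)
      next
        case False
        then show ?thesis using z by (auto simp: rotate_filling_def)
      qed
    qed
  qed
qed

lemma refill_dom:
  assumes "dom U' = insert x (dom U) - {z}" "z \<in> insert x (dom U)" "b ` {1..n} \<subseteq> dom U" "dom U \<subseteq> M" "x \<in> M"
  shows "b ` {1..n} \<subseteq> dom (refill n b k U U' z) \<and> dom (refill n b k U U' z) \<subseteq> M"
proof (cases "z \<in> b ` {1..n}")
  case True
  then have "refill n b k U U' z = U'(z := Some (the (U z) + k))" by (simp add: refill_def)
  then have "dom (refill n b k U U' z) = insert z (dom U')" by simp
  moreover have "B \<subseteq> insert z D' \<and> insert z D' \<subseteq> M"
    if "D' = insert x D - {z}" "z \<in> insert x D" "B \<subseteq> D" "D \<subseteq> M" "x \<in> M" for B D D' :: "box set"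
    using that by blast
  ultimately show ?thesis using assms by metis
next
  case False
  then have "refill n b k U U' z = U'" by (simp add: refill_def)
  moreover have "B \<subseteq> D' \<and> D' \<subseteq> M"
    if "D' = insert x D - {z}" "z \<notin> B" "B \<subseteq> D" "D \<subseteq> M" "x \<in> M" for B D D' :: "box set"
    using that by blast
  ultimately show ?thesis using assms False by metis
qed

text \<open>The two inclusions in the conclusion re-establish the hypotheses for the next step of a
  run.\<close>

lemma upper_step_rotate:
  assumes step: "upper_step n (rect p q) Lm b U U''"
    and b: "b ` {1..n} \<subseteq> dom U" and U: "dom U \<subseteq> rect p q - Lm"
    and b': "b' ` {1..n} = rotate_box p q ` b ` {1..n}"
  shows "lower_step n (rotate_box p q ` (rect p q - Lm)) b' (rotate_filling p q K U) (rotate_filling p q K U'') \<and>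
    b ` {1..n} \<subseteq> dom U'' \<and> dom U'' \<subseteq> rect p q - Lm"
proof -
  define R where "R = rect p q"
  have UR: "dom U \<subseteq> R" using U by (auto simp: R_def)
  obtain x U' z where ne: "dom U \<noteq> R - Lm" and x: "x \<in> R - Lm - dom U"
    and yd: "young_diagram ((R - (R - Lm - dom U)) \<union> {x})" and sl: "slides rev_slide_source U x U' z"
    and U'': "U'' = refill n b (- int n) U U' z"
    using step unfolding upper_step_def R_def by blast
  have xR: "x \<in> R" using x by blast
  have dU': "dom U' = insert x (dom U) - {z}" "z \<in> insert x (dom U)"
  proof -
    have "dom U' = insert x (dom U) - {z} \<and> z \<in> insert x (dom U)"
      by (rule slides_dom[OF sl]) (use rev_slide_source_dom x in blast)+
    then show "dom U' = insert x (dom U) - {z}" "z \<in> insert x (dom U)" by simp_all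
  qed
  have zR: "z \<in> R" using dU'(2) xR UR by blast
  have "insert x (dom U) \<subseteq> R" using xR UR by simp
  then have U'R: "dom U' \<subseteq> R" unfolding dU'(1) by (rule subset_trans[OF Diff_subset])
  have inv: "b ` {1..n} \<subseteq> dom U''" "dom U'' \<subseteq> R - Lm"
  proof -
    have "b ` {1..n} \<subseteq> dom U'' \<and> dom U'' \<subseteq> R - Lm"
      unfolding U'' by (rule refill_dom[OF dU' b]) (use U x R_def in blast)+
    then show "b ` {1..n} \<subseteq> dom U''" "dom U'' \<subseteq> R - Lm" by simp_all
  qed
  define V where "V = rotate_filling p q K U"
  have dV: "dom V = rotate_box p q ` dom U" unfolding V_def by (rule dom_rotate_filling) (use UR R_def in simp)
  have inj: "inj_on (rotate_box p q) R" unfolding R_def by (rule inj_rotate)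
  have diff: "rotate_box p q ` (A - B) = rotate_box p q ` A - rotate_box p q ` B" if "A \<subseteq> R" "B \<subseteq> R" for A B
    by (rule inj_on_image_set_diff[OF inj]) (use that in auto)
  have mu: "rotate_box p q ` (R - Lm) - dom V = rotate_box p q ` (R - Lm - dom U)"
    unfolding dV using diff[of "R - Lm" "dom U"] UR by auto
  have "lower_step n (rotate_box p q ` (R - Lm)) b' V (rotate_filling p q K U'')"
    unfolding lower_step_def
  proof (intro conjI exI)
    show "dom V \<noteq> rotate_box p q ` (R - Lm)"
      unfolding dV using inj_on_image_eq_iff[OF inj UR, of "R - Lm"] ne by blast
    show "rotate_box p q ` (R - Lm) - dom V = rotate_box p q ` (R - Lm) - dom V" ..
    show "rotate_box p q x \<in> rotate_box p q ` (R - Lm) - dom V" unfolding mu using x by blast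
    have "rotate_box p q ` (R - Lm) - dom V - {rotate_box p q x} = rotate_box p q ` (R - Lm - dom U - {x})"
      unfolding mu using diff[of "R - Lm - dom U" "{x}"] xR by auto
    also have "R - Lm - dom U - {x} = R - ((R - (R - Lm - dom U)) \<union> {x})" by blast
    finally show "young_diagram (rotate_box p q ` (R - Lm) - dom V - {rotate_box p q x})"
      using young_complement[OF _ yd, of p q] xR by (auto simp: R_def)
    show "slides slide_source V (rotate_box p q x) (rotate_filling p q K U') (rotate_box p q z)"
      unfolding V_def by (rule slides_rotate[OF sl]) (use UR xR R_def in auto)
    show "rotate_filling p q K U'' = refill n b' (int n) V (rotate_filling p q K U') (rotate_box p q z)"
    proof -
      have "rotate_filling p q K U'' = refill n b' (- (- int n)) V (rotate_filling p q K U') (rotate_box p q z)"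
        unfolding U'' V_def by (rule rotate_filling_refill[OF _ _ b b']) (use UR U'R zR R_def in auto)
      then show ?thesis by simp
    qed
  qed
  then show ?thesis using inv unfolding R_def V_def by blast
qed

text \<open>This direction yields the existence of upper outputs; the other one yields their
  uniqueness.\<close>

lemma lower_step_rotate:
  assumes step: "lower_step n (rotate_box p q ` (rect p q - Lm)) b' V V''"
    and b: "b' ` {1..n} \<subseteq> dom V" and V: "dom V \<subseteq> rotate_box p q ` (rect p q - Lm)"
    and b': "b' ` {1..n} = rotate_box p q ` b ` {1..n}" and bR: "b ` {1..n} \<subseteq> rect p q"
  shows "upper_step n (rect p q) Lm b (rotate_filling p q K V) (rotate_filling p q K V'') \<and>
    b' ` {1..n} \<subseteq> dom V'' \<and> dom V'' \<subseteq> rotate_box p q ` (rect p q - Lm)"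
proof -
  define R where "R = rect p q"
  define M where "M = rotate_box p q ` (R - Lm)"
  have MR: "M \<subseteq> R" unfolding M_def R_def by (rule rotate_image_subset) blast
  have VM: "dom V \<subseteq> M" using V by (simp add: M_def R_def)
  have VR: "dom V \<subseteq> R" using VM MR by blast
  obtain x V' z where ne: "dom V \<noteq> M" and x: "x \<in> M - dom V"
    and yd: "young_diagram (M - dom V - {x})" and sl: "slides slide_source V x V' z"
    and V'': "V'' = refill n b' (int n) V V' z"
    using step unfolding lower_step_def R_def M_def by blast
  have xR: "x \<in> R" using x MR by blast
  have dV': "dom V' = insert x (dom V) - {z}" "z \<in> insert x (dom V)"
  proof -
    have "dom V' = insert x (dom V) - {z} \<and> z \<in> insert x (dom V)"
      by (rule slides_dom[OF sl]) (use slide_source_dom x in blast)+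
    then show "dom V' = insert x (dom V) - {z}" "z \<in> insert x (dom V)" by simp_all
  qed
  have zR: "z \<in> R" using dV'(2) xR VR by blast
  have "insert x (dom V) \<subseteq> R" using xR VR by simp
  then have V'R: "dom V' \<subseteq> R" unfolding dV'(1) by (rule subset_trans[OF Diff_subset])
  have inv: "b' ` {1..n} \<subseteq> dom V''" "dom V'' \<subseteq> M"
  proof -
    have "b' ` {1..n} \<subseteq> dom V'' \<and> dom V'' \<subseteq> M"
      unfolding V'' by (rule refill_dom[OF dV' b VM]) (use x in blast)
    then show "b' ` {1..n} \<subseteq> dom V''" "dom V'' \<subseteq> M" by simp_all
  qed
  define U where "U = rotate_filling p q K V"
  have dU: "dom U = rotate_box p q ` dom V" unfolding U_def by (rule dom_rotate_filling) (use VR R_def in simp)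
  have inj: "inj_on (rotate_box p q) R" unfolding R_def by (rule inj_rotate)
  have diff: "rotate_box p q ` (A - B) = rotate_box p q ` A - rotate_box p q ` B" if "A \<subseteq> R" "B \<subseteq> R" for A B
    by (rule inj_on_image_set_diff[OF inj]) (use that in auto)
  have RM: "R - Lm = rotate_box p q ` M"
    unfolding M_def R_def by (rule rotate_image_image[symmetric]) blast
  have b'': "b ` {1..n} = rotate_box p q ` b' ` {1..n}" unfolding b' by (rule rotate_image_image[OF bR, symmetric])
  have mu: "R - Lm - dom U = rotate_box p q ` (M - dom V)" unfolding dU RM using diff[OF MR VR] by simp
  have "upper_step n R Lm b U (rotate_filling p q K V'')"
    unfolding upper_step_def
  proof (intro conjI exI)
    show "dom U \<noteq> R - Lm" unfolding dU RM using inj_on_image_eq_iff[OF inj VR MR] ne by blast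
    show "R - (R - Lm - dom U) = R - (R - Lm - dom U)" ..
    have "rotate_box p q x \<in> R - Lm - dom U" unfolding mu using x by blast
    then show "rotate_box p q x \<in> R - (R - (R - Lm - dom U))" by blast
    have "young_diagram (rotate_box p q ` (R - (M - dom V - {x})))"
      unfolding R_def by (rule young_complement[OF _ yd]) (use MR R_def in blast)
    moreover have "rotate_box p q ` (R - (M - dom V - {x})) = R - (R - Lm - dom U) \<union> {rotate_box p q x}"
    proof -
      have RR: "rotate_box p q ` R = R"
        using rotate_image_image[of "rect p q" p q] rotate_image_subset[of "rect p q" p q] unfolding R_def by blast
      have "rotate_box p q ` (R - (M - dom V - {x})) = rotate_box p q ` R - rotate_box p q ` (M - dom V - {x})"
        by (rule diff) (use MR in auto)
      also have "rotate_box p q ` (M - dom V - {x}) = rotate_box p q ` (M - dom V) - rotate_box p q ` {x}"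
        by (rule diff) (use MR xR in auto)
      finally have "rotate_box p q ` (R - (M - dom V - {x})) = R - (R - Lm - dom U - {rotate_box p q x})"
        unfolding RR mu by simp
      moreover have "rotate_box p q x \<in> R" using xR unfolding R_def by simp
      ultimately show ?thesis by blast
    qed
    ultimately show "young_diagram (R - (R - Lm - dom U) \<union> {rotate_box p q x})" by simp
    show "slides rev_slide_source U (rotate_box p q x) (rotate_filling p q K V') (rotate_box p q z)"
      unfolding U_def by (rule rev_slides_rotate[OF sl]) (use VR xR R_def in auto)
    show "rotate_filling p q K V'' = refill n b (- int n) U (rotate_filling p q K V') (rotate_box p q z)"
      unfolding V'' U_def
      by (rule rotate_filling_refill[OF _ _ b b'']) (use VR V'R zR R_def in auto)
  qed
  then show ?thesis using inv unfolding R_def U_def M_def by blast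
qed

section \<open>Rotation of diagonals and of complete runs\<close>

lemma rotated_corners:
  fixes n :: nat
  shows "(\<lambda>i. rotate_box p q (b (n + 1 - i))) ` {1..n} = rotate_box p q ` b ` {1..n}"
proof -
  have "(\<lambda>i. n + 1 - i) ` {1..n} = {1..n}"
  proof (intro equalityI subsetI)
    fix i assume "i \<in> {1..n}"
    then have "i = n + 1 - (n + 1 - i)" "n + 1 - i \<in> {1..n}" by auto
    then show "i \<in> (\<lambda>i. n + 1 - i) ` {1..n}" by (rule image_eqI)
  qed auto
  then have "rotate_box p q ` b ` {1..n} = rotate_box p q ` b ` (\<lambda>i. n + 1 - i) ` {1..n}" by simp
  then show ?thesis by (simp only: image_image)
qed

lemma diagonal_rotate:
  assumes d: "diagonal n (rect p q) Lm Lp b"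
  shows "diagonal n (rect p q) (rotate_box p q ` (rect p q - Lp)) (rotate_box p q ` (rect p q - Lm))
    (\<lambda>i. rotate_box p q (b (n + 1 - i)))"
proof -
  define R where "R = rect p q"
  have D: "young_diagram Lm" "young_diagram Lp" "Lm \<subseteq> Lp" "Lp \<subseteq> R" "Lp - Lm = b ` {1..n}" "card (Lp - Lm) = n"
    using d unfolding diagonal_def R_def by blast+
  have inj: "inj_on (rotate_box p q) R" unfolding R_def by (rule inj_rotate)
  have "rotate_box p q ` (R - Lm) - rotate_box p q ` (R - Lp) = rotate_box p q ` ((R - Lm) - (R - Lp))"
    by (rule inj_on_image_set_diff[OF inj, symmetric]) auto
  also have "(R - Lm) - (R - Lp) = Lp - Lm" using D by blast
  finally have diff: "rotate_box p q ` (R - Lm) - rotate_box p q ` (R - Lp) = rotate_box p q ` (Lp - Lm)" .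
  have img: "rotate_box p q ` (Lp - Lm) = (\<lambda>i. rotate_box p q (b (n + 1 - i))) ` {1..n}"
    unfolding D(5) by (rule rotated_corners[of p q b n, symmetric])
  have card: "card (rotate_box p q ` (Lp - Lm)) = n"
    using card_image[OF inj_on_subset[OF inj, of "Lp - Lm"]] D by blast
  have steps: "fst (rotate_box p q (b (n + 1 - (i + 1)))) < fst (rotate_box p q (b (n + 1 - i))) \<and>
      snd (rotate_box p q (b (n + 1 - i))) < snd (rotate_box p q (b (n + 1 - (i + 1))))" if "1 \<le> i \<and> i \<le> n - 1" for i
  proof -
    define j where "j = n - i"
    have j: "1 \<le> j" "j < j + 1" "j + 1 \<le> n" "n + 1 - (i + 1) = j" "n + 1 - i = j + 1"
      using that by (auto simp: j_def)
    have "b j \<in> R" "b (j + 1) \<in> R" using diagonal_in[OF d] j D(4) by force+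
    then show ?thesis using diagonal_mono[OF d j(1-3)] unfolding j(4,5) by (auto simp: rotate_box_def R_def rect_def)
  qed
  show ?thesis
    unfolding diagonal_def R_def[symmetric]
  proof (intro conjI allI impI)
    show "young_diagram (rotate_box p q ` (R - Lp))" "young_diagram (rotate_box p q ` (R - Lm))"
      unfolding R_def using young_complement D unfolding R_def by blast+
    show "rotate_box p q ` (R - Lp) \<subseteq> rotate_box p q ` (R - Lm)" using D by blast
    show "rotate_box p q ` (R - Lm) \<subseteq> R" unfolding R_def by (rule rotate_image_subset) blast
    show "rotate_box p q ` (R - Lm) - rotate_box p q ` (R - Lp) = (\<lambda>i. rotate_box p q (b (n + 1 - i))) ` {1..n}"
      unfolding diff img ..
    show "card (rotate_box p q ` (R - Lm) - rotate_box p q ` (R - Lp)) = n" unfolding diff by (rule card)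
  qed (use steps in blast)+
qed

lemma diagonal_filling_rotate:
  assumes d: "diagonal n (rect p q) Lm Lp b" and e': "\<And>i. i \<in> {1..n} \<Longrightarrow> e' i = K - e (n + 1 - i)"
  shows "rotate_filling p q K (diagonal_filling n b e)
    = diagonal_filling n (\<lambda>i. rotate_box p q (b (n + 1 - i))) e'"
proof
  fix y
  have bR: "b i \<in> rect p q" if "i \<in> {1..n}" for i
    using diagonal_in[OF d that] d unfolding diagonal_def by blast
  have flip: "n + 1 - i \<in> {1..n}" "n + 1 - (n + 1 - i) = i" if "i \<in> {1..n}" for i using that by auto
  have "rotate_filling p q K (diagonal_filling n b e) y = Some x \<longleftrightarrow>
    diagonal_filling n (\<lambda>i. rotate_box p q (b (n + 1 - i))) e' y = Some x" for x
  proof -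
    have "rotate_filling p q K (diagonal_filling n b e) y = Some x \<longleftrightarrow>
      y \<in> rect p q \<and> diagonal_filling n b e (rotate_box p q y) = Some (K - x)"
      by (cases "diagonal_filling n b e (rotate_box p q y)") (auto simp: rotate_filling_def)
    also have "\<dots> \<longleftrightarrow> y \<in> rect p q \<and> (\<exists>i\<in>{1..n}. rotate_box p q y = b i \<and> K - x = e i)"
      unfolding diagonal_filling_Some[OF d] ..
    also have "\<dots> \<longleftrightarrow> (\<exists>i\<in>{1..n}. y = rotate_box p q (b i) \<and> x = K - e i)"
    proof (intro iffI)
      assume a: "y \<in> rect p q \<and> (\<exists>i\<in>{1..n}. rotate_box p q y = b i \<and> K - x = e i)"
      then obtain i where i: "i \<in> {1..n}" "rotate_box p q y = b i" "K - x = e i" by blast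
      have "y = rotate_box p q (b i)" using a unfolding i(2)[symmetric] by simp
      moreover have "x = K - e i" using i(3) by simp
      ultimately show "\<exists>i\<in>{1..n}. y = rotate_box p q (b i) \<and> x = K - e i" using i(1) by blast
    next
      assume "\<exists>i\<in>{1..n}. y = rotate_box p q (b i) \<and> x = K - e i"
      then obtain i where i: "i \<in> {1..n}" "y = rotate_box p q (b i)" "x = K - e i" by blast
      have "y \<in> rect p q" "rotate_box p q y = b i" "K - x = e i" using i(2,3) bR[OF i(1)] by simp_all
      then show "y \<in> rect p q \<and> (\<exists>i\<in>{1..n}. rotate_box p q y = b i \<and> K - x = e i)" using i(1) by blast
    qed
    also have "\<dots> \<longleftrightarrow> (\<exists>i\<in>{1..n}. y = rotate_box p q (b (n + 1 - i)) \<and> x = e' i)"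
      using flip e' by metis
    also have "\<dots> \<longleftrightarrow> diagonal_filling n (\<lambda>i. rotate_box p q (b (n + 1 - i))) e' y = Some x"
      unfolding diagonal_filling_Some[OF diagonal_rotate[OF d]] ..
    finally show ?thesis .
  qed
  then show "rotate_filling p q K (diagonal_filling n b e) y
    = diagonal_filling n (\<lambda>i. rotate_box p q (b (n + 1 - i))) e' y"
    by (metis not_Some_eq)
qed

lemma upper_output_rotate:
  assumes d: "diagonal n (rect p q) Lm Lp b"
    and w: "\<And>i. i \<in> {1..n} \<Longrightarrow> w i \<in> {1..n}" and U: "upper_output m n (rect p q) Lm b w U"
  shows "lower_output n (rotate_box p q ` (rect p q - Lm)) (\<lambda>i. rotate_box p q (b (n + 1 - i)))
    (\<lambda>i. n + 1 - w (n + 1 - i)) (rotate_filling p q (int (m * n) + 1) U)"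
proof -
  define K where "K = int (m * n) + 1"
  define b' where "b' i = rotate_box p q (b (n + 1 - i))" for i
  define U0 where "U0 = diagonal_filling n b (\<lambda>i. int (w i) + (int m - 1) * int n)"
  note d' = diagonal_rotate[OF d, folded b'_def]
  have img: "b ` {1..n} = Lp - Lm" "Lp \<subseteq> rect p q" using d unfolding diagonal_def by blast+
  have b': "b' ` {1..n} = rotate_box p q ` b ` {1..n}"
    unfolding b'_def by (rule rotated_corners[of p q b n])
  have "dom U0 = b ` {1..n}" unfolding U0_def using diagonal_filling_Some[OF d] by (auto simp: dom_def)
  then have inv0: "b ` {1..n} \<subseteq> dom U0" "dom U0 \<subseteq> rect p q - Lm" using img by blast+
  have run: "(upper_step n (rect p q) Lm b)\<^sup>*\<^sup>* U0 U" "dom U = rect p q - Lm"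
    using U unfolding upper_output_def U0_def by blast+
  have "(lower_step n (rotate_box p q ` (rect p q - Lm)) b')\<^sup>*\<^sup>* (rotate_filling p q K U0) (rotate_filling p q K U)
    \<and> b ` {1..n} \<subseteq> dom U \<and> dom U \<subseteq> rect p q - Lm"
    using run(1)
  proof (induction rule: rtranclp_induct)
    case base then show ?case using inv0 by simp
  next
    case (step U1 U2)
    have "lower_step n (rotate_box p q ` (rect p q - Lm)) b' (rotate_filling p q K U1) (rotate_filling p q K U2) \<and>
      b ` {1..n} \<subseteq> dom U2 \<and> dom U2 \<subseteq> rect p q - Lm"
      by (rule upper_step_rotate[OF step(2) _ _ b']) (use step(3) in simp_all)
    then show ?case using rtranclp.rtrancl_into_rtrancl[OF conjunct1[OF step(3)], of "rotate_filling p q K U2"] by simp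
  qed
  moreover have "rotate_filling p q K U0 = diagonal_filling n b' (\<lambda>i. int (n + 1 - w (n + 1 - i)))"
    unfolding U0_def b'_def
  proof (rule diagonal_filling_rotate[OF d])
    fix i assume i: "i \<in> {1..n}"
    have "n + 1 - i \<in> {1..n}" using i by auto
    then have "w (n + 1 - i) \<le> n" using w by auto
    \<comment> \<open>The upper construction starts with the last \<open>n\<close> numbers up to
      \<open>m * n\<close>; subtracting them from \<open>m * n + 1\<close> returns to
      \<open>1, ..., n\<close>.\<close>
    then show "int (n + 1 - w (n + 1 - i)) = K - (int (w (n + 1 - i)) + (int m - 1) * int n)"
      by (simp add: K_def algebra_simps of_nat_diff)
  qed
  moreover have "dom (rotate_filling p q K U) = rotate_box p q ` (rect p q - Lm)"
    using dom_rotate_filling[of U p q K] run(2) by simp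
  ultimately show ?thesis unfolding lower_output_def K_def[symmetric] b'_def by simp
qed

lemma lower_output_rotate:
  assumes d: "diagonal n (rect p q) Lm Lp b"
    and w: "\<And>i. i \<in> {1..n} \<Longrightarrow> w i \<in> {1..n}"
    and V: "lower_output n (rotate_box p q ` (rect p q - Lm)) (\<lambda>i. rotate_box p q (b (n + 1 - i)))
      (\<lambda>i. n + 1 - w (n + 1 - i)) V"
  shows "upper_output m n (rect p q) Lm b w (rotate_filling p q (int (m * n) + 1) V)"
proof -
  define K where "K = int (m * n) + 1"
  define b' where "b' i = rotate_box p q (b (n + 1 - i))" for i
  define M where "M = rotate_box p q ` (rect p q - Lm)"
  define U0 where "U0 = diagonal_filling n b (\<lambda>i. int (w i) + (int m - 1) * int n)"
  define V0 where "V0 = diagonal_filling n b' (\<lambda>i. int (n + 1 - w (n + 1 - i)))"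
  note d' = diagonal_rotate[OF d, folded b'_def]
  have img: "b ` {1..n} = Lp - Lm" "Lp \<subseteq> rect p q" using d unfolding diagonal_def by blast+
  have b': "b' ` {1..n} = rotate_box p q ` b ` {1..n}" unfolding b'_def by (rule rotated_corners[of p q b n])
  have bR: "b ` {1..n} \<subseteq> rect p q" using img by blast
  have dV0: "dom V0 = b' ` {1..n}" unfolding V0_def using diagonal_filling_Some[OF d'] by (auto simp: dom_def)
  then have inv0: "b' ` {1..n} \<subseteq> dom V0" "dom V0 \<subseteq> M" using img unfolding b' M_def by blast+
  have run: "(lower_step n M b')\<^sup>*\<^sup>* V0 V" "dom V = M"
    using V unfolding lower_output_def V0_def M_def b'_def by blast+
  have "(upper_step n (rect p q) Lm b)\<^sup>*\<^sup>* (rotate_filling p q K V0) (rotate_filling p q K V)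
    \<and> b' ` {1..n} \<subseteq> dom V \<and> dom V \<subseteq> M"
    using run(1)
  proof (induction rule: rtranclp_induct)
    case base then show ?case using inv0 by simp
  next
    case (step V1 V2)
    have "upper_step n (rect p q) Lm b (rotate_filling p q K V1) (rotate_filling p q K V2) \<and>
      b' ` {1..n} \<subseteq> dom V2 \<and> dom V2 \<subseteq> M"
      unfolding M_def
      by (rule lower_step_rotate[OF step(2)[unfolded M_def] _ _ b' bR]) (use step(3) M_def in simp_all)
    then show ?case using rtranclp.rtrancl_into_rtrancl[OF conjunct1[OF step(3)], of "rotate_filling p q K V2"] by simp
  qed
  moreover have "rotate_filling p q K U0 = V0"
    unfolding U0_def V0_def b'_def
  proof (rule diagonal_filling_rotate[OF d])
    fix i assume i: "i \<in> {1..n}"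
    have "n + 1 - i \<in> {1..n}" using i by auto
    then have "w (n + 1 - i) \<le> n" using w by auto
    then show "int (n + 1 - w (n + 1 - i)) = K - (int (w (n + 1 - i)) + (int m - 1) * int n)"
      by (simp add: K_def algebra_simps of_nat_diff)
  qed
  moreover have "dom U0 \<subseteq> rect p q"
  proof -
    have "dom U0 = b ` {1..n}" unfolding U0_def using diagonal_filling_Some[OF d] by (auto simp: dom_def)
    then show ?thesis using bR by simp
  qed
  then have "rotate_filling p q K (rotate_filling p q K U0) = U0" by (rule rotate_filling_twice)
  moreover have "dom (rotate_filling p q K V) = rect p q - Lm"
  proof -
    have "M \<subseteq> rect p q" unfolding M_def by (rule rotate_image_subset) blast
    then have "dom (rotate_filling p q K V) = rotate_box p q ` M" using dom_rotate_filling[of V p q K] run(2) by simp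
    also have "\<dots> = rect p q - Lm" unfolding M_def by (rule rotate_image_image) blast
    finally show ?thesis .
  qed
  ultimately show ?thesis unfolding upper_output_def K_def[symmetric] U0_def[symmetric] by simp
qed

section \<open>The common tableau of all diagonals\<close>

lemma standard_young_tableau_swap:
  assumes "standard_young_tableau L T"
  shows "standard_young_tableau (prod.swap ` L) (T \<circ> prod.swap)"
proof -
  note S = assms[unfolded standard_young_tableau_def]
  have mem: "(r, c) \<in> prod.swap ` L \<longleftrightarrow> (c, r) \<in> L" for r c by force
  show ?thesis
    unfolding standard_young_tableau_def
  proof (intro conjI allI impI)
    show "dom (T \<circ> prod.swap) = prod.swap ` L"
    proof (intro set_eqI)
      fix y show "y \<in> dom (T \<circ> prod.swap) \<longleftrightarrow> y \<in> prod.swap ` L"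
        using S mem[of "fst y" "snd y"] by (cases y) (auto simp: domIff)
    qed
    have "bij_betw prod.swap (prod.swap ` L) L"
      by (rule bij_betw_byWitness[of _ prod.swap]) auto
    then have "bij_betw ((\<lambda>x. the (T x)) \<circ> prod.swap) (prod.swap ` L) {1..int (card L)}"
      using S bij_betw_trans by blast
    moreover have "card (prod.swap ` L) = card L" by (rule card_image) (rule inj_on_inverseI[of _ prod.swap], simp)
    ultimately show "bij_betw (\<lambda>x. the ((T \<circ> prod.swap) x)) (prod.swap ` L) {1..int (card (prod.swap ` L))}"
      by (simp add: comp_def)
  qed (use S mem in auto)
qed

lemma exists_tableau:
  assumes nm: "1 \<le> n" "n \<le> m" and pq: "(p = n \<and> q = m) \<or> (p = m \<and> q = n)"
    and idx_range: "\<And>x. idx x \<in> {1..n}" and idx_eq: "\<And>x y. idx x = idx y \<longleftrightarrow> int n dvd x - y"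
  defines "idx' \<equiv> \<lambda>x. n + 1 - idx (int (m * n) + 1 - x)"
  shows "\<exists>F. standard_young_tableau (rect p q) (\<lambda>y. if y \<in> rect p q then Some (F y) else None) \<and>
    forced n idx (\<lambda>L b. \<exists>Lm. diagonal n (rect p q) Lm L b) F \<and>
    forced n idx' (\<lambda>L b. \<exists>Lm. diagonal n (rect p q) Lm L b) (\<lambda>y. int (m * n) + 1 - F (rotate_box p q y))"
proof -
  have idx'_range: "idx' x \<in> {1..n}" and idx'_eq: "idx' x = idx' y \<longleftrightarrow> int n dvd x - y" for x y
    unfolding idx'_def by (rule rotated_index[OF idx_range idx_eq])+
  show ?thesis
    using pq
  proof
    assume r: "p = n \<and> q = m"
    obtain G where G: "standard_young_tableau (rect n m) (\<lambda>y. if y \<in> rect n m then Some (G y) else None)"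
      "forced n idx (row_shape n m idx) G"
      "forced n idx' (row_shape n m idx') (\<lambda>y. int (m * n) + 1 - G (n + 1 - fst y, m + 1 - snd y))"
      using exists_tableau_rows[OF nm idx_range idx_eq] unfolding idx'_def by blast
    have shape: "row_shape n m i0 L b"
      if d: "diagonal n (rect p q) Lm L b" and i0: "\<And>x. i0 x \<in> {1..n}" "\<And>x y. i0 x = i0 y \<longleftrightarrow> int n dvd x - y"
      for i0 Lm L b
      unfolding row_shape_def
    proof (intro conjI ballI)
      show "corners n i0 L b" by (rule diagonal_corners[OF _ d nm(1) i0]) (use r in simp)
      show "L \<subseteq> rect n m" using d r unfolding diagonal_def by simp
      show "fst (b i) = n + 1 - i" if "i \<in> {1..n}" for i using diagonal_rows[of n m Lm L b i] d r that by simp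
    qed
    have "forced n idx (\<lambda>L b. \<exists>Lm. diagonal n (rect p q) Lm L b) G"
      by (rule forcedI, elim exE, rule forcedD[OF G(2) shape[OF _ idx_range idx_eq]])
    moreover have "forced n idx' (\<lambda>L b. \<exists>Lm. diagonal n (rect p q) Lm L b) (\<lambda>y. int (m * n) + 1 - G (rotate_box p q y))"
    proof (rule forcedI, elim exE)
      fix L b cv T y Lm
      assume a: "corners.state n idx' L b 0 cv {} T" "corners.dominated idx' b 0 T" "y \<in> L"
        "diagonal n (rect p q) Lm L b"
      have "row_shape n m idx' L b" by (rule shape[OF a(4) idx'_range idx'_eq])
      from forcedD[OF G(3) this a(1-3)] show "T y = Some (int (m * n) + 1 - G (rotate_box p q y))"
        using r by (simp add: rotate_box_def)
    qed
    ultimately show ?thesis using G(1) r by blast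
  next
    assume c: "p = m \<and> q = n"
    \<comment> \<open>The reversed index of the transposed shape. Reversal commutes with passing to
      the rotated index, so one application of the row case serves both halves.\<close>
    define idx1 where "idx1 = (\<lambda>x. n + 1 - idx x)"
    have idx1: "idx1 x \<in> {1..n}" "idx1 x = idx1 y \<longleftrightarrow> int n dvd x - y" for x y
      using idx_range[of x] idx_range[of y] idx_eq[of x y] by (auto simp: idx1_def)
    have idx1': "(\<lambda>x. n + 1 - idx1 (int (m * n) + 1 - x)) = (\<lambda>x. n + 1 - idx' x)"
      by (simp add: idx'_def idx1_def)
    obtain G where G: "standard_young_tableau (rect n m) (\<lambda>y. if y \<in> rect n m then Some (G y) else None)"
      "forced n idx1 (row_shape n m idx1) G"
      "forced n (\<lambda>x. n + 1 - idx' x) (row_shape n m (\<lambda>x. n + 1 - idx' x))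
        (\<lambda>y. int (m * n) + 1 - G (n + 1 - fst y, m + 1 - snd y))"
      using exists_tableau_rows[OF nm idx1] unfolding idx1' by blast
    have sw: "prod.swap ` rect n m = rect p q" using c by (auto simp: rect_def image_iff)
    have swapped: "T y = Some (F (prod.swap y))"
      if F: "forced n (\<lambda>x. n + 1 - i0 x) (row_shape n m (\<lambda>x. n + 1 - i0 x)) F"
        and i0: "\<And>x. i0 x \<in> {1..n}" "\<And>x y. i0 x = i0 y \<longleftrightarrow> int n dvd x - y"
        and d: "diagonal n (rect p q) Lm L b" and st: "corners.state n i0 L b 0 cv {} T"
        "corners.dominated i0 b 0 T" and y: "y \<in> L" for F i0 Lm L b cv T y
    proof -
      have C: "corners n i0 L b" by (rule diagonal_corners[OF _ d nm(1) i0]) (use c in simp)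
      interpret c: corners n i0 L b by (rule C)
      have "row_shape n m (\<lambda>x. n + 1 - i0 x) (prod.swap ` L) (\<lambda>i. prod.swap (b (n + 1 - i)))"
        unfolding row_shape_def
      proof (intro conjI ballI)
        show "corners n (\<lambda>x. n + 1 - i0 x) (prod.swap ` L) (\<lambda>i. prod.swap (b (n + 1 - i)))" by (rule c.transpose)
        have "L \<subseteq> rect p q" using d unfolding diagonal_def by simp
        then show "prod.swap ` L \<subseteq> rect n m" using c by (auto simp: rect_def)
        fix i assume "i \<in> {1..n}"
        then have "n + 1 - i \<in> {1..n}" by auto
        then show "fst (prod.swap (b (n + 1 - i))) = n + 1 - i"
          using diagonal_cols[of n m Lm L b "n + 1 - i"] d c by simp
      qed
      moreover have "corners.state n (\<lambda>x. n + 1 - i0 x) (prod.swap ` L) (\<lambda>i. prod.swap (b (n + 1 - i)))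
        0 (\<lambda>i. cv (n + 1 - i)) {} (T \<circ> prod.swap)"
        using c.state_swap[OF st(1)] by simp
      moreover have "corners.dominated (\<lambda>x. n + 1 - i0 x) (\<lambda>i. prod.swap (b (n + 1 - i))) 0 (T \<circ> prod.swap)"
        by (rule c.dominated_swap[OF st])
      moreover have "prod.swap y \<in> prod.swap ` L" using y by (rule imageI)
      ultimately have "(T \<circ> prod.swap) (prod.swap y) = Some (F (prod.swap y))" by (rule forcedD[OF F])
      then show ?thesis by simp
    qed
    show ?thesis
    proof (intro exI[of _ "\<lambda>y. G (prod.swap y)"] conjI)
      have "(\<lambda>y. if y \<in> rect n m then Some (G y) else None) \<circ> prod.swap
        = (\<lambda>y. if y \<in> rect p q then Some (G (prod.swap y)) else None)"
        using c by (auto simp: fun_eq_iff rect_def)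
      then show "standard_young_tableau (rect p q) (\<lambda>y. if y \<in> rect p q then Some (G (prod.swap y)) else None)"
        using standard_young_tableau_swap[OF G(1)] unfolding sw by simp
      show "forced n idx (\<lambda>L b. \<exists>Lm. diagonal n (rect p q) Lm L b) (\<lambda>y. G (prod.swap y))"
        by (rule forcedI, elim exE, rule swapped[OF G(2)[unfolded idx1_def] idx_range idx_eq])
      show "forced n idx' (\<lambda>L b. \<exists>Lm. diagonal n (rect p q) Lm L b)
        (\<lambda>y. int (m * n) + 1 - G (prod.swap (rotate_box p q y)))"
      proof (rule forcedI, elim exE)
        fix L b cv T y Lm
        assume a: "corners.state n idx' L b 0 cv {} T" "corners.dominated idx' b 0 T" "y \<in> L"
          "diagonal n (rect p q) Lm L b"
        from swapped[OF G(3) idx'_range idx'_eq a(4) a(1-3)]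
        show "T y = Some (int (m * n) + 1 - G (prod.swap (rotate_box p q y)))"
          using c by (simp add: rotate_box_def)
      qed
    qed
  qed
qed

lemma T_lower_eq:
  assumes pq: "p = n \<or> q = n" and d: "diagonal n (rect p q) Lm Lp b"
    and n1: "1 \<le> n" and idx: "\<And>x. idx x \<in> {1..n}" "\<And>x y. idx x = idx y \<longleftrightarrow> int n dvd x - y"
    and w: "\<And>i. i \<in> {1..n} \<Longrightarrow> idx (int (w i)) = i \<and> w i \<in> {1..n}"
    and F: "forced n idx (\<lambda>L b. \<exists>Lm. diagonal n (rect p q) Lm L b) F"
  shows "T_lower n Lp b w = (\<lambda>y. if y \<in> Lp then Some (F y) else None)"
proof -
  have eq: "T = (\<lambda>y. if y \<in> Lp then Some (F y) else None)" if T: "lower_output n Lp b w T" for T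
  proof
    fix y
    obtain cv where st: "corners.state n idx Lp b 0 cv {} T" "corners.dominated idx b 0 T"
      using lower_output_state(2)[OF pq d n1 idx w T] by blast
    have dT: "dom T = Lp" using T unfolding lower_output_def by simp
    show "T y = (if y \<in> Lp then Some (F y) else None)"
    proof (cases "y \<in> Lp")
      case True
      have "T y = Some (F y)" by (rule forcedD[OF F exI[of _ Lm] st True]) (rule d)
      then show ?thesis using True by simp
    next
      case False then show ?thesis using dT by auto
    qed
  qed
  obtain T where T: "lower_output n Lp b w T" using lower_output_state(1)[OF pq d n1 idx w] by blast
  show ?thesis unfolding T_lower_def
    by (rule the_equality) (use T eq in metis, rule eq)
qed

lemma T_upper_eq:
  assumes pq: "p = n \<or> q = n" and d: "diagonal n (rect p q) Lm Lp b"
    and n1: "1 \<le> n" and idx: "\<And>x. idx' x \<in> {1..n}" "\<And>x y. idx' x = idx' y \<longleftrightarrow> int n dvd x - y"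
    and w: "\<And>i. i \<in> {1..n} \<Longrightarrow> w i \<in> {1..n}"
    and w': "\<And>i. i \<in> {1..n} \<Longrightarrow> idx' (int (n + 1 - w (n + 1 - i))) = i"
    and F: "forced n idx' (\<lambda>L b. \<exists>Lm. diagonal n (rect p q) Lm L b) (\<lambda>y. int (m * n) + 1 - F (rotate_box p q y))"
  shows "T_upper m n (rect p q) Lm b w = (\<lambda>y. if y \<in> rect p q - Lm then Some (F y) else None)"
proof -
  let ?w' = "\<lambda>i. n + 1 - w (n + 1 - i)" and ?M = "rotate_box p q ` (rect p q - Lm)"
    and ?b' = "\<lambda>i. rotate_box p q (b (n + 1 - i))"
  note d' = diagonal_rotate[OF d]
  have w'2: "idx' (int (?w' i)) = i \<and> ?w' i \<in> {1..n}" if i: "i \<in> {1..n}" for i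
  proof -
    have "n + 1 - i \<in> {1..n}" using i by auto
    then have "w (n + 1 - i) \<in> {1..n}" by (rule w)
    then show ?thesis using w'[OF i] by auto
  qed
  have eq: "U = (\<lambda>y. if y \<in> rect p q - Lm then Some (F y) else None)" if U: "upper_output m n (rect p q) Lm b w U" for U
  proof
    fix y
    define V where "V = rotate_filling p q (int (m * n) + 1) U"
    have V: "lower_output n ?M ?b' ?w' V" unfolding V_def by (rule upper_output_rotate[OF d w U])
    obtain cv where st: "corners.state n idx' ?M ?b' 0 cv {} V" "corners.dominated idx' ?b' 0 V"
      using lower_output_state(2)[OF pq d' n1 idx w'2 V] by blast
    have dU: "dom U = rect p q - Lm" using U unfolding upper_output_def by simp
    show "U y = (if y \<in> rect p q - Lm then Some (F y) else None)"
    proof (cases "y \<in> rect p q - Lm")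
      case True
      then have yR: "y \<in> rect p q" by blast
      have yM: "rotate_box p q y \<in> ?M" using True by (rule imageI)
      have "V (rotate_box p q y) = Some (int (m * n) + 1 - F (rotate_box p q (rotate_box p q y)))"
        by (rule forcedD[OF F exI[of _ "rotate_box p q ` (rect p q - Lp)"] st yM]) (rule d')
      moreover have "V (rotate_box p q y) = map_option (\<lambda>x. int (m * n) + 1 - x) (U y)"
        using yR by (simp add: V_def rotate_filling_def)
      ultimately show ?thesis using True yR by (cases "U y") auto
    next
      case False
      then have "y \<notin> dom U" unfolding dU .
      then have "U y = None" by (simp add: domIff)
      then show ?thesis using False by (simp only: if_False)
    qed
  qed
  obtain V where V: "lower_output n ?M ?b' ?w' V" using lower_output_state(1)[OF pq d' n1 idx w'2] by blast
  have U: "upper_output m n (rect p q) Lm b w (rotate_filling p q (int (m * n) + 1) V)"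
    by (rule lower_output_rotate[OF d w V])
  show ?thesis unfolding T_upper_def
    by (rule the_equality) (use U eq in metis, rule eq)
qed

theorem theorem1p2:
  fixes m n p q :: nat and R :: "box set" and w :: "nat \<Rightarrow> nat"
  assumes "1 \<le> n" and "n \<le> m"
    and "(p = n \<and> q = m) \<or> (p = m \<and> q = n)"
    and "R = rect p q"
    and "w permutes {1..n}"
  shows "(\<forall>Lm Lp b. diagonal n R Lm Lp b \<longrightarrow>
            standard_young_tableau R (T_glued m n R Lm Lp b w)) \<and>
         (\<forall>Lm Lp b Lm' Lp' b'. diagonal n R Lm Lp b \<and> diagonal n R Lm' Lp' b' \<longrightarrow>
            T_glued m n R Lm Lp b w = T_glued m n R Lm' Lp' b' w)"
proof -
  have n0: "0 < int n" using assms(1) by simp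
  \<comment> \<open>Box \<open>b i\<close> starts with \<open>w i\<close>, so a letter gets its
    index by applying \<open>inv w\<close> to its residue in \<open>1, ..., n\<close>. The shifts by
    one make \<open>n\<close>, and not \<open>0\<close>, the representative of the multiples of
    \<open>n\<close>.\<close>
  define idx where "idx x = inv w (nat ((x - 1) mod int n) + 1)" for x :: int
  have idx_range: "idx x \<in> {1..n}" for x
  proof -
    have "0 \<le> (x - 1) mod int n" "(x - 1) mod int n < int n" using n0 by auto
    then have "nat ((x - 1) mod int n) + 1 \<in> {1..n}" by auto
    then show ?thesis unfolding idx_def using permutes_in_image[OF permutes_inv[OF assms(5)]] by blast
  qed
  have idx_eq: "idx x = idx y \<longleftrightarrow> int n dvd x - y" for x y
  proof -
    have "idx x = idx y \<longleftrightarrow> nat ((x - 1) mod int n) = nat ((y - 1) mod int n)"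
      unfolding idx_def using inj_eq[OF permutes_inj[OF permutes_inv[OF assms(5)]]] by simp
    also have "\<dots> \<longleftrightarrow> (x - 1) mod int n = (y - 1) mod int n" using n0 by (simp add: nat_eq_iff)
    also have "\<dots> \<longleftrightarrow> int n dvd x - y" unfolding mod_eq_dvd_iff by simp
    finally show ?thesis .
  qed
  have w: "w i \<in> {1..n}" if "i \<in> {1..n}" for i using that permutes_in_image[OF assms(5)] by blast
  have idx_w: "idx (int (w i)) = i \<and> w i \<in> {1..n}" if "i \<in> {1..n}" for i
  proof -
    have "nat ((int (w i) - 1) mod int n) + 1 = w i" using w[OF that] by (simp add: nat_diff_distrib' mod_pos_pos_trivial)
    then have "idx (int (w i)) = inv w (w i)" unfolding idx_def by (simp only:)
    then show ?thesis using w[OF that] permutes_inverses(2)[OF assms(5)] by simp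
  qed
  define idx' where "idx' = (\<lambda>x. n + 1 - idx (int (m * n) + 1 - x))"
  have idx'_range: "idx' x \<in> {1..n}" and idx'_eq: "idx' x = idx' y \<longleftrightarrow> int n dvd x - y" for x y
    unfolding idx'_def by (rule rotated_index[OF idx_range idx_eq])+
  have idx'_w: "idx' (int (n + 1 - w (n + 1 - i))) = i" if i: "i \<in> {1..n}" for i
  proof -
    have j: "n + 1 - i \<in> {1..n}" using i by auto
    have "idx (int (m * n) + 1 - int (n + 1 - w (n + 1 - i))) = idx (int (w (n + 1 - i)))"
      unfolding idx_eq using w[OF j] by (auto simp: of_nat_diff)
    then show ?thesis using idx_w[OF j] i by (auto simp: idx'_def)
  qed
  obtain F where F: "standard_young_tableau (rect p q) (\<lambda>y. if y \<in> rect p q then Some (F y) else None)"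
    "forced n idx (\<lambda>L b. \<exists>Lm. diagonal n (rect p q) Lm L b) F"
    "forced n idx' (\<lambda>L b. \<exists>Lm. diagonal n (rect p q) Lm L b) (\<lambda>y. int (m * n) + 1 - F (rotate_box p q y))"
    using exists_tableau[OF assms(1-3) idx_range idx_eq] unfolding idx'_def by blast
  have glued: "T_glued m n R Lm Lp b w = (\<lambda>y. if y \<in> R then Some (F y) else None)"
    if d: "diagonal n R Lm Lp b" for Lm Lp b
  proof -
    have d': "diagonal n (rect p q) Lm Lp b" using d assms(4) by simp
    have pq: "p = n \<or> q = n" using assms(3) by blast
    have lower: "T_lower n Lp b w = (\<lambda>y. if y \<in> Lp then Some (F y) else None)"
      by (rule T_lower_eq[OF pq d' assms(1) idx_range idx_eq idx_w F(2)])
    have upper: "T_upper m n R Lm b w = (\<lambda>y. if y \<in> R - Lm then Some (F y) else None)"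
      unfolding assms(4) by (rule T_upper_eq[OF pq d' assms(1) idx'_range idx'_eq w idx'_w F(3)])
    have "Lm \<subseteq> Lp" "Lp \<subseteq> R" using d unfolding diagonal_def by blast+
    then show ?thesis unfolding T_glued_def lower upper by (intro ext) auto
  qed
  have "standard_young_tableau R (\<lambda>y. if y \<in> R then Some (F y) else None)" using F(1) assms(4) by simp
  then show ?thesis using glued by simp
qed

end
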